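(* Let $a, b, c \in \{2, 3, 4, \dots\} \cup \{\infty\}$ and suppose that $\max\{a,b\} \le c$. Then there exists a code $\mathcal{C}_{(a,b,c)}$ with embedding dimension vector $(a,b,c)$, i.e. $\operatorname{odim}(\mathcal{C}_{(a,b,c)}) = a$, $\operatorname{cdim}(\mathcal{C}_{(a,b,c)}) = b$, and $\operatorname{nddim}(\mathcal{C}_{(a,b,c)}) = c$.
   Context: A code is a collection $\mathcal{C} \subseteq 2^{S}$ of subsets of a finite set $S$ (for instance $S = [n] = \{1,\dots,n\}$), where $S$ is called a base set for $\mathcal{C}$; its elements are called codewords. By convention $\emptyset$ is a codeword of every code. For a collection $\mathcal{U} = \{U_i\}_{i \in S}$ of subsets of $\mathbb{R}^d$ indexed by $S$ (sets in the collection may be empty), the code of $\mathcal{U}$ is $$\operatorname{code}(\mathcal{U}) = \{\sigma \subseteq S \mid \text{there exists } p \in \mathbb{R}^d \text{ such that } p \in U_i \text{ if and only if } i \in \sigma\},$$ and $\mathcal{U}$ is called a realization of $\operatorname{code}(\mathcal{U})$. A realization is open (resp. closed) convex if all sets in it are convex and open (resp. convex and closed) in $\mathbb{R}^d$. A collection $\mathcal{U} = \{U_i\}$ of convex open sets is non-degenerate if $\operatorname{code}(\{\operatorname{cl}(U_i)\}) = \operatorname{code}(\mathcal{U})$. A collection $\mathcal{X} = \{X_i\}$ of closed convex sets is non-degenerate if $\operatorname{code}(\{\operatorname{int}(X_i)\}) = \operatorname{code}(\mathcal{X})$. Here $\operatorname{cl}$ and $\operatorname{int}$ denote closure and interior in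 $\mathbb{R}^d$. The embedding dimensions of $\mathcal{C}$ are defined as follows, with the minimum (over integers $d \ge 0$) of the empty set equal to $\infty$: - $\operatorname{odim}(\mathcal{C}) = \min\{d \mid \mathcal{C}$ has an open convex realization in $\mathbb{R}^d\}$; - $\operatorname{cdim}(\mathcal{C}) = \min\{d \mid \mathcal{C}$ has a closed convex realization in $\mathbb{R}^d\}$; - $\operatorname{nddim}(\mathcal{C}) = \min\{d \mid \mathcal{C}$ has a non-degenerate (open or closed) convex realization in $\mathbb{R}^d\}$. The embedding dimension vector of $\mathcal{C}$ is the triple $(\operatorname{odim}(\mathcal{C}), \operatorname{cdim}(\mathcal{C}), \operatorname{nddim}(\mathcal{C}))$. *)

theory Defs
  imports "HOL-Analysis.Analysis"
begin

text \<open>The minimum defining an embedding dimension ranges over all \<^term>\<open>d :: nat\<close>, so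
  $\mathbb{R}^d$ is rendered by the library's topology \<^term>\<open>Euclidean_space d\<close>: its points are
  the functions \<^term>\<open>x :: nat \<Rightarrow> real\<close> with \<^prop>\<open>\<forall>i\<ge>d. x i = 0\<close>, and open sets, closed sets, closures and
  interiors are taken relative to that topology (\<^const>\<open>openin\<close>, \<^const>\<open>closedin\<close>,
  \<^const>\<open>closure_of\<close>, \<^const>\<open>interior_of\<close>).\<close>

text \<open>The codewords alone do not determine the base set, so a code is given together with it.\<close>

definition is_code :: "'i set \<Rightarrow> 'i set set \<Rightarrow> bool" where
  "is_code S C \<longleftrightarrow> finite S \<and> C \<subseteq> Pow S \<and> {} \<in> C"

text \<open>The library's \<^const>\<open>convex\<close> with the vector operations written coordinatewise;
  the type \<^typ>\<open>nat \<Rightarrow> real\<close> is not an instance of \<^class>\<open>real_vector\<close>.\<close>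

definition convex_fun :: "(nat \<Rightarrow> real) set \<Rightarrow> bool" where
  "convex_fun A \<longleftrightarrow>
     (\<forall>x\<in>A. \<forall>y\<in>A. \<forall>u\<ge>0. \<forall>v\<ge>0. u + v = 1 \<longrightarrow> (\<lambda>i. u * x i + v * y i) \<in> A)"

definition code_of :: "nat \<Rightarrow> 'i set \<Rightarrow> ('i \<Rightarrow> (nat \<Rightarrow> real) set) \<Rightarrow> 'i set set" where
  "code_of d S U =
     {\<sigma>. \<sigma> \<subseteq> S \<and> (\<exists>p \<in> topspace (Euclidean_space d). \<forall>i\<in>S. p \<in> U i \<longleftrightarrow> i \<in> \<sigma>)}"

definition open_convex_realization ::
    "nat \<Rightarrow> 'i set \<Rightarrow> 'i set set \<Rightarrow> ('i \<Rightarrow> (nat \<Rightarrow> real) set) \<Rightarrow> bool" where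
  "open_convex_realization d S C U \<longleftrightarrow>
     (\<forall>i\<in>S. openin (Euclidean_space d) (U i) \<and> convex_fun (U i)) \<and> code_of d S U = C"

definition closed_convex_realization ::
    "nat \<Rightarrow> 'i set \<Rightarrow> 'i set set \<Rightarrow> ('i \<Rightarrow> (nat \<Rightarrow> real) set) \<Rightarrow> bool" where
  "closed_convex_realization d S C X \<longleftrightarrow>
     (\<forall>i\<in>S. closedin (Euclidean_space d) (X i) \<and> convex_fun (X i)) \<and> code_of d S X = C"

definition nondegenerate_open ::
    "nat \<Rightarrow> 'i set \<Rightarrow> ('i \<Rightarrow> (nat \<Rightarrow> real) set) \<Rightarrow> bool" where
  "nondegenerate_open d S U \<longleftrightarrow>
     code_of d S (\<lambda>i. Euclidean_space d closure_of U i) = code_of d S U"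

definition nondegenerate_closed ::
    "nat \<Rightarrow> 'i set \<Rightarrow> ('i \<Rightarrow> (nat \<Rightarrow> real) set) \<Rightarrow> bool" where
  "nondegenerate_closed d S X \<longleftrightarrow>
     code_of d S (\<lambda>i. Euclidean_space d interior_of X i) = code_of d S X"

text \<open>In \<^typ>\<open>enat\<close>, \<^const>\<open>Inf\<close> of a nonempty set is its minimum and \<^prop>\<open>Inf {} = (\<infinity> :: enat)\<close>.\<close>

definition odim :: "'i set \<Rightarrow> 'i set set \<Rightarrow> enat" where
  "odim S C = Inf {enat d | d. \<exists>U. open_convex_realization d S C U}"

definition cdim :: "'i set \<Rightarrow> 'i set set \<Rightarrow> enat" where
  "cdim S C = Inf {enat d | d. \<exists>X. closed_convex_realization d S C X}"

definition nddim :: "'i set \<Rightarrow> 'i set set \<Rightarrow> enat" where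
  "nddim S C = Inf {enat d | d.
     (\<exists>U. open_convex_realization d S C U \<and> nondegenerate_open d S U) \<or>
     (\<exists>X. closed_convex_realization d S C X \<and> nondegenerate_closed d S X)}"

definition embedding_dimension_vector :: "'i set \<Rightarrow> 'i set set \<Rightarrow> enat \<times> enat \<times> enat" where
  "embedding_dimension_vector S C = (odim S C, cdim S C, nddim S C)"

end

theory Submission
  imports Defs
begin

text \<open>
  Every lower bound comes from sunflowers: convex petals any two of which meet exactly in a common
  centre.  If there are more open petals than dimensions and one point is chosen in each, the convex
  hull of these points comes arbitrarily near the centre (theorem \<open>sunflower\<close>).  For closed petals the
  same holds if the centre is thick, that is, has interior points relative to a flat containing the
  petals (\<open>closed_sunflower\<close>), and it fails otherwise, since rays from one point form a planar
  sunflower.  Hence a convex set that touches every one of \<open>n\<close> petals and avoids the centre forces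
  dimension at least \<open>n\<close>, provided that it is open like the petals, or that it is compact and the centre
  is closed and thick.

  In the codes used here this convex set is the union of a chain of pieces, piece \<open>i\<close> touching petal
  \<open>i\<close>.  Its convexity and the thickness of the centre are imposed in three ways, each of which is felt
  by one kind of realization only.

  The first code has a neuron for the union of the chain.  Its convexity obstructs open realizations
  in low dimension, while in the plane closed petals can be rays crossing a line.

  The second code has no such neuron.  Closed pieces nevertheless have a convex union, forced by the
  way in which neighbours overlap (\<open>convex_Un_separated_overlap\<close>, \<open>convex_chain_Union\<close>), whereas open
  half planes with the same overlap pattern can go round a convex obstacle in the plane.  An ambient
  set that is covered by two disjoint sets up to a part of the centre makes the centre thick when
  all sets are closed (\<open>split_flower_thick\<close>).

  The third code keeps only the petals and the chain.  Closed planar realizations may have a thin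
  centre and open ones may bend, but a nondegenerate realization yields a closed one with a thick
  centre (\<open>nd_realizable_thick\<close>), and is obstructed.

  In dimension \<open>n\<close> all these sets can be realized together and nondegenerately, the centre being the
  positive orthant (\<open>private_flower_fat_realization\<close>).  For an infinite bound there are three petals
  and two pieces whose overlap is contained in the middle petal: a segment in the chain between the
  outer petals then meets all three petals, and the sunflower theorem applies to a plane through this
  segment and a point of the centre, whatever the dimension of the space.

  The code with the prescribed vector \<open>(a, b, c)\<close> is the disjoint union of a code of the first kind for
  \<open>a\<close>, one of the second kind for \<open>b\<close> and one of the third kind for \<open>c\<close>, realized in parallel slabs.
  Each of its dimensions is the largest of the three corresponding dimensions.  The open dimensions
  of the summands are \<open>a\<close> and twice at most 2, the closed ones \<open>b\<close> and twice at most 2; the nondegenerate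
  ones are at most \<open>a\<close>, at most \<open>b\<close> and equal to \<open>c\<close>, and this is where \<open>max a b \<le> c\<close> enters.
\<close>

section \<open>Convex geometry in inner product spaces\<close>

lemma nearest_point_inner_le:
  fixes S :: "'a::real_inner set"
  assumes "convex S" "c \<in> S" "x \<in> S" and near: "\<And>y. y \<in> S \<Longrightarrow> dist z c \<le> dist z y"
  shows "inner (z - c) (x - c) \<le> 0"
proof (rule ccontr)
  assume "\<not> ?thesis"
  then have "inner (z - c) (x - c) > 0" by simp
  from closer_point_lemma[OF this] obtain u where u: "u > 0" "u \<le> 1"
    "dist (c + u *\<^sub>R (x - c)) z < dist c z" by blast
  have "c + u *\<^sub>R (x - c) = (1 - u) *\<^sub>R c + u *\<^sub>R x"
    by (simp add: algebra_simps)
  also have "\<dots> \<in> S"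
    using assms u by (intro convexD) auto
  finally have "dist z c \<le> dist z (c + u *\<^sub>R (x - c))" by (rule near)
  then show False using u(3) by (simp add: dist_commute)
qed

lemma orthogonal_projection_exists:
  fixes x :: "'a::real_inner"
  assumes "finite T"
  shows "\<exists>y\<in>span T. \<forall>t\<in>span T. inner (x - y) t = 0"
  using assms
proof (induction T arbitrary: x)
  case empty
  then show ?case by auto
next
  case (insert t T)
  obtain p where p: "p \<in> span T" "\<And>s. s \<in> span T \<Longrightarrow> inner (t - p) s = 0"
    using insert.IH[of t] by blast
  obtain q where q: "q \<in> span T" "\<And>s. s \<in> span T \<Longrightarrow> inner (x - q) s = 0"
    using insert.IH[of x] by blast
  define w where "w = t - p"
  define y where "y = q + (inner (x - q) w / inner w w) *\<^sub>R w"
  have sub: "span T \<subseteq> span (insert t T)" by (rule span_mono) auto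
  have wi: "w \<in> span (insert t T)"
    unfolding w_def using p(1) sub by (intro span_diff) (auto intro: span_base)
  have yi: "y \<in> span (insert t T)"
    unfolding y_def using q(1) sub wi by (intro span_add span_scale) auto
  have yT: "inner (x - y) s = 0" if "s \<in> span T" for s
    using p(2)[OF that] q(2)[OF that] by (simp add: y_def w_def algebra_simps inner_diff_left inner_add_left)
  have yw: "inner (x - y) w = 0"
    by (cases "w = 0") (simp_all add: y_def inner_diff_left inner_add_left)
  have "inner (x - y) s = 0" if s: "s \<in> span (insert t T)" for s
  proof -
    obtain k where k: "s - k *\<^sub>R t \<in> span T"
      using s span_breakdown_eq[of s t T] by blast
    have "s = (s - k *\<^sub>R t + k *\<^sub>R p) + k *\<^sub>R w" by (simp add: w_def algebra_simps)
    moreover have "s - k *\<^sub>R t + k *\<^sub>R p \<in> span T" using k p(1) by (intro span_add span_scale)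
    ultimately show ?thesis using yT yw by (metis add_0 inner_add_right inner_scaleR_right mult_zero_right)
  qed
  then show ?case using yi by blast
qed

lemma closed_span_finite:
  fixes B :: "'a::real_inner set"
  assumes "finite B"
  shows "closed (span B)"
proof -
  have "x \<in> span B" if x: "x \<in> closure (span B)" for x
  proof -
    obtain y where y: "y \<in> span B" "\<And>t. t \<in> span B \<Longrightarrow> inner (x - y) t = 0"
      using orthogonal_projection_exists[OF assms] by blast
    have "closed {w. inner (x - y) w = 0}"
      by (intro closed_Collect_eq continuous_intros)
    then have "closure (span B) \<subseteq> {w. inner (x - y) w = 0}"
      using y(2) by (intro closure_minimal) auto
    then have "inner (x - y) x = 0" using x by auto
    then have "inner (x - y) (x - y) = 0" using y by (simp add: inner_diff_right)
    then show ?thesis using y by simp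
  qed
  then have "closure (span B) \<subseteq> span B" by blast
  then show ?thesis by (simp add: closure_subset_eq)
qed

text \<open>The trace of a flat \<^term>\<open>(+) a ` span B\<close> on a level hyperplane of a nonconstant functional is
  a flat with one direction fewer: projecting along a direction \<^term>\<open>b0\<close> on which the functional
  does not vanish kills \<^term>\<open>b0\<close> itself.\<close>

lemma flat_section:
  fixes B :: "'a::real_inner set"
  assumes fB: "finite B" and n: "n \<in> span B" "n \<noteq> 0" and a': "a' \<in> (+) a ` span B" "inner n a' = r"
  shows "\<exists>B'. finite B' \<and> card B' < card B \<and> (+) a' ` span B' = {x \<in> (+) a ` span B. inner n x = r}"
proof -
  have "\<exists>b0\<in>B. inner n b0 \<noteq> 0"
  proof (rule ccontr)
    assume "\<not> ?thesis"
    then have "B \<subseteq> {x. inner n x = 0}" by auto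
    moreover have "subspace {x. inner n x = 0}"
      by (auto simp: subspace_def inner_add_right)
    ultimately have "span B \<subseteq> {x. inner n x = 0}" by (rule span_minimal)
    then show False using n by auto
  qed
  then obtain b0 where b0: "b0 \<in> B" "inner n b0 \<noteq> 0" by blast
  define f where "f x = x - (inner n x / inner n b0) *\<^sub>R b0" for x
  define B' where "B' = f ` (B - {b0})"
  have lin: "linear f"
    by (rule linearI) (auto simp: f_def inner_add_right add_divide_distrib algebra_simps)
  have f0: "f b0 = 0" using b0 by (simp add: f_def)
  have "span B' = span (insert 0 B')" by (simp add: span_insert_0)
  also have "insert 0 B' = f ` B" using b0 f0 by (auto simp: B'_def)
  also have "span (f ` B) = f ` span B" using lin by (rule linear_span_image)
  finally have sp: "span B' = f ` span B" .
  have in0: "inner n (f x) = 0" for x using b0 by (simp add: f_def inner_diff_right)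
  have fin: "f x \<in> span B" if "x \<in> span B" for x
    unfolding f_def using that b0 by (intro span_diff span_scale) (auto intro: span_base)
  have "card B' \<le> card (B - {b0})" unfolding B'_def using fB by (intro card_image_le) auto
  also have "\<dots> < card B" using b0 fB by (intro psubset_card_mono) auto
  finally have card: "card B' < card B" .
  have "(+) a' ` span B' = {x \<in> (+) a ` span B. inner n x = r}"
  proof (intro equalityI subsetI)
    fix x assume "x \<in> (+) a' ` span B'"
    then obtain y where y: "y \<in> span B" "x = a' + f y" using sp by auto
    obtain c where c: "c \<in> span B" "a' = a + c" using a' by auto
    have "x = a + (c + f y)" using y c by simp
    then have "x \<in> (+) a ` span B" using c(1) fin[OF y(1)] by (blast intro: span_add)
    moreover have "inner n x = r" using y a' in0 by (simp add: inner_add_right)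
    ultimately show "x \<in> {x \<in> (+) a ` span B. inner n x = r}" by simp
  next
    fix x assume "x \<in> {x \<in> (+) a ` span B. inner n x = r}"
    then obtain y where y: "y \<in> span B" "x = a + y" "inner n x = r" by auto
    obtain c where c: "c \<in> span B" "a' = a + c" using a' by auto
    have d: "y - c \<in> span B" using y c by (intro span_diff)
    have "inner n (y - c) = 0" using y(2,3) c(2) a'(2) by (simp add: inner_add_right inner_diff_right)
    then have "f (y - c) = y - c" by (simp add: f_def)
    then have "y - c \<in> span B'" using sp d by (metis imageI)
    moreover have "x = a' + (y - c)" using y c by simp
    ultimately show "x \<in> (+) a' ` span B'" by blast
  qed
  then show ?thesis using card fB by (intro exI[of _ B']) (auto simp: B'_def)
qed

lemma dist_add_eq_iff_segment:
  fixes p :: "'a::real_inner"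
  shows "dist p x + dist x y = dist p y \<longleftrightarrow> x \<in> closed_segment p y"
proof
  assume "dist p x + dist x y = dist p y"
  then have eq: "norm (p - x) *\<^sub>R (x - y) = norm (x - y) *\<^sub>R (p - x)"
    using dist_triangle_eq[of p y x] by simp
  define r where "r = norm (p - x)"
  define s where "s = norm (x - y)"
  show "x \<in> closed_segment p y"
  proof (cases "r + s = 0")
    case True
    then have "r = 0" unfolding r_def s_def by (smt (verit) norm_ge_zero)
    then show ?thesis by (simp add: r_def)
  next
    case False
    then have pos: "r + s > 0" unfolding r_def s_def by (smt (verit) norm_ge_zero)
    have "(r + s) *\<^sub>R x = s *\<^sub>R p + r *\<^sub>R y"
      using eq unfolding r_def[symmetric] s_def[symmetric] by (simp add: algebra_simps)
    then have "(1 / (r + s)) *\<^sub>R ((r + s) *\<^sub>R x) = (s / (r + s)) *\<^sub>R p + (r / (r + s)) *\<^sub>R y"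
      by (simp add: scaleR_add_right)
    moreover have "1 - r / (r + s) = s / (r + s)" using pos by (simp add: field_simps)
    ultimately have "x = (1 - r / (r + s)) *\<^sub>R p + (r / (r + s)) *\<^sub>R y" using pos by simp
    moreover have "0 \<le> r / (r + s)" "r / (r + s) \<le> 1" using pos by (auto simp: r_def s_def)
    ultimately show ?thesis by (auto simp: in_segment)
  qed
next
  assume "x \<in> closed_segment p y"
  then obtain u where u: "0 \<le> u" "u \<le> 1" "x = (1 - u) *\<^sub>R p + u *\<^sub>R y" by (auto simp: in_segment)
  have "p - x = u *\<^sub>R (p - y)" "x - y = (1 - u) *\<^sub>R (p - y)" using u by (auto simp: algebra_simps)
  then have "dist p x = u * dist p y" "dist x y = (1 - u) * dist p y" using u by (auto simp: dist_norm)
  then show "dist p x + dist x y = dist p y" by (simp add: algebra_simps)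
qed

lemma closed_segment_subset_Un:
  fixes p :: "'a::real_vector"
  assumes "x \<in> closed_segment p q"
  shows "closed_segment p q \<subseteq> closed_segment p x \<union> closed_segment x q"
proof
  fix w assume "w \<in> closed_segment p q"
  then obtain t where t: "0 \<le> t" "t \<le> 1" "w = p + t *\<^sub>R (q - p)"
    by (auto simp: in_segment algebra_simps)
  obtain s where s: "0 \<le> s" "s \<le> 1" "x = p + s *\<^sub>R (q - p)"
    using assms by (auto simp: in_segment algebra_simps)
  show "w \<in> closed_segment p x \<union> closed_segment x q"
  proof (cases "t \<le> s")
    case True
    show ?thesis
    proof (cases "s = 0")
      case False
      have "w = (1 - t / s) *\<^sub>R p + (t / s) *\<^sub>R x" using False by (simp add: t s algebra_simps)
      moreover have "0 \<le> t / s" "t / s \<le> 1" using True False t s by auto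
      ultimately show ?thesis by (auto simp: in_segment)
    qed (use True t s in auto)
  next
    case False
    then have s1: "s < 1" using t by simp
    define v where "v = (t - s) / (1 - s)"
    have v: "0 \<le> v" "v \<le> 1" "s + v * (1 - s) = t" using False s1 t by (auto simp: v_def field_simps)
    have "(1 - v) *\<^sub>R x + v *\<^sub>R q = p + (s + v * (1 - s)) *\<^sub>R (q - p)" by (simp add: s algebra_simps)
    then have "w = (1 - v) *\<^sub>R x + v *\<^sub>R q" using v t by simp
    then show ?thesis using v by (auto simp: in_segment)
  qed
qed

text \<open>The union of two sets each of which protrudes from the other only inside one of two separated
  closed sets is convex.  For \<open>p\<close> on one side and \<open>q\<close> on the other take a shortest path
  \<open>p\<close>, \<open>x\<close>, \<open>y\<close>, \<open>q\<close> with \<open>x\<close> and \<open>y\<close> in the two closed parts of the overlap.  The segment from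
  \<open>p\<close> to \<open>y\<close> must itself meet the first part, so the path cannot bend at \<open>x\<close>; neither can it bend
  at \<open>y\<close>, and \<open>x \<noteq> y\<close>, so it is straight.  For open sets no shortest path need exist, and the
  union may have a reflex corner.\<close>

lemma convex_Un_separated_overlap:
  fixes X Y :: "'a::real_inner set"
  assumes cX: "compact X" "convex X" and cY: "compact Y" "convex Y"
    and clA: "closed A" and clB: "closed B"
    and XA: "X \<subseteq> A \<union> Y" and YB: "Y \<subseteq> B \<union> X"
    and disj: "X \<inter> Y \<inter> A \<inter> B = {}" and ne: "X \<inter> Y \<noteq> {}"
  shows "convex (X \<union> Y)"
proof -
  \<comment> \<open>a segment inside \<open>S\<close> leaving \<open>A\<close> passes through the overlap\<close>
  have cross: "\<exists>w \<in> closed_segment p y. w \<in> S \<inter> T \<inter> A'"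
    if "convex S" "closed T" "closed A'" "S \<subseteq> A' \<union> T" "p \<in> S \<inter> A'" "y \<in> S \<inter> T"
    for S T A' :: "'a set" and p y
  proof (rule ccontr)
    assume no: "\<not> ?thesis"
    have seg: "closed_segment p y \<subseteq> S" using that by (intro closed_segment_subset) auto
    have "connected (closed_segment p y)" by simp
    moreover have "closed_segment p y \<subseteq> A' \<union> T" using seg that by auto
    moreover have "A' \<inter> T \<inter> closed_segment p y = {}" using no seg by auto
    ultimately have "A' \<inter> closed_segment p y = {} \<or> T \<inter> closed_segment p y = {}"
      using that unfolding connected_closed by blast
    then show False using that by auto
  qed
  have main: "closed_segment p q \<subseteq> X \<union> Y" if p: "p \<in> X" "p \<notin> Y" and q: "q \<in> Y" "q \<notin> X" for p q
  proof -
    have pA: "p \<in> A" and qB: "q \<in> B" using p q XA YB by auto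
    obtain m where m: "m \<in> X" "m \<in> Y" using ne by blast
    define P where "P = X \<inter> Y \<inter> A"
    define Q where "Q = Y \<inter> X \<inter> B"
    have "P \<noteq> {}" unfolding P_def using cross[of X Y A p m] cX cY clA XA p pA m compact_imp_closed by blast
    moreover have "Q \<noteq> {}" unfolding Q_def
      using cross[of Y X B q m] cX cY clB YB q qB m compact_imp_closed by blast
    ultimately have PQne: "P \<times> Q \<noteq> {}" by auto
    have "compact P" "compact Q" unfolding P_def Q_def using cX cY clA clB
      by (auto intro: compact_Int compact_Int_closed)
    then have "compact (P \<times> Q)" by (rule compact_Times)
    moreover have "continuous_on (P \<times> Q) (\<lambda>z. dist p (fst z) + dist (fst z) (snd z) + dist (snd z) q)"
      by (intro continuous_intros)
    ultimately obtain z where z: "z \<in> P \<times> Q"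
      "\<And>z'. z' \<in> P \<times> Q \<Longrightarrow> dist p (fst z) + dist (fst z) (snd z) + dist (snd z) q
             \<le> dist p (fst z') + dist (fst z') (snd z') + dist (snd z') q"
      using continuous_attains_inf[OF _ PQne] by blast
    define x where "x = fst z"
    define y where "y = snd z"
    have xP: "x \<in> P" and yQ: "y \<in> Q" using z(1) by (auto simp: x_def y_def)
    have min: "dist p x + dist x y + dist y q \<le> dist p x' + dist x' y' + dist y' q"
      if "x' \<in> P" "y' \<in> Q" for x' y'
      using z(2)[of "(x', y')"] that by (simp add: x_def y_def)
    have xy: "x \<noteq> y" using xP yQ disj by (auto simp: P_def Q_def)
    obtain w where w: "w \<in> closed_segment p y" "w \<in> P"
      using cross[of X Y A p y] cX cY clA XA p pA yQ compact_imp_closed by (auto simp: P_def Q_def)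
    have "dist p w + dist w y = dist p y"
      using w(1) by (simp add: dist_add_eq_iff_segment)
    then have "dist p x + dist x y \<le> dist p y" using min[OF w(2) yQ] by simp
    then have "dist p y = dist p x + dist x y" using dist_triangle[of p y x] by simp
    then have x1: "x \<in> closed_segment p y" by (simp flip: dist_add_eq_iff_segment)
    obtain w' where w': "w' \<in> closed_segment q x" "w' \<in> Q"
      using cross[of Y X B q x] cX cY clB YB q qB xP compact_imp_closed by (auto simp: P_def Q_def)
    have "dist q w' + dist w' x = dist q x"
      using w'(1) by (simp add: dist_add_eq_iff_segment)
    then have "dist x y + dist y q \<le> dist x q" using min[OF xP w'(2)] by (simp add: dist_commute)
    then have "dist x q = dist x y + dist y q" using dist_triangle[of x q y] by simp
    then have y1: "y \<in> closed_segment x q" by (simp flip: dist_add_eq_iff_segment)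
    obtain s where s: "0 \<le> s" "s \<le> 1" "x = (1 - s) *\<^sub>R p + s *\<^sub>R y" using x1 by (auto simp: in_segment)
    obtain t where t: "0 \<le> t" "t \<le> 1" "y = (1 - t) *\<^sub>R x + t *\<^sub>R q" using y1 by (auto simp: in_segment)
    have s1: "s < 1" using s xy by (cases "s = 1") auto
    have t0: "0 < t" using t xy by (cases "t = 0") auto
    define D where "D = 1 - s * (1 - t)"
    have D: "D > 0" unfolding D_def using s s1 t by (smt (verit) mult_left_le mult_nonneg_nonneg)
    have "D *\<^sub>R x = (1 - s) *\<^sub>R p + (s * t) *\<^sub>R q"
    proof -
      have "x = (1 - s) *\<^sub>R p + s *\<^sub>R ((1 - t) *\<^sub>R x + t *\<^sub>R q)" using s(3) t(3) by simp
      then have "x - (s * (1 - t)) *\<^sub>R x = (1 - s) *\<^sub>R p + (s * t) *\<^sub>R q"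
        by (simp add: scaleR_add_right algebra_simps)
      then show ?thesis by (simp add: D_def scaleR_diff_left)
    qed
    then have xD: "x = (1 / D) *\<^sub>R ((1 - s) *\<^sub>R p + (s * t) *\<^sub>R q)" using D
      by (metis divide_self_if less_irrefl mult.commute scaleR_one scaleR_scaleR times_divide_eq_right mult.right_neutral)
    then have "x = (1 - s * t / D) *\<^sub>R p + (s * t / D) *\<^sub>R q"
    proof -
      have "1 - s * t / D = (1 - s) / D" using D by (simp add: field_simps D_def)
      then show ?thesis using xD by (simp add: scaleR_add_right)
    qed
    moreover have "0 \<le> s * t / D" using s t D by simp
    moreover have "s * t / D \<le> 1" using s D by (simp add: D_def field_simps)
    ultimately have x2: "x \<in> closed_segment p q" by (auto simp: in_segment)
    have "closed_segment p q \<subseteq> closed_segment p x \<union> closed_segment x q"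
      using x2 by (rule closed_segment_subset_Un)
    moreover have "closed_segment x q \<subseteq> closed_segment x y \<union> closed_segment y q"
      using y1 by (rule closed_segment_subset_Un)
    moreover have "closed_segment p x \<subseteq> X" "closed_segment x y \<subseteq> X" "closed_segment y q \<subseteq> Y"
      using p q xP yQ cX cY by (intro closed_segment_subset; simp add: P_def Q_def)+
    ultimately show ?thesis by blast
  qed
  show ?thesis unfolding convex_contains_segment
  proof (intro ballI)
    fix p q assume pq: "p \<in> X \<union> Y" "q \<in> X \<union> Y"
    show "closed_segment p q \<subseteq> X \<union> Y"
    proof (cases "(p \<in> X \<and> q \<in> X) \<or> (p \<in> Y \<and> q \<in> Y)")
      case True
      then show ?thesis using cX cY closed_segment_subset by blast
    next
      case False
      then consider "p \<in> X" "p \<notin> Y" "q \<in> Y" "q \<notin> X" | "q \<in> X" "q \<notin> Y" "p \<in> Y" "p \<notin> X" using pq by blast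
      then show ?thesis using main[of p q] main[of q p] by cases (simp_all add: closed_segment_commute)
    qed
  qed
qed

lemma convex_meets_level:
  fixes S :: "'a::real_inner set"
  assumes S: "convex S" "x \<in> S" "y \<in> S" and lev: "inner n x < r" "r < inner n y"
  shows "\<exists>w\<in>S. inner n w = r"
proof -
  define t where "t = (r - inner n x) / (inner n y - inner n x)"
  have t: "0 \<le> t" "t \<le> 1" using lev by (auto simp: t_def divide_simps)
  have "(1 - t) *\<^sub>R x + t *\<^sub>R y \<in> S" using S t by (intro convexD) auto
  moreover have "inner n ((1 - t) *\<^sub>R x + t *\<^sub>R y) = inner n x + t * (inner n y - inner n x)"
    by (simp add: inner_add_right algebra_simps)
  moreover have "t * (inner n y - inner n x) = r - inner n x"
    using lev by (simp add: t_def)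
  ultimately show ?thesis by force
qed

lemma openin_flat_translate:
  fixes A :: "'a::real_inner set"
  assumes A: "A = (+) a ` span B" and U: "openin (top_of_set A) U" "x \<in> U" and h: "h \<in> span B"
  shows "\<exists>d>0. \<forall>t. \<bar>t\<bar> \<le> d \<longrightarrow> x + t *\<^sub>R h \<in> U"
proof -
  obtain e where e: "e > 0" "ball x e \<inter> A \<subseteq> U" using U by (meson openin_contains_ball)
  define d where "d = e / (2 * (norm h + 1))"
  have d: "d > 0" using e by (simp add: d_def add_nonneg_pos)
  have "x + t *\<^sub>R h \<in> U" if t: "\<bar>t\<bar> \<le> d" for t
  proof -
    have "norm (t *\<^sub>R h) \<le> d * (norm h + 1)" using t by (simp add: mult_mono)
    also have "\<dots> = e / 2"
    proof -
      have "norm h + 1 \<noteq> 0" using norm_ge_zero[of h] by linarith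
      then show ?thesis by (simp add: d_def field_simps)
    qed
    also have "\<dots> < e" using e by simp
    finally have "x + t *\<^sub>R h \<in> ball x e" by (simp add: dist_norm)
    moreover have "x \<in> A" using U openin_imp_subset by blast
    then obtain v where "v \<in> span B" "x = a + v" unfolding A by blast
    then have "x + t *\<^sub>R h \<in> A" unfolding A using h
      by (auto simp: add.assoc intro!: image_eqI[where x = "v + t *\<^sub>R h"] span_add span_scale)
    ultimately show ?thesis using e by blast
  qed
  then show ?thesis using d by blast
qed

lemma openin_subset_section:
  assumes "openin (top_of_set A) U" "A' \<subseteq> A"
  shows "openin (top_of_set A') (U \<inter> A')"
proof -
  obtain T where "open T" "U = A \<inter> T" using assms(1) by (auto simp: openin_open)
  then show ?thesis using assms(2) by (auto simp: openin_open intro!: exI[of _ T])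
qed

definition open_sunflower :: "'a::real_inner set \<Rightarrow> 'i set \<Rightarrow> ('i \<Rightarrow> 'a set) \<Rightarrow> 'a set \<Rightarrow> bool" where
  "open_sunflower A I U C \<longleftrightarrow> C \<noteq> {} \<and>
     (\<forall>i\<in>I. openin (top_of_set A) (U i) \<and> convex (U i) \<and> C \<subseteq> U i) \<and>
     (\<forall>i\<in>I. \<forall>j\<in>I. i \<noteq> j \<longrightarrow> U i \<inter> U j \<subseteq> C)"

text \<open>Suppose the hull misses \<open>closure C\<close>; intersecting with a large ball makes the centre bounded.  Its
  closure \<open>D\<close> has a point \<open>c\<close> and a normal \<open>n\<close> such that \<open>D\<close> touches the hyperplane through \<open>c\<close> only
  in \<open>c\<close> and all \<open>p i\<close> lie strictly on the other side.  So every petal meets that hyperplane, in a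
  point \<open>e i\<close> say.  With \<open>k\<close> dimensions and \<open>k + 1\<close> petals, some \<open>h \<noteq> 0\<close> is orthogonal to \<open>n\<close> and to
  \<open>e i - c\<close> for all but three indices; moving the points slightly and choosing the sign of \<open>h\<close> gives
  \<open>k\<close> petals with points \<open>q i\<close> in the hyperplane for which \<open>inner h (q i - c)\<close> is at least some
  \<open>m > 0\<close>.  In a parallel hyperplane slightly inside \<open>D\<close> these petals form a sunflower, and by
  induction the hull of the shifted \<open>q i\<close> contains a point of \<open>D\<close>.  That point is at least \<open>m\<close> away
  from \<open>c\<close> as measured by \<open>h\<close>, but the sections of \<open>D\<close> shrink to \<open>c\<close>.\<close>

theorem sunflower:
  fixes B :: "'a::real_inner set" and U :: "'i \<Rightarrow> 'a set"
  assumes "finite B" "finite I" "card B < card I"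
    and "\<And>X. X \<subseteq> (+) a ` span B \<Longrightarrow> closed X \<Longrightarrow> bounded X \<Longrightarrow> compact X"
    and "open_sunflower ((+) a ` span B) I U C"
    and "\<And>i. i \<in> I \<Longrightarrow> p i \<in> U i"
  shows "convex hull (p ` I) \<inter> closure C \<noteq> {}"
  using assms
proof (induction "card B" arbitrary: B a U C I p rule: less_induct)
  case less
  note fB = less.prems(1) and fI = less.prems(2) and cBI = less.prems(3) and heine = less.prems(4)
  note sf = less.prems(5)[unfolded open_sunflower_def] and pU = less.prems(6)
  define A where "A = (+) a ` span B"
  have Ad: "x - y \<in> span B" if "x \<in> A" "y \<in> A" for x y
    using that unfolding A_def by (auto intro: span_diff)
  have Aa: "x + v \<in> A" if "x \<in> A" "v \<in> span B" for x v
  proof -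
    obtain w where "w \<in> span B" "x = a + w" using \<open>x \<in> A\<close> by (auto simp: A_def)
    then have "x + v = a + (w + v)" "w + v \<in> span B" using that by (auto intro: span_add simp: add.assoc)
    then show ?thesis unfolding A_def by blast
  qed
  have clA: "closed A" unfolding A_def by (intro closed_translation closed_span_finite fB)
  have cvA: "convex A" unfolding A_def by (intro convex_translation subspace_imp_convex subspace_span)
  have Ine: "I \<noteq> {}" using cBI by auto
  have UA: "U i \<subseteq> A" if "i \<in> I" for i using sf that openin_imp_subset unfolding A_def by blast
  show ?case
  proof (cases "B = {}")
    case True
    then have "A = {a}" by (simp add: A_def)
    moreover obtain i where "i \<in> I" using Ine by blast
    ultimately have "a \<in> C" "p i = a" using sf UA[of i] pU[of i] by auto
    then show ?thesis using \<open>i \<in> I\<close> closure_subset[of C] hull_inc[of a "p ` I" convex] by (metis IntI empty_iff image_eqI subsetD)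
  next
    case Bne: False
    then have k1: "card B \<ge> 1" using fB by (simp add: Suc_leI card_gt_0_iff)
    show ?thesis
    proof (cases "independent B")
      case False
      then obtain b where b: "b \<in> B" "b \<in> span (B - {b})" by (auto simp: dependent_def)
      have sp: "span (B - {b}) = span B"
        using b by (metis insert_Diff span_redundant)
      have "card (B - {b}) < card B" using b fB by (simp add: card_gt_0_iff Bne)
      from less.hyps[OF this, of I a U C p] show ?thesis
        using fB fI cBI less.prems(4-6) \<open>card (B - {b}) < card B\<close> unfolding sp by auto
    next
      case ind: True
      show ?thesis
      proof (rule ccontr)
        assume "\<not> ?thesis"
        then have no: "convex hull (p ` I) \<inter> closure C = {}" by simp
        obtain I0 where I0: "I0 \<subseteq> I" "card I0 = Suc (card B)" "finite I0"
          using obtain_subset_with_card_n[of "Suc (card B)" I] cBI by auto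
        obtain c0 where c0: "c0 \<in> C" using conjunct1[OF sf] by auto
        have "bounded (insert c0 (p ` I0))" using I0 by (simp add: finite_imp_bounded)
        then obtain r where r: "r > 0" "insert c0 (p ` I0) \<subseteq> ball 0 r" by (meson bounded_subset_ballD)
        define U' where "U' i = U i \<inter> ball 0 r" for i
        define C' where "C' = C \<inter> ball 0 r"
        have oU: "openin (top_of_set A) (U' i)" if "i \<in> I0" for i
          unfolding U'_def using sf I0 that by (intro openin_Int_open) (auto simp: A_def)
        have cvU: "convex (U' i)" if "i \<in> I0" for i
          unfolding U'_def using sf I0 that by (intro convex_Int) auto
        have CU: "C' \<subseteq> U' i" if "i \<in> I0" for i using sf I0 that by (auto simp: C'_def U'_def)
        have UU: "U' i \<inter> U' j \<subseteq> C'" if "i \<in> I0" "j \<in> I0" "i \<noteq> j" for i j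
        proof -
          have "U i \<inter> U j \<subseteq> C" using sf I0 that by blast
          then show ?thesis by (auto simp: C'_def U'_def)
        qed
        have pU': "p i \<in> U' i" if "i \<in> I0" for i using pU I0 r that by (auto simp: U'_def)
        have c0': "c0 \<in> C'" using c0 r by (auto simp: C'_def)
        have "\<not> I0 \<subseteq> {i}" for i using I0 k1 card_mono[of "{i}" I0] by fastforce
        then obtain i j where ij: "i \<in> I0" "j \<in> I0" "i \<noteq> j" by blast
        have C'eq: "C' = U' i \<inter> U' j" using UU[OF ij] CU ij by blast
        have oC: "openin (top_of_set A) C'" unfolding C'eq using oU ij by (intro openin_Int)
        have cvC: "convex C'" unfolding C'eq using cvU ij by (intro convex_Int)
        have C'A: "C' \<subseteq> A" using oC openin_imp_subset by blast
        define D where "D = closure C'"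
        have DA: "D \<subseteq> A" unfolding D_def using C'A clA by (rule closure_minimal)
        have Dr: "D \<subseteq> cball 0 r" unfolding D_def by (rule closure_minimal) (auto simp: C'_def)
        have cD: "compact D" using heine[of D] DA bounded_subset[OF bounded_cball Dr]
          by (auto simp: A_def D_def)
        have cvD: "convex D" unfolding D_def using cvC by (rule convex_closure)
        have C'D: "C' \<subseteq> D" unfolding D_def by (rule closure_subset)
        define K where "K = convex hull (p ` I0)"
        have cK: "compact K" unfolding K_def using I0 by (intro finite_imp_compact_convex_hull) auto
        have cvK: "convex K" by (simp add: K_def)
        have pK: "p i \<in> K" if "i \<in> I0" for i unfolding K_def using that by (intro hull_inc) auto
        have "K \<subseteq> A" unfolding K_def using cvA pU UA I0 by (intro hull_minimal) auto
        have "D \<subseteq> closure C" unfolding D_def C'_def by (intro closure_mono) auto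
        moreover have "K \<subseteq> convex hull (p ` I)" unfolding K_def using I0 by (intro hull_mono) auto
        ultimately have KD: "K \<inter> D = {}" using no by blast
        have "K \<times> D \<noteq> {}" using pK ij c0' C'D by auto
        moreover have "compact (K \<times> D)" using cK cD by (rule compact_Times)
        moreover have "continuous_on (K \<times> D) (\<lambda>z. dist (fst z) (snd z))" by (intro continuous_intros)
        ultimately obtain z where z: "z \<in> K \<times> D"
          "\<forall>z'\<in>K \<times> D. dist (fst z) (snd z) \<le> dist (fst z') (snd z')"
          using continuous_attains_inf by blast
        define k0 where "k0 = fst z"
        define c1 where "c1 = snd z"
        have kc: "k0 \<in> K" "c1 \<in> D" using z(1) by (auto simp: k0_def c1_def)
        have near: "dist k0 c1 \<le> dist x y" if "x \<in> K" "y \<in> D" for x y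
          using z(2) that by (auto simp: k0_def c1_def)
        define u where "u = c1 - k0"
        have u0: "u \<noteq> 0" using kc KD by (auto simp: u_def)
        have uK: "inner u (x - k0) \<le> 0" if "x \<in> K" for x
          unfolding u_def using near kc that
          by (intro nearest_point_inner_le[OF cvK]) (auto simp: dist_commute)
        have uD: "inner (k0 - c1) (x - c1) \<le> 0" if "x \<in> D" for x
          using near kc that by (intro nearest_point_inner_le[OF cvD]) auto
        have sep: "inner u (x - y) \<le> - inner u u" if "x \<in> K" "y \<in> D" for x y
          using uK[OF that(1)] uD[OF that(2)] by (simp add: u_def inner_diff_left inner_diff_right algebra_simps)
        \<comment> \<open>the point of \<open>D\<close> farthest from a centre far out on the side of \<open>D\<close> is exposed, and for a
          centre far enough the tangent hyperplane still separates \<open>D\<close> from the points \<open>p i\<close>\<close>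
        define s where "s = (4 * r\<^sup>2 + 1) / inner u u"
        define z0 where "z0 = c1 + s *\<^sub>R u"
        have "D \<noteq> {}" using kc by auto
        moreover have "continuous_on D (\<lambda>x. dist z0 x)" by (intro continuous_intros)
        ultimately obtain c where cD': "c \<in> D" and far: "\<And>x. x \<in> D \<Longrightarrow> dist z0 x \<le> dist z0 c"
          using continuous_attains_sup[OF cD] by blast
        define n where "n = z0 - c"
        have gD: "(norm (x - c))\<^sup>2 \<le> 2 * inner n (x - c)" if "x \<in> D" for x
        proof -
          have "(norm (z0 - x))\<^sup>2 \<le> (norm (z0 - c))\<^sup>2" using far[OF that] by (simp add: dist_norm power_mono)
          moreover have "(norm (z0 - x))\<^sup>2 = (norm (z0 - c))\<^sup>2 - 2 * inner n (x - c) + (norm (x - c))\<^sup>2"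
            unfolding power2_norm_eq_inner n_def
            by (simp add: inner_diff_left inner_diff_right inner_commute algebra_simps)
          ultimately show ?thesis by simp
        qed
        have gp: "inner n (p i - c) < 0" if i: "i \<in> I0" for i
        proof -
          have "inner (c1 - c) (p i - c) \<le> norm (c1 - c) * norm (p i - c)" by (rule norm_cauchy_schwarz)
          also have "\<dots> \<le> (2 * r) * (2 * r)"
          proof (intro mult_mono)
            have "norm c1 \<le> r" "norm c \<le> r" "norm (p i) \<le> r"
              using Dr kc cD' pU'[OF i] by (auto simp: U'_def)
            then show "norm (c1 - c) \<le> 2 * r" "norm (p i - c) \<le> 2 * r"
              using norm_triangle_ineq4[of c1 c] norm_triangle_ineq4[of "p i" c] by linarith+
          qed (use r in auto)
          finally have 1: "inner (c1 - c) (p i - c) \<le> 4 * r\<^sup>2" by (simp add: power2_eq_square)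
          have "s > 0" using u0 by (simp add: s_def add_nonneg_pos)
          then have "s * inner u (p i - c) \<le> s * (- inner u u)"
            using sep[OF pK[OF i] cD'] by (intro mult_left_mono) auto
          also have "\<dots> = - (4 * r\<^sup>2 + 1)" using u0 by (simp add: s_def)
          finally have 2: "s * inner u (p i - c) \<le> - (4 * r\<^sup>2 + 1)" .
          have "inner n (p i - c) = inner (c1 - c) (p i - c) + s * inner u (p i - c)"
            by (simp add: n_def z0_def inner_add_left inner_diff_left algebra_simps)
          then show ?thesis using 1 2 by linarith
        qed
        have n0: "n \<noteq> 0" using gp[of i] ij by auto
        have cA: "c \<in> A" using cD' DA by auto
        have nB: "n \<in> span B"
        proof -
          have "n = (c1 - c) + s *\<^sub>R (c1 - k0)" by (simp add: n_def z0_def u_def)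
          then show ?thesis using Ad kc cA DA \<open>K \<subseteq> A\<close> by (auto intro!: span_add span_scale)
        qed
        have gC: "inner n (x - c) > 0" if x: "x \<in> C'" for x
        proof -
          obtain d where d: "d > 0" "\<And>t. \<bar>t\<bar> \<le> d \<Longrightarrow> x + t *\<^sub>R n \<in> C'"
            using openin_flat_translate[OF A_def oC x nB] by blast
          have "0 \<le> 2 * inner n (x + (- d) *\<^sub>R n - c)"
            using gD[of "x + (- d) *\<^sub>R n"] d C'D by (smt (verit) subsetD zero_le_power2)
          also have "\<dots> = 2 * (inner n (x - c) - d * inner n n)"
            by (simp add: inner_diff_right inner_add_right algebra_simps)
          finally show ?thesis using d n0 by (smt (verit) inner_gt_zero_iff mult_pos_pos)
        qed
        have "\<exists>w\<in>U' i. inner n w = inner n c" if i: "i \<in> I0" for i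
          using convex_meets_level[OF cvU[OF i] pU'[OF i] subsetD[OF CU[OF i] c0'], of n "inner n c"]
            gp[OF i] gC[OF c0'] by (simp add: inner_diff_right)
        then obtain e where e: "\<And>i. i \<in> I0 \<Longrightarrow> e i \<in> U' i" "\<And>i. i \<in> I0 \<Longrightarrow> inner n (e i - c) = 0"
          by (metis inner_diff_right diff_self)
        have eA: "e i \<in> A" if "i \<in> I0" for i using e(1)[OF that] oU[OF that] openin_imp_subset by blast
        show False
        proof (cases "card B = 1")
          case True
          then obtain b where b: "B = {b}" by (auto simp: card_1_singleton_iff)
          have "e i - e j \<in> span {b}" using Ad eA ij b by auto
          then obtain v where v: "e i - e j = v *\<^sub>R b" by (auto simp: span_singleton)
          obtain w where w: "n = w *\<^sub>R b" using nB b by (auto simp: span_singleton)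
          have "inner n (e i - e j) = 0" using e(2)[OF ij(1)] e(2)[OF ij(2)] by (simp add: inner_diff_right)
          then have "v = 0 \<or> b = 0" using v w n0 by auto
          then have "e i = e j" using v by auto
          then have "e i \<in> C'" using UU[OF ij] e(1)[OF ij(1)] e(1)[OF ij(2)] by auto
          then show False using gC e(2)[OF ij(1)] by fastforce
        next
          case False
          then have k2: "card B \<ge> 2" using k1 by linarith
          have "3 \<le> card I0" using I0 k2 by simp
          then obtain I3 where I3: "I3 \<subseteq> I0" "card I3 = 3" by (meson obtain_subset_with_card_n)
          then obtain i1 i2 i3 where i3: "I3 = {i1, i2, i3}" "i1 \<noteq> i2" "i1 \<noteq> i3" "i2 \<noteq> i3"
            by (auto simp: card_3_iff)
          define J where "J = I0 - I3"
          have fJ: "finite J" using I0 by (simp add: J_def)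
          have cJ: "card J + 2 = card B" unfolding J_def using I0 I3 i3 k2
            by (subst card_Diff_subset) auto
          define T where "T = insert n ((\<lambda>i. e i - c) ` J)"
          have fT: "finite T" using fJ by (simp add: T_def)
          have cT: "card T < card B"
          proof -
            have "card T \<le> Suc (card ((\<lambda>i. e i - c) ` J))" unfolding T_def using fJ by (intro card_insert_le_m1) auto
            also have "\<dots> \<le> Suc (card J)" using card_image_le[OF fJ] by simp
            finally show ?thesis using cJ by linarith
          qed
          have TB: "T \<subseteq> span B" unfolding T_def using nB Ad eA cA by (auto simp: J_def)
          have "\<not> B \<subseteq> span T" using independent_span_bound[OF fT ind] cT by auto
          then obtain b where b: "b \<in> B" "b \<notin> span T" by blast
          obtain y where y: "y \<in> span T" "\<And>t. t \<in> span T \<Longrightarrow> inner (b - y) t = 0"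
            using orthogonal_projection_exists[OF fT] by blast
          define h where "h = b - y"
          have h0: "h \<noteq> 0" using b y by (auto simp: h_def)
          have "span T \<subseteq> span B" using TB by (intro span_minimal) auto
          then have hB: "h \<in> span B" unfolding h_def using b y by (intro span_diff) (auto intro: span_base)
          have hn: "inner h n = 0" and hJ: "\<And>i. i \<in> J \<Longrightarrow> inner h (e i - c) = 0"
            using y(2) by (auto simp: h_def T_def intro!: span_base)
          have pert: "\<exists>d>0. \<forall>t. \<bar>t\<bar> \<le> d \<longrightarrow> e i + t *\<^sub>R h \<in> U' i" if "i \<in> I0" for i
            by (rule openin_flat_translate[OF A_def oU e(1) hB]) (use that in auto)
          have "\<exists>w\<in>U' i. inner n (w - c) = 0 \<and> inner h (w - c) \<noteq> 0" if i: "i \<in> I0" for i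
          proof (cases "inner h (e i - c) = 0")
            case True
            obtain d where d: "d > 0" "e i + d *\<^sub>R h \<in> U' i" using pert[OF i] by force
            have "inner n (e i + d *\<^sub>R h - c) = inner n (e i - c) + d * inner h n"
              "inner h (e i + d *\<^sub>R h - c) = inner h (e i - c) + d * inner h h"
              by (simp_all add: inner_diff_right inner_add_right inner_commute)
            then show ?thesis using True d e(2)[OF i] hn h0 by (intro bexI[OF _ d(2)]) auto
          next
            case False
            then show ?thesis using e i by blast
          qed
          then obtain e2 where e2: "\<And>i. i \<in> I0 \<Longrightarrow> e2 i \<in> U' i" "\<And>i. i \<in> I0 \<Longrightarrow> inner n (e2 i - c) = 0"
            "\<And>i. i \<in> I0 \<Longrightarrow> inner h (e2 i - c) \<noteq> 0" by metis
          have "\<exists>\<sigma> i i'. (\<sigma> = 1 \<or> \<sigma> = (-1::real)) \<and> i \<in> I3 \<and> i' \<in> I3 \<and> i \<noteq> i' \<and>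
             \<sigma> * inner h (e2 i - c) > 0 \<and> \<sigma> * inner h (e2 i' - c) > 0"
          proof -
            have nz: "inner h (e2 i1 - c) \<noteq> 0" "inner h (e2 i2 - c) \<noteq> 0" "inner h (e2 i3 - c) \<noteq> 0"
              using e2(3) I3 i3 by auto
            consider "inner h (e2 i1 - c) > 0 \<and> inner h (e2 i2 - c) > 0 \<or> inner h (e2 i1 - c) < 0 \<and> inner h (e2 i2 - c) < 0"
              | "inner h (e2 i1 - c) > 0 \<and> inner h (e2 i3 - c) > 0 \<or> inner h (e2 i1 - c) < 0 \<and> inner h (e2 i3 - c) < 0"
              | "inner h (e2 i2 - c) > 0 \<and> inner h (e2 i3 - c) > 0 \<or> inner h (e2 i2 - c) < 0 \<and> inner h (e2 i3 - c) < 0"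
              using nz by linarith
            then show ?thesis
            proof cases
              case 1 then show ?thesis using i3 by (elim disjE) (rule exI[of _ 1], force, rule exI[of _ "-1"], force)
            next
              case 2 then show ?thesis using i3 by (elim disjE) (rule exI[of _ 1], force, rule exI[of _ "-1"], force)
            next
              case 3 then show ?thesis using i3 by (elim disjE) (rule exI[of _ 1], force, rule exI[of _ "-1"], force)
            qed
          qed
          then obtain \<sigma> j1 j2 where sg: "\<sigma> = 1 \<or> \<sigma> = (-1::real)" "j1 \<in> I3" "j2 \<in> I3" "j1 \<noteq> j2"
             "\<sigma> * inner h (e2 j1 - c) > 0" "\<sigma> * inner h (e2 j2 - c) > 0" by blast
          define h' where "h' = \<sigma> *\<^sub>R h"
          have hn': "inner h' n = 0" using hn by (simp add: h'_def)
          define I1 where "I1 = insert j1 (insert j2 J)"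
          have I10: "I1 \<subseteq> I0" using sg I3 by (auto simp: I1_def J_def)
          have fI1: "finite I1" using I10 I0 finite_subset by blast
          have cI1: "card I1 = card B" using sg fJ cJ by (simp add: I1_def J_def)
          have "\<exists>w\<in>U' i. inner n (w - c) = 0 \<and> inner h' (w - c) > 0" if i: "i \<in> I1" for i
          proof (cases "i \<in> J")
            case True
            then have iI: "i \<in> I0" by (simp add: J_def)
            obtain d where d: "d > 0" "\<And>t. \<bar>t\<bar> \<le> d \<Longrightarrow> e i + t *\<^sub>R h \<in> U' i" using pert[OF iI] by blast
            have m: "e i + (d * \<sigma>) *\<^sub>R h \<in> U' i" using sg(1) d by (intro d(2)) auto
            have "inner n (e i + (d * \<sigma>) *\<^sub>R h - c) = inner n (e i - c) + (d * \<sigma>) * inner h n"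
              "inner h' (e i + (d * \<sigma>) *\<^sub>R h - c) = \<sigma> * inner h (e i - c) + (\<sigma> * \<sigma>) * d * inner h h"
              by (simp_all add: h'_def inner_diff_right inner_add_right inner_commute algebra_simps)
            then show ?thesis using hJ[OF True] d e(2)[OF iI] hn h0 sg(1) by (intro bexI[OF _ m]) auto
          next
            case False
            then have "i = j1 \<or> i = j2" using i by (auto simp: I1_def)
            then show ?thesis using e2(1)[of i] e2(2)[of i] sg I3 by (intro bexI[of _ "e2 i"]) (auto simp: h'_def)
          qed
          then obtain q where q: "\<And>i. i \<in> I1 \<Longrightarrow> q i \<in> U' i" "\<And>i. i \<in> I1 \<Longrightarrow> inner n (q i - c) = 0"
            "\<And>i. i \<in> I1 \<Longrightarrow> inner h' (q i - c) > 0" by metis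
          define m where "m = Min ((\<lambda>i. inner h' (q i - c)) ` I1)"
          have I1ne: "I1 \<noteq> {}" by (simp add: I1_def)
          have m0: "m > 0" unfolding m_def using q(3) fI1 I1ne by (subst Min_gr_iff) auto
          have mi: "m \<le> inner h' (q i - c)" if "i \<in> I1" for i
            unfolding m_def using that fI1 by (intro Min_le) auto
          have "\<exists>d>0. \<forall>t. \<bar>t\<bar> \<le> d \<longrightarrow> q i + t *\<^sub>R n \<in> U' i" if i: "i \<in> I1" for i
            by (rule openin_flat_translate[OF A_def oU q(1) nB]) (use i I10 in auto)
          then obtain d where d: "\<And>i. i \<in> I1 \<Longrightarrow> d i > 0"
            "\<And>i t. i \<in> I1 \<Longrightarrow> \<bar>t\<bar> \<le> d i \<Longrightarrow> q i + t *\<^sub>R n \<in> U' i" by metis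
          define M where "M = 2 * inner h' h' + 1"
          have M: "M > 0" by (simp add: M_def add_nonneg_pos)
          define l where "l = min (Min (d ` I1) * inner n n) (min (inner n (c0 - c) / 2) (m\<^sup>2 / M))"
          have nn: "inner n n > 0" using n0 by simp
          have dmin: "Min (d ` I1) > 0" using d fI1 I1ne by (subst Min_gr_iff) auto
          have l: "l > 0" "l \<le> Min (d ` I1) * inner n n" "l < inner n (c0 - c)" "l \<le> m\<^sup>2 / M"
          proof -
            have "Min (d ` I1) * inner n n > 0" "inner n (c0 - c) > 0" "m\<^sup>2 / M > 0"
              using dmin nn gC[OF c0'] m0 M by auto
            then show "l > 0" "l \<le> Min (d ` I1) * inner n n" "l < inner n (c0 - c)" "l \<le> m\<^sup>2 / M"
              unfolding l_def by linarith+
          qed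
          define \<epsilon> where "\<epsilon> = l / inner n n"
          have eps: "\<epsilon> > 0" "\<And>i. i \<in> I1 \<Longrightarrow> \<epsilon> \<le> d i" "\<epsilon> * inner n n = l"
          proof -
            show "\<epsilon> > 0" "\<epsilon> * inner n n = l" using l nn by (auto simp: \<epsilon>_def)
            show "\<epsilon> \<le> d i" if "i \<in> I1" for i
            proof -
              have "\<epsilon> \<le> Min (d ` I1)" using l(2) nn by (simp add: \<epsilon>_def divide_simps)
              also have "\<dots> \<le> d i" using that fI1 by (intro Min_le) auto
              finally show ?thesis .
            qed
          qed
          define r' where "r' = inner n c + l"
          have "\<exists>w\<in>C'. inner n w = r'"
          proof -
            have "c \<in> closure C'" using cD' by (simp add: D_def)
            moreover have "l / norm n > 0" using l n0 by simp
            ultimately obtain x where x: "x \<in> C'" "dist x c < l / norm n"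
              by (meson closure_approachable)
            have "inner n (x - c) \<le> norm n * norm (x - c)" by (rule norm_cauchy_schwarz)
            also have "\<dots> < l" using x n0 by (simp add: dist_norm field_simps)
            finally have "inner n x < r'" by (simp add: r'_def inner_diff_right)
            moreover have "r' < inner n c0" using l(3) by (simp add: r'_def inner_diff_right)
            ultimately show ?thesis using convex_meets_level[OF cvC x(1) c0'] by blast
          qed
          then obtain w0 where w0: "w0 \<in> C'" "inner n w0 = r'" by blast
          define A' where "A' = {x \<in> A. inner n x = r'}"
          have "w0 \<in> A" using w0 C'A by auto
          then obtain B' where B': "finite B'" "card B' < card B" "(+) w0 ` span B' = A'"
            using flat_section[OF fB nB n0, of w0 a r'] w0(2) unfolding A'_def A_def by blast
          define q' where "q' i = q i + \<epsilon> *\<^sub>R n" for i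
          have qA: "q' i \<in> U' i \<inter> A'" if i: "i \<in> I1" for i
          proof -
            have 1: "q' i \<in> U' i" unfolding q'_def using d(2)[OF i] eps(1) eps(2)[OF i] by auto
            moreover have "U' i \<subseteq> A" using oU i I10 openin_imp_subset by blast
            moreover have "inner n (q' i) = r'" using q(2)[OF i] eps(3)
              by (simp add: q'_def r'_def inner_add_right inner_diff_right)
            ultimately show ?thesis by (auto simp: A'_def)
          qed
          have "convex hull (q' ` I1) \<inter> closure (C' \<inter> A') \<noteq> {}"
          proof (rule less.hyps[OF B'(2) B'(1) fI1])
            show "card B' < card I1" using B' cI1 by simp
            show "compact X" if "X \<subseteq> (+) w0 ` span B'" "closed X" "bounded X" for X
              using heine[of X] that B'(3) by (auto simp: A'_def A_def)
            have A'A: "A' \<subseteq> A" by (auto simp: A'_def)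
            have "convex A'"
              using B'(3) convex_translation[OF subspace_imp_convex[OF subspace_span]] by metis
            show "open_sunflower ((+) w0 ` span B') I1 (\<lambda>i. U' i \<inter> A') (C' \<inter> A')"
              unfolding open_sunflower_def B'(3)
            proof (intro conjI ballI impI)
              show "C' \<inter> A' \<noteq> {}" using w0 \<open>w0 \<in> A\<close> by (auto simp: A'_def)
              fix i assume i: "i \<in> I1"
              show "openin (top_of_set A') (U' i \<inter> A')"
                using i I10 oU A'A by (intro openin_subset_section) auto
              show "convex (U' i \<inter> A')" using cvU i I10 \<open>convex A'\<close> by (intro convex_Int) auto
              show "C' \<inter> A' \<subseteq> U' i \<inter> A'" using CU i I10 by blast
              fix j assume j: "j \<in> I1" "i \<noteq> j"
              show "U' i \<inter> A' \<inter> (U' j \<inter> A') \<subseteq> C' \<inter> A'" using UU[of i j] i j I10 by blast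
            qed
          qed (use qA in auto)
          then obtain y where y: "y \<in> convex hull (q' ` I1)" "y \<in> closure (C' \<inter> A')" by blast
          have yD: "y \<in> D" using y(2) closure_mono[of "C' \<inter> A'" C'] by (auto simp: D_def)
          have "closed {x. inner n x = r'}" by (intro closed_Collect_eq continuous_intros)
          then have "closure (C' \<inter> A') \<subseteq> {x. inner n x = r'}"
            by (intro closure_minimal) (auto simp: A'_def)
          then have "inner n (y - c) = l" using y(2) by (auto simp: r'_def inner_diff_right)
          then have yl: "(norm (y - c))\<^sup>2 \<le> 2 * l" using gD[OF yD] by simp
          have "convex {x. inner h' x \<ge> inner h' c + m}" by (rule convex_halfspace_ge)
          moreover have "inner h' (q' i) \<ge> inner h' c + m" if "i \<in> I1" for i
            using mi[OF that] hn' by (simp add: q'_def inner_add_right inner_diff_right)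
          ultimately have "convex hull (q' ` I1) \<subseteq> {x. inner h' x \<ge> inner h' c + m}"
            by (intro hull_minimal) auto
          then have "m \<le> inner h' (y - c)" using y(1) by (auto simp: inner_diff_right)
          then have "m\<^sup>2 \<le> (inner h' (y - c))\<^sup>2" using m0 by (intro power_mono) auto
          also have "\<dots> \<le> inner h' h' * (norm (y - c))\<^sup>2"
            using Cauchy_Schwarz_ineq[of h' "y - c"] by (simp add: power2_norm_eq_inner)
          also have "\<dots> \<le> inner h' h' * (2 * l)" using yl by (intro mult_left_mono) auto
          also have "\<dots> < M * l" using l(1) by (simp add: M_def algebra_simps)
          also have "\<dots> \<le> m\<^sup>2" using l(4) M by (simp add: field_simps)
          finally show False by simp
        qed
      qed
    qed
  qed
qed

text \<open>Contracting towards \<open>y\<close> by the factor \<open>t\<close> keeps \<open>S\<close> inside itself and maps a neighbourhood of \<open>x\<close>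
  onto one of the new point.\<close>

lemma interior_of_flat_mix:
  fixes S :: "'a::real_inner set"
  assumes A: "A = (+) a ` span B" and S: "convex S" "S \<subseteq> A"
    and x: "x \<in> top_of_set A interior_of S" and y: "y \<in> S" and t: "0 < t" "t \<le> 1"
  shows "(1 - t) *\<^sub>R y + t *\<^sub>R x \<in> top_of_set A interior_of S"
proof -
  have "openin (top_of_set A) (top_of_set A interior_of S)" by (rule openin_interior_of)
  then obtain e where e: "e > 0" "ball x e \<inter> A \<subseteq> S"
    using x interior_of_subset[of "top_of_set A" S] by (meson openin_contains_ball subset_trans)
  define m where "m = (1 - t) *\<^sub>R y + t *\<^sub>R x"
  have xA: "x \<in> A" using x S interior_of_subset[of "top_of_set A" S] by blast
  have yA: "y \<in> A" using y S by blast
  have "ball m (t * e) \<inter> A \<subseteq> S"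
  proof
    fix w assume w: "w \<in> ball m (t * e) \<inter> A"
    define x' where "x' = x + (1 / t) *\<^sub>R (w - m)"
    obtain u v z where uv: "u \<in> span B" "v \<in> span B" "z \<in> span B" "x = a + u" "y = a + v" "w = a + z"
      using xA yA w unfolding A by auto
    have "x' = a + (u + (1 / t) *\<^sub>R (z - ((1 - t) *\<^sub>R v + t *\<^sub>R u)))"
      by (simp add: x'_def m_def uv scaleR_add_right scaleR_diff_left algebra_simps)
    moreover have "u + (1 / t) *\<^sub>R (z - ((1 - t) *\<^sub>R v + t *\<^sub>R u)) \<in> span B"
      using uv by (intro span_add span_scale span_diff)
    ultimately have "x' \<in> A" unfolding A by blast
    moreover have "dist x x' < e"
    proof -
      have "dist x x' = norm (w - m) / t" using t by (simp add: x'_def dist_norm norm_minus_commute)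
      also have "\<dots> < e" using w t by (simp add: dist_norm norm_minus_commute field_simps)
      finally show ?thesis .
    qed
    ultimately have "x' \<in> S" using e by auto
    then have "(1 - t) *\<^sub>R y + t *\<^sub>R x' \<in> S" using S y t by (intro convexD) auto
    moreover have "(1 - t) *\<^sub>R y + t *\<^sub>R x' = w" using t by (simp add: x'_def m_def scaleR_add_right)
    ultimately show "w \<in> S" by simp
  qed
  moreover have "openin (top_of_set A) (ball m (t * e) \<inter> A)" by (auto simp: openin_open)
  moreover have "m \<in> ball m (t * e) \<inter> A"
  proof -
    have "x \<in> A" "y \<in> A" "convex A" using xA yA unfolding A
      by (auto intro: convex_translation subspace_imp_convex subspace_span)
    then have "m \<in> A" unfolding m_def using t by (intro convexD) auto
    then show ?thesis using e t by simp
  qed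
  ultimately show ?thesis unfolding m_def interior_of_def by blast
qed

text \<open>For closed petals a fat common part is needed: rays from one point form a sunflower in the
  plane with any number of petals.  If the common part is fat, the relative interiors of the petals
  form an open sunflower, and moving the points \<^term>\<open>p i\<close> a little towards the common part puts
  them into these interiors; compactness absorbs the motion.\<close>

theorem closed_sunflower:
  fixes B :: "'a::real_inner set" and W :: "'i \<Rightarrow> 'a set"
  assumes fin: "finite B" "finite I" "card B < card I"
    and A: "A = (+) a ` span B"
    and heine: "\<And>X. X \<subseteq> A \<Longrightarrow> closed X \<Longrightarrow> bounded X \<Longrightarrow> compact X"
    and W: "\<And>i. i \<in> I \<Longrightarrow> W i \<subseteq> A \<and> convex (W i) \<and> C \<subseteq> W i"
    and WW: "\<And>i j. i \<in> I \<Longrightarrow> j \<in> I \<Longrightarrow> i \<noteq> j \<Longrightarrow> W i \<inter> W j \<subseteq> C"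
    and C: "closed C" "c \<in> top_of_set A interior_of C"
    and K: "compact K" "convex K" and p: "\<And>i. i \<in> I \<Longrightarrow> p i \<in> W i \<inter> K"
  shows "K \<inter> C \<noteq> {}"
proof -
  define U where "U i = top_of_set A interior_of W i" for i
  define C0 where "C0 = top_of_set A interior_of C"
  have sub: "U i \<subseteq> W i" for i unfolding U_def by (rule interior_of_subset)
  have op: "openin (top_of_set A) (U i)" for i unfolding U_def by (rule openin_interior_of)
  have C0U: "C0 \<subseteq> U i" if "i \<in> I" for i
    unfolding C0_def U_def using W[OF that] by (intro interior_of_mono) auto
  have "open_sunflower A I U C0"
    unfolding open_sunflower_def
  proof (intro conjI ballI impI)
    show "C0 \<noteq> {}" using C by (auto simp: C0_def)
    fix i assume i: "i \<in> I"
    show "openin (top_of_set A) (U i)" by (rule op)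
    show "C0 \<subseteq> U i" using C0U i by blast
    show "convex (U i)"
    proof (rule convexI)
      fix x y u v assume xy: "x \<in> U i" "y \<in> U i" "0 \<le> u" "0 \<le> v" "u + v = (1::real)"
      show "u *\<^sub>R x + v *\<^sub>R y \<in> U i"
      proof (cases "v = 0")
        case False
        show ?thesis
        proof -
          have "(1 - v) *\<^sub>R x + v *\<^sub>R y \<in> U i"
            unfolding U_def using W[OF i] xy sub[of i] False
            by (intro interior_of_flat_mix[OF A]) (auto simp: U_def)
          moreover have "u = 1 - v" using xy by simp
          ultimately show ?thesis by simp
        qed
      qed (use xy in auto)
    qed
    fix j assume j: "j \<in> I" "i \<noteq> j"
    have "openin (top_of_set A) (U i \<inter> U j)" using op by (intro openin_Int)
    moreover have "U i \<inter> U j \<subseteq> C" using sub WW[OF i j] by blast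
    ultimately show "U i \<inter> U j \<subseteq> C0" unfolding C0_def by (intro interior_of_maximal)
  qed
  then have sf: "open_sunflower ((+) a ` span B) I U C0" by (simp add: A)
  have step: "\<exists>k\<in>K. (1 - t) *\<^sub>R k + t *\<^sub>R c \<in> C" if t: "0 < t" "t < 1" for t
  proof -
    define p' where "p' i = (1 - t) *\<^sub>R p i + t *\<^sub>R c" for i
    have "p' i \<in> U i" if i: "i \<in> I" for i
      unfolding p'_def U_def using W[OF i] p[OF i] t C C0U[OF i]
      by (intro interior_of_flat_mix[OF A]) (auto simp: C0_def U_def)
    then have "convex hull (p' ` I) \<inter> closure C0 \<noteq> {}"
      using sunflower[OF fin heine[unfolded A] sf] by blast
    then obtain y where y: "y \<in> convex hull (p' ` I)" "y \<in> closure C0" by blast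
    have "closure C0 \<subseteq> C" unfolding C0_def using C(1) interior_of_subset by (intro closure_minimal)
    then have yC: "y \<in> C" using y by blast
    have img: "convex ((\<lambda>k. (1 - t) *\<^sub>R k + t *\<^sub>R c) ` K)"
    proof -
      have "(\<lambda>k. (1 - t) *\<^sub>R k + t *\<^sub>R c) ` K = (+) (t *\<^sub>R c) ` (\<lambda>k. (1 - t) *\<^sub>R k) ` K"
        by (auto simp: image_image add.commute)
      then show ?thesis using K by (simp add: convex_scaling convex_translation)
    qed
    have "convex hull (p' ` I) \<subseteq> (\<lambda>k. (1 - t) *\<^sub>R k + t *\<^sub>R c) ` K"
      using p img by (intro hull_minimal) (auto simp: p'_def)
    then show ?thesis using y yC by auto
  qed
  have "\<exists>k\<in>K. (1 - 1 / (real m + 2)) *\<^sub>R k + (1 / (real m + 2)) *\<^sub>R c \<in> C" for m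
    by (rule step) (auto simp: field_simps)
  then obtain k where k: "\<And>m. k m \<in> K" "\<And>m. (1 - 1 / (real m + 2)) *\<^sub>R k m + (1 / (real m + 2)) *\<^sub>R c \<in> C"
    by metis
  obtain l s where l: "l \<in> K" "strict_mono s" "(k \<circ> s) \<longlonglongrightarrow> l"
    using K(1) k(1) by (meson compact_def seq_compact_def compact_imp_seq_compact)
  have "(\<lambda>m. 1 / (real m + 2)) \<longlonglongrightarrow> 0"
    using LIMSEQ_ignore_initial_segment[OF lim_1_over_n[where 'a = real], of 2] by (simp add: add.commute)
  then have e0: "((\<lambda>m. 1 / (real m + 2)) \<circ> s) \<longlonglongrightarrow> 0" using l(2) by (rule LIMSEQ_subseq_LIMSEQ)
  define f where "f m = (1 - ((\<lambda>m. 1 / (real m + 2)) \<circ> s) m) *\<^sub>R (k \<circ> s) m + ((\<lambda>m. 1 / (real m + 2)) \<circ> s) m *\<^sub>R c" for m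
  have "f \<longlonglongrightarrow> (1 - 0) *\<^sub>R l + 0 *\<^sub>R c"
    unfolding f_def by (intro tendsto_intros e0 l)
  then have lim: "f \<longlonglongrightarrow> l" by simp
  have "f m \<in> C" for m using k(2)[of "s m"] by (simp add: f_def)
  then have "l \<in> C" using closed_sequentially[OF C(1) _ lim] by blast
  then show ?thesis using l by blast
qed

text \<open>A convex set has an interior point relative to a flat of the least dimension containing it.
  In an independent family each coefficient is a bounded functional, being the inner product with
  the component of that vector orthogonal to the others, so all points near the barycentre of a
  maximal simplex have positive barycentric coordinates.\<close>

lemma convex_interior_in_flat:
  fixes S :: "'a::real_inner set"
  assumes S: "convex S" "a \<in> S" "S \<subseteq> span T" and T: "finite T"
  shows "\<exists>B c. finite B \<and> card B \<le> card T \<and> S \<subseteq> (+) a ` span B \<and> (+) a ` span B \<subseteq> span T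
            \<and> c \<in> top_of_set ((+) a ` span B) interior_of S"
proof -
  obtain B where B: "B \<subseteq> (\<lambda>x. x - a) ` S" "independent B" "(\<lambda>x. x - a) ` S \<subseteq> span B"
    using maximal_independent_subset by blast
  have BT: "B \<subseteq> span T" using B(1) S by (auto intro!: span_diff)
  then have fB: "finite B" and cB: "card B \<le> card T" using independent_span_bound[OF T B(2)] by auto
  define A where "A = (+) a ` span B"
  have SA: "S \<subseteq> A"
  proof
    fix x assume "x \<in> S"
    then have "x - a \<in> span B" using B(3) by auto
    then show "x \<in> A" unfolding A_def by (intro image_eqI[of _ _ "x - a"]) auto
  qed
  have "span B \<subseteq> span T" using BT by (intro span_minimal) auto
  then have AT: "A \<subseteq> span T" using S by (auto simp: A_def intro!: span_add)
  have "\<exists>v. (\<forall>b'\<in>B - {b}. inner v b' = 0) \<and> inner v b = inner v v \<and> v \<noteq> 0" if b: "b \<in> B" for b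
  proof -
    obtain y where y: "y \<in> span (B - {b})" "\<And>t. t \<in> span (B - {b}) \<Longrightarrow> inner (b - y) t = 0"
      using orthogonal_projection_exists[of "B - {b}" b] fB by auto
    have "b - y \<noteq> 0" using B(2) b y(1) by (auto simp: dependent_def)
    moreover have "inner (b - y) b = inner (b - y) (b - y)" using y by (simp add: inner_diff_right)
    ultimately show ?thesis using y(2) by (intro exI[of _ "b - y"]) (auto intro: span_base)
  qed
  then obtain v where v: "\<And>b b'. b \<in> B \<Longrightarrow> b' \<in> B - {b} \<Longrightarrow> inner (v b) b' = 0"
    "\<And>b. b \<in> B \<Longrightarrow> inner (v b) b = inner (v b) (v b)" "\<And>b. b \<in> B \<Longrightarrow> v b \<noteq> 0" by metis
  define k where "k = real (card B) + 1"
  have k1: "k \<ge> 1" by (simp add: k_def)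
  define e where "e = Min (insert 1 ((\<lambda>b. norm (v b) / k\<^sup>2) ` B))"
  have e0: "e > 0" unfolding e_def using fB v(3) k1 by (subst Min_gr_iff) auto
  have eb: "e \<le> norm (v b) / k\<^sup>2" if "b \<in> B" for b unfolding e_def using fB that by (intro Min_le) auto
  define c where "c = a + (\<Sum>b\<in>B. (1 / k) *\<^sub>R b)"
  have "ball c e \<inter> A \<subseteq> S"
  proof
    fix w assume w: "w \<in> ball c e \<inter> A"
    have cA: "(\<Sum>b\<in>B. (1 / k) *\<^sub>R b) \<in> span B" by (intro span_sum span_scale span_base)
    obtain z where z: "z \<in> span B" "w = a + z" using w by (auto simp: A_def)
    have "w - c \<in> span B" using span_diff[OF z(1) cA] by (simp add: z c_def)
    then obtain u where u: "w - c = (\<Sum>b\<in>B. u b *\<^sub>R b)" using fB by (auto simp: span_finite)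
    have ub: "\<bar>u b\<bar> \<le> 1 / k\<^sup>2" if b: "b \<in> B" for b
    proof -
      have "inner (v b) (w - c) = (\<Sum>b'\<in>B. u b' * inner (v b) b')"
        by (simp add: u inner_sum_right)
      also have "\<dots> = u b * inner (v b) b"
        using v(1)[OF b] by (subst sum.remove[OF fB b]) auto
      finally have "u b * (norm (v b))\<^sup>2 = inner (v b) (w - c)" using v(2)[OF b] by (simp add: power2_norm_eq_inner)
      then have "\<bar>u b\<bar> * (norm (v b))\<^sup>2 \<le> norm (v b) * norm (w - c)"
        using Cauchy_Schwarz_ineq2[of "v b" "w - c"] by (simp flip: abs_mult)
      then have "\<bar>u b\<bar> * norm (v b) \<le> norm (w - c)"
        using v(3)[OF b] mult_left_le_imp_le[of "norm (v b)" "\<bar>u b\<bar> * norm (v b)" "norm (w - c)"]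
        by (simp add: power2_eq_square mult_ac)
      also have "\<dots> \<le> norm (v b) / k\<^sup>2" using w eb[OF b] by (simp add: dist_norm norm_minus_commute)
      finally have "\<bar>u b\<bar> * norm (v b) \<le> 1 / k\<^sup>2 * norm (v b)" by simp
      then show ?thesis using v(3)[OF b] by (intro mult_right_le_imp_le[of "\<bar>u b\<bar>" "norm (v b)"]) auto
    qed
    define q where "q b = 1 / k + u b" for b
    have "1 / k\<^sup>2 \<le> 1 / k" using k1 by (simp add: power2_eq_square field_simps)
    then have q0: "0 \<le> q b" if "b \<in> B" for b using ub[OF that] by (simp add: q_def)
    have "(\<Sum>b\<in>B. q b) \<le> (\<Sum>b\<in>B. 1 / k + 1 / k\<^sup>2)" unfolding q_def
      using ub by (intro sum_mono add_left_mono) (auto simp only: abs_le_iff)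
    also have "\<dots> = (k - 1) * (1 / k + 1 / k\<^sup>2)" by (simp add: k_def)
    also have "\<dots> = 1 - 1 / k\<^sup>2" using k1 by (simp add: field_simps power2_eq_square)
    also have "\<dots> \<le> 1" by simp
    finally have qs: "(\<Sum>b\<in>B. q b) \<le> 1" .
    have "w = a + (\<Sum>b\<in>B. q b *\<^sub>R b)"
    proof -
      have "w = c + (\<Sum>b\<in>B. u b *\<^sub>R b)" using u by (simp add: algebra_simps)
      then show ?thesis by (simp add: c_def q_def scaleR_add_left sum.distrib)
    qed
    moreover have "a + (\<Sum>b\<in>B. q b *\<^sub>R b) \<in> S"
    proof -
      define q' where "q' b = (if b = 0 then 1 - (\<Sum>b\<in>B. q b) else q b)" for b
      have B0: "0 \<notin> B" using B(2) dependent_zero by blast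
      have "(\<Sum>b\<in>insert 0 B. q' b *\<^sub>R (a + b)) \<in> S"
      proof (rule convex_sum)
        have "(\<Sum>b\<in>B. q' b) = (\<Sum>b\<in>B. q b)"
          using B0 by (intro sum.cong) (auto simp: q'_def)
        then show "(\<Sum>b\<in>insert 0 B. q' b) = 1"
          using fB B0 by (simp add: q'_def)
        show "a + b \<in> S" if "b \<in> insert 0 B" for b using that B(1) S by auto
      qed (use S fB q0 qs in \<open>auto simp: q'_def\<close>)
      also have "(\<Sum>b\<in>insert 0 B. q' b *\<^sub>R (a + b)) = (1 - (\<Sum>b\<in>B. q b)) *\<^sub>R a + (\<Sum>b\<in>B. q b *\<^sub>R (a + b))"
      proof -
        have "(\<Sum>b\<in>B. q' b *\<^sub>R (a + b)) = (\<Sum>b\<in>B. q b *\<^sub>R (a + b))"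
          using B0 by (intro sum.cong) (auto simp: q'_def)
        then show ?thesis using fB B0 by (simp add: q'_def)
      qed
      also have "\<dots> = a + (\<Sum>b\<in>B. q b *\<^sub>R b)"
      proof -
        have "(\<Sum>b\<in>B. q b *\<^sub>R (a + b)) = (\<Sum>b\<in>B. q b) *\<^sub>R a + (\<Sum>b\<in>B. q b *\<^sub>R b)"
          by (simp only: scaleR_add_right sum.distrib scaleR_sum_left)
        then show ?thesis by (simp add: scaleR_diff_left)
      qed
      finally show ?thesis .
    qed
    ultimately show "w \<in> S" by simp
  qed
  moreover have "openin (top_of_set A) (ball c e \<inter> A)" by (auto simp: openin_open)
  moreover have "c \<in> A"
    unfolding c_def A_def by (intro imageI span_sum span_scale span_base)
  then have "c \<in> ball c e \<inter> A" using e0 by simp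
  ultimately have "c \<in> top_of_set A interior_of S" unfolding interior_of_def by blast
  then show ?thesis using fB cB SA AT unfolding A_def by blast
qed

section \<open>The space of finitely supported sequences\<close>

text \<open>All the spaces $\mathbb{R}^d$ sit in this one inner product space, so that the results above
  apply to them simultaneously in every dimension.\<close>

typedef fvec = "{x :: nat \<Rightarrow> real. finite {i. x i \<noteq> 0}}"
  morphisms coord Abs_fvec
  by (rule exI[of _ "\<lambda>_. 0"]) auto

lemma fvec_eqI: "(\<And>i. coord x i = coord y i) \<Longrightarrow> x = y"
  using coord_inject by blast

lemma finite_coord: "finite {i. coord x i \<noteq> 0}"
  using coord[of x] by simp

lemma coord_Abs: "finite {i. f i \<noteq> 0} \<Longrightarrow> coord (Abs_fvec f) = f"
  by (simp add: Abs_fvec_inverse)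

instantiation fvec :: real_vector
begin
definition "0 = Abs_fvec (\<lambda>_. 0)"
definition "x + y = Abs_fvec (\<lambda>i. coord x i + coord y i)"
definition "- x = Abs_fvec (\<lambda>i. - coord x i)"
definition "x - y = Abs_fvec (\<lambda>i. coord x i - coord y i)"
definition "scaleR r x = Abs_fvec (\<lambda>i. r * coord x i)"

lemma coord_0: "coord 0 i = 0"
  by (simp add: zero_fvec_def coord_Abs)

lemma coord_add: "coord (x + y) i = coord x i + coord y i"
  unfolding plus_fvec_def
  by (subst coord_Abs) (auto intro: finite_subset[OF _ finite_UnI[OF finite_coord[of x] finite_coord[of y]]])

lemma coord_minus: "coord (- x) i = - coord x i"
  unfolding uminus_fvec_def using finite_coord[of x] by (subst coord_Abs) auto

lemma coord_diff: "coord (x - y) i = coord x i - coord y i"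
  unfolding minus_fvec_def
  by (subst coord_Abs) (auto intro: finite_subset[OF _ finite_UnI[OF finite_coord[of x] finite_coord[of y]]])

lemma coord_scaleR: "coord (scaleR r x) i = r * coord x i"
  unfolding scaleR_fvec_def
  by (subst coord_Abs) (auto intro: finite_subset[OF _ finite_coord[of x]])

instance
  by standard (auto intro!: fvec_eqI simp: coord_0 coord_add coord_minus coord_diff coord_scaleR algebra_simps)
end

lemmas coord_simps = coord_0 coord_add coord_minus coord_diff coord_scaleR

instantiation fvec :: real_inner
begin
definition "inner x y = (\<Sum>i | coord x i \<noteq> 0. coord x i * coord y i)"
definition "norm x = sqrt (inner x (x::fvec))"
definition "dist x y = norm (x - (y::fvec))"
definition "sgn x = x /\<^sub>R norm (x::fvec)"
definition "uniformity = (INF e\<in>{0 <..}. principal {(x, y :: fvec). dist x y < e})"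
definition "open U \<longleftrightarrow> (\<forall>x\<in>U. \<forall>\<^sub>F (x', y) in uniformity. x' = x \<longrightarrow> y \<in> (U :: fvec set))"

lemma inner_fvec: "finite F \<Longrightarrow> {i. coord x i \<noteq> 0} \<subseteq> F \<Longrightarrow> inner x y = (\<Sum>i\<in>F. coord x i * coord y i)"
  unfolding inner_fvec_def by (intro sum.mono_neutral_left) auto

instance
proof
  fix x y z :: fvec and r :: real
  define F where "F = {i. coord x i \<noteq> 0} \<union> {i. coord y i \<noteq> 0} \<union> {i. coord z i \<noteq> 0}"
  have F: "finite F" unfolding F_def using finite_coord by auto
  have sup: "{i. coord x i \<noteq> 0} \<subseteq> F" "{i. coord y i \<noteq> 0} \<subseteq> F" "{i. coord (x + y) i \<noteq> 0} \<subseteq> F"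
     "{i. coord (scaleR r x) i \<noteq> 0} \<subseteq> F"
    by (auto simp: F_def coord_simps)
  note inn = inner_fvec[OF F sup(1)] inner_fvec[OF F sup(2)] inner_fvec[OF F sup(3)] inner_fvec[OF F sup(4)]
  show "dist x y = norm (x - y)" by (simp add: dist_fvec_def)
  show "sgn x = x /\<^sub>R norm x" by (simp add: sgn_fvec_def)
  show "inner x y = inner y x" unfolding inn by (simp add: mult.commute)
  show "inner (x + y) z = inner x z + inner y z" unfolding inn by (simp add: coord_simps algebra_simps sum.distrib)
  show "inner (scaleR r x) y = r * inner x y" unfolding inn by (simp add: coord_simps sum_distrib_left algebra_simps)
  show "0 \<le> inner x x" unfolding inn by (intro sum_nonneg) auto
  show "(inner x x = 0) = (x = 0)"
  proof
    assume "inner x x = 0"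
    then have "\<forall>i\<in>F. coord x i * coord x i = 0"
      unfolding inn using F by (subst (asm) sum_nonneg_eq_0_iff) auto
    then show "x = 0" using sup(1) by (intro fvec_eqI) (auto simp: coord_simps)
  qed (simp add: inner_fvec_def coord_simps)
  show "norm x = sqrt (inner x x)" by (simp add: norm_fvec_def)
qed (simp_all add: uniformity_fvec_def open_fvec_def)
end

lemma coord_le_norm: "\<bar>coord x i\<bar> \<le> norm x"
proof -
  have "(coord x i)\<^sup>2 \<le> inner x x"
  proof (cases "coord x i = 0")
    case False
    then have "coord x i * coord x i \<le> (\<Sum>i | coord x i \<noteq> 0. coord x i * coord x i)"
      using finite_coord[of x] by (intro member_le_sum) auto
    then show ?thesis by (simp add: inner_fvec_def power2_eq_square)
  qed simp
  then have "sqrt ((coord x i)\<^sup>2) \<le> sqrt (inner x x)" by (rule real_sqrt_le_mono)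
  then show ?thesis by (simp add: norm_eq_sqrt_inner)
qed

definition unitv :: "nat \<Rightarrow> fvec" where
  "unitv j = Abs_fvec (\<lambda>i. if i = j then 1 else 0)"

lemma coord_unitv: "coord (unitv j) i = (if i = j then 1 else 0)"
  unfolding unitv_def by (subst coord_Abs) auto

definition Rn :: "nat \<Rightarrow> fvec set" where
  "Rn d = {x. \<forall>i\<ge>d. coord x i = 0}"

lemma Rn_eq_span: "Rn d = span (unitv ` {..<d})"
proof
  show "span (unitv ` {..<d}) \<subseteq> Rn d"
    by (rule span_minimal) (auto simp: Rn_def coord_unitv subspace_def coord_simps)
  have "coord (\<Sum>j\<in>F. f j) i = (\<Sum>j\<in>F. coord (f j) i)" if "finite F" for f :: "nat \<Rightarrow> fvec" and F i
    using that by induction (auto simp: coord_simps)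
  note coord_sum = this
  have expand: "x = (\<Sum>j<d. coord x j *\<^sub>R unitv j)" if "x \<in> Rn d" for x
  proof (rule fvec_eqI)
    fix i
    have "coord (\<Sum>j<d. coord x j *\<^sub>R unitv j) i = (\<Sum>j<d. if i = j then coord x j else 0)"
      by (simp add: coord_sum coord_scaleR coord_unitv if_distrib cong: if_cong)
    also have "\<dots> = coord x i" using that by (auto simp: Rn_def)
    finally show "coord x i = coord (\<Sum>j<d. coord x j *\<^sub>R unitv j) i" by simp
  qed
  show "Rn d \<subseteq> span (unitv ` {..<d})"
  proof
    fix x assume "x \<in> Rn d"
    then have "x = (\<Sum>j<d. coord x j *\<^sub>R unitv j)" by (rule expand)
    moreover have "(\<Sum>j<d. coord x j *\<^sub>R unitv j) \<in> span (unitv ` {..<d})"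
      by (intro span_sum span_scale span_base) auto
    ultimately show "x \<in> span (unitv ` {..<d})" by simp
  qed
qed

lemma closed_Rn: "closed (Rn d)"
  unfolding Rn_eq_span by (rule closed_span_finite) auto

lemma compact_box: "compact {x \<in> Rn d. \<forall>i. \<bar>coord x i\<bar> \<le> r}"
proof (induction d)
  case 0
  have "{x \<in> Rn 0. \<forall>i. \<bar>coord x i\<bar> \<le> r} \<subseteq> {0}" by (auto simp: Rn_def intro!: fvec_eqI simp: coord_0)
  then show ?case using finite_subset finite_imp_compact by blast
next
  case (Suc d)
  let ?f = "\<lambda>z :: fvec \<times> real. fst z + snd z *\<^sub>R unitv d"
  show ?case
  proof (cases "r \<ge> 0")
    case True
    have "compact ({x \<in> Rn d. \<forall>i. \<bar>coord x i\<bar> \<le> r} \<times> {-r..r})" using Suc by (intro compact_Times) auto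
    then have "compact (?f ` ({x \<in> Rn d. \<forall>i. \<bar>coord x i\<bar> \<le> r} \<times> {-r..r}))"
      by (intro compact_continuous_image continuous_intros)
    also have "?f ` ({x \<in> Rn d. \<forall>i. \<bar>coord x i\<bar> \<le> r} \<times> {-r..r}) = {x \<in> Rn (Suc d). \<forall>i. \<bar>coord x i\<bar> \<le> r}"
    proof (intro equalityI subsetI)
      fix x assume x: "x \<in> {x \<in> Rn (Suc d). \<forall>i. \<bar>coord x i\<bar> \<le> r}"
      define y where "y = x - coord x d *\<^sub>R unitv d"
      have "\<bar>coord x d\<bar> \<le> r" using x by auto
      moreover have "coord x i = 0" if "d \<le> i" "i \<noteq> d" for i using x that by (auto simp: Rn_def)
      then have "y \<in> {x \<in> Rn d. \<forall>i. \<bar>coord x i\<bar> \<le> r}"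
        using x True by (auto simp: y_def Rn_def coord_simps coord_unitv)
      ultimately have "(y, coord x d) \<in> {x \<in> Rn d. \<forall>i. \<bar>coord x i\<bar> \<le> r} \<times> {-r..r}" by auto
      moreover have "x = ?f (y, coord x d)" by (simp add: y_def)
      ultimately show "x \<in> ?f ` ({x \<in> Rn d. \<forall>i. \<bar>coord x i\<bar> \<le> r} \<times> {-r..r})" by blast
    qed (auto simp: Rn_def coord_simps coord_unitv abs_le_iff)
    finally show ?thesis .
  next
    case False
    then have "{x \<in> Rn (Suc d). \<forall>i. \<bar>coord x i\<bar> \<le> r} = {}" by force
    then show ?thesis by (metis compact_empty)
  qed
qed

lemma Rn_heine_borel:
  assumes "X \<subseteq> Rn d" "closed X" "bounded X"
  shows "compact X"
proof -
  obtain r where r: "\<And>x. x \<in> X \<Longrightarrow> norm x \<le> r" using assms(3) by (auto simp: bounded_iff)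
  have eq: "X \<inter> {x \<in> Rn d. \<forall>i. \<bar>coord x i\<bar> \<le> r} = X"
    using assms(1) r coord_le_norm order_trans by blast
  have "compact (X \<inter> {x \<in> Rn d. \<forall>i. \<bar>coord x i\<bar> \<le> r})"
    using assms(2) compact_box by (rule closed_Int_compact)
  then show ?thesis by (simp only: eq)
qed

section \<open>Convex sets in the spaces \<^term>\<open>Euclidean_space d\<close>\<close>

abbreviation "Esp \<equiv> Euclidean_space"

lemma topspace_E: "x \<in> topspace (Esp d) \<longleftrightarrow> (\<forall>i\<ge>d. x i = 0)"
  by (simp add: topspace_Euclidean_space)

lemma openin_Esp_iff: "openin (Esp d) U \<longleftrightarrow> (\<exists>T. open T \<and> U = T \<inter> topspace (Esp d))"
proof -
  have "Esp d = subtopology euclidean (topspace (Esp d))"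
    by (simp add: Euclidean_space_def euclidean_product_topology)
  then show ?thesis by (metis openin_subtopology open_openin)
qed

lemma openin_Esp_box:
  "openin (Esp d) U \<longleftrightarrow> U \<subseteq> topspace (Esp d) \<and>
     (\<forall>x\<in>U. \<exists>e>0. \<forall>y\<in>topspace (Esp d). (\<forall>i<d. \<bar>y i - x i\<bar> < e) \<longrightarrow> y \<in> U)"
proof safe
  fix x assume "openin (Esp d) U" "x \<in> U"
  then show "x \<in> topspace (Esp d)" using openin_subset by blast
next
  fix x assume op: "openin (Esp d) U" and x: "x \<in> U"
  obtain T where T: "open T" "U = T \<inter> topspace (Esp d)" using op openin_Esp_iff by blast
  have "openin (product_topology (\<lambda>_. euclidean) UNIV) T" using T(1) by (simp add: euclidean_product_topology)
  then obtain X where X: "x \<in> (\<Pi>\<^sub>E i\<in>UNIV. X i)" "\<And>i. open (X i)" "finite {i. X i \<noteq> UNIV}" "(\<Pi>\<^sub>E i\<in>UNIV. X i) \<subseteq> T"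
    using product_topology_open_contains_basis[of "\<lambda>_. euclidean" UNIV T x] x T(2) by auto
  have xX: "x i \<in> X i" for i using X(1) by (auto simp: PiE_iff)
  have "\<exists>e>0. ball (x i) e \<subseteq> X i" for i
    by (rule openE[OF X(2)[of i] xX[of i]]) blast
  then obtain e where e: "\<And>i. e i > 0" "\<And>i. ball (x i) (e i) \<subseteq> X i" by metis
  define m where "m = Min (insert 1 (e ` {..<d}))"
  have m: "m > 0" "\<And>i. i < d \<Longrightarrow> m \<le> e i" using e(1) by (auto simp: m_def)
  have "y \<in> U" if y: "y \<in> topspace (Esp d)" "\<forall>i<d. \<bar>y i - x i\<bar> < m" for y
  proof -
    have "y i \<in> X i" for i
    proof (cases "i < d")
      case True
      then have "\<bar>y i - x i\<bar> < e i" using y m(2) by force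
      then show ?thesis using e(2)[of i] by (auto simp: dist_real_def)
    next
      case False
      then have "y i = x i" using y x T(2) by (auto simp: topspace_E)
      then show ?thesis using e[of i] by auto
    qed
    then show ?thesis using X(4) T(2) y(1) by auto
  qed
  then show "\<exists>e>0. \<forall>y\<in>topspace (Esp d). (\<forall>i<d. \<bar>y i - x i\<bar> < e) \<longrightarrow> y \<in> U" using m(1) by blast
next
  assume sub: "U \<subseteq> topspace (Esp d)"
    and box: "\<forall>x\<in>U. \<exists>e>0. \<forall>y\<in>topspace (Esp d). (\<forall>i<d. \<bar>y i - x i\<bar> < e) \<longrightarrow> y \<in> U"
  show "openin (Esp d) U"
    unfolding openin_subopen[of _ U]
  proof
    fix x assume x: "x \<in> U"
    then obtain e where e: "e > 0" "\<forall>y\<in>topspace (Esp d). (\<forall>i<d. \<bar>y i - x i\<bar> < e) \<longrightarrow> y \<in> U" using box by blast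
    have "open {y :: nat \<Rightarrow> real. \<forall>i<d. \<bar>y i - x i\<bar> < e}"
    proof -
      have "open (\<Inter>i\<in>{..<d}. {y :: nat \<Rightarrow> real. \<bar>y i - x i\<bar> < e})"
        by (intro open_INT ballI open_Collect_less continuous_intros) auto
      also have "(\<Inter>i\<in>{..<d}. {y :: nat \<Rightarrow> real. \<bar>y i - x i\<bar> < e}) = {y. \<forall>i<d. \<bar>y i - x i\<bar> < e}" by auto
      finally show ?thesis .
    qed
    then have "openin (Esp d) ({y. \<forall>i<d. \<bar>y i - x i\<bar> < e} \<inter> topspace (Esp d))" using openin_Esp_iff by blast
    then show "\<exists>T. openin (Esp d) T \<and> x \<in> T \<and> T \<subseteq> U" 
      using e sub x by (intro exI[of _ "{y. \<forall>i<d. \<bar>y i - x i\<bar> < e} \<inter> topspace (Esp d)"] conjI) auto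
  qed
qed

lemma interior_of_Esp_box:
  "x \<in> Esp d interior_of X \<longleftrightarrow> x \<in> topspace (Esp d) \<and>
     (\<exists>e>0. \<forall>y\<in>topspace (Esp d). (\<forall>i<d. \<bar>y i - x i\<bar> < e) \<longrightarrow> y \<in> X)"
proof
  assume x: "x \<in> Esp d interior_of X"
  have "openin (Esp d) (Esp d interior_of X)" by (rule openin_interior_of)
  then show "x \<in> topspace (Esp d) \<and> (\<exists>e>0. \<forall>y\<in>topspace (Esp d). (\<forall>i<d. \<bar>y i - x i\<bar> < e) \<longrightarrow> y \<in> X)"
    unfolding openin_Esp_box using x interior_of_subset[of "Esp d" X] by blast
next
  assume "x \<in> topspace (Esp d) \<and> (\<exists>e>0. \<forall>y\<in>topspace (Esp d). (\<forall>i<d. \<bar>y i - x i\<bar> < e) \<longrightarrow> y \<in> X)"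
  then obtain e where e: "x \<in> topspace (Esp d)" "e > 0"
    "\<And>y. y \<in> topspace (Esp d) \<Longrightarrow> (\<forall>i<d. \<bar>y i - x i\<bar> < e) \<Longrightarrow> y \<in> X" by blast
  define T where "T = {y \<in> topspace (Esp d). \<forall>i<d. \<bar>y i - x i\<bar> < e}"
  have "openin (Esp d) T"
    unfolding openin_Esp_box
  proof (intro conjI ballI)
    fix y assume y: "y \<in> T"
    define f where "f = Min (insert 1 ((\<lambda>i. e - \<bar>y i - x i\<bar>) ` {..<d}))"
    have f: "f > 0" "\<And>i. i < d \<Longrightarrow> f \<le> e - \<bar>y i - x i\<bar>" using y by (auto simp: f_def T_def)
    have "z \<in> T" if z: "z \<in> topspace (Esp d)" "\<forall>i<d. \<bar>z i - y i\<bar> < f" for z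
    proof -
      have "\<bar>z i - x i\<bar> < e" if "i < d" for i using z(2) that f(2)[OF that] by fastforce
      then show ?thesis using z(1) by (simp add: T_def)
    qed
    then show "\<exists>f>0. \<forall>z\<in>topspace (Esp d). (\<forall>i<d. \<bar>z i - y i\<bar> < f) \<longrightarrow> z \<in> T" using f(1) by blast
  qed (auto simp: T_def)
  then show "x \<in> Esp d interior_of X" unfolding interior_of_def using e by (auto simp: T_def)
qed

lemma closure_of_Esp_box:
  "x \<in> Esp d closure_of X \<longleftrightarrow> x \<in> topspace (Esp d) \<and>
     (\<forall>e>0. \<exists>y\<in>topspace (Esp d). (\<forall>i<d. \<bar>y i - x i\<bar> < e) \<and> y \<in> X)"
proof -
  have "Esp d closure_of X = topspace (Esp d) - (Esp d interior_of (topspace (Esp d) - X))"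
    by (rule closure_of_interior_of)
  then show ?thesis using interior_of_Esp_box[of x d "topspace (Esp d) - X"] by auto
qed

lemma convex_fun_closure_of:
  assumes U: "convex_fun U"
  shows "convex_fun (Esp d closure_of U)"
  unfolding convex_fun_def
proof (intro ballI allI impI)
  fix x y :: "nat \<Rightarrow> real" and u v :: real
  assume x: "x \<in> Esp d closure_of U" and y: "y \<in> Esp d closure_of U" and uv: "0 \<le> u" "0 \<le> v" "u + v = 1"
  show "(\<lambda>i. u * x i + v * y i) \<in> Esp d closure_of U"
    unfolding closure_of_Esp_box
  proof (intro conjI allI impI)
    show "(\<lambda>i. u * x i + v * y i) \<in> topspace (Esp d)"
      using x y by (auto simp: closure_of_Esp_box topspace_E)
    fix e :: real assume e: "e > 0"
    obtain x' where x': "x' \<in> topspace (Esp d)" "\<forall>i<d. \<bar>x' i - x i\<bar> < e" "x' \<in> U"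
      using x e by (auto simp: closure_of_Esp_box)
    obtain y' where y': "y' \<in> topspace (Esp d)" "\<forall>i<d. \<bar>y' i - y i\<bar> < e" "y' \<in> U"
      using y e by (auto simp: closure_of_Esp_box)
    have near: "\<bar>(u * x' i + v * y' i) - (u * x i + v * y i)\<bar> < e" if i: "i < d" for i
    proof -
      have "(u * x' i + v * y' i) - (u * x i + v * y i) = u * (x' i - x i) + v * (y' i - y i)"
        by (simp add: algebra_simps)
      moreover have "\<bar>u * (x' i - x i) + v * (y' i - y i)\<bar> \<le> u * \<bar>x' i - x i\<bar> + v * \<bar>y' i - y i\<bar>"
        using uv abs_triangle_ineq[of "u * (x' i - x i)" "v * (y' i - y i)"] by (simp add: abs_mult)
      moreover have "u * \<bar>x' i - x i\<bar> + v * \<bar>y' i - y i\<bar> < e"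
        using x' y' i uv by (intro convex_bound_lt) auto
      ultimately show ?thesis by linarith
    qed
    have "(\<lambda>i. u * x' i + v * y' i) \<in> U" using U uv x' y' by (auto simp: convex_fun_def)
    moreover have "(\<lambda>i. u * x' i + v * y' i) \<in> topspace (Esp d)" using x' y' by (auto simp: topspace_E)
    ultimately show "\<exists>z\<in>topspace (Esp d). (\<forall>i<d. \<bar>z i - (u * x i + v * y i)\<bar> < e) \<and> z \<in> U"
      using near by (intro bexI[of _ "\<lambda>i. u * x' i + v * y' i"]) auto
  qed
qed

subsection \<open>Passing to the inner product space\<close>

definition fvecs :: "(nat \<Rightarrow> real) set \<Rightarrow> fvec set" where
  "fvecs X = {v. coord v \<in> X}"

lemma coord_topspace: "coord v \<in> topspace (Esp d) \<longleftrightarrow> v \<in> Rn d"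
  by (simp add: topspace_E Rn_def)

lemma topspace_coord:
  assumes "p \<in> topspace (Esp d)"
  obtains v where "v \<in> Rn d" "coord v = p"
proof -
  have "{i. p i \<noteq> 0} \<subseteq> {..<d}" using assms by (auto simp: topspace_E) (meson not_le)
  then have "coord (Abs_fvec p) = p" by (intro coord_Abs) (auto intro: finite_subset)
  then show ?thesis using that[of "Abs_fvec p"] assms coord_topspace[of "Abs_fvec p" d] by simp
qed

lemma convex_fvecs: "convex_fun X \<Longrightarrow> convex (fvecs X)"
proof (rule convexI)
  fix x y :: fvec and u v :: real
  assume X: "convex_fun X" "x \<in> fvecs X" "y \<in> fvecs X" "0 \<le> u" "0 \<le> v" "u + v = 1"
  have "coord (u *\<^sub>R x + v *\<^sub>R y) = (\<lambda>i. u * coord x i + v * coord y i)" by (auto simp: coord_simps)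
  then show "u *\<^sub>R x + v *\<^sub>R y \<in> fvecs X" using X by (auto simp: fvecs_def convex_fun_def)
qed

lemma openin_fvecs:
  assumes "openin (Esp d) U"
  shows "openin (top_of_set (Rn d)) (fvecs U)"
  unfolding openin_contains_ball
proof (intro conjI ballI)
  show "fvecs U \<subseteq> Rn d" using openin_subset[OF assms] coord_topspace by (auto simp: fvecs_def)
  fix x assume "x \<in> fvecs U"
  then obtain e where e: "e > 0" "\<And>y. y \<in> topspace (Esp d) \<Longrightarrow> (\<forall>i<d. \<bar>y i - coord x i\<bar> < e) \<Longrightarrow> y \<in> U"
    using assms unfolding openin_Esp_box fvecs_def by blast
  have "y \<in> fvecs U" if y: "y \<in> ball x e \<inter> Rn d" for y
  proof -
    have "\<bar>coord y i - coord x i\<bar> < e" for i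
      using coord_le_norm[of "y - x" i] y by (simp add: coord_simps dist_norm norm_minus_commute)
    then show ?thesis using e(2)[of "coord y"] y coord_topspace[of y d] by (simp add: fvecs_def)
  qed
  then show "\<exists>e>0. ball x e \<inter> Rn d \<subseteq> fvecs U" using e(1) by blast
qed

lemma closed_fvecs:
  assumes "closedin (Esp d) X"
  shows "closed (fvecs X)" "fvecs X \<subseteq> Rn d"
proof -
  show sub: "fvecs X \<subseteq> Rn d" using closedin_subset[OF assms] coord_topspace by (auto simp: fvecs_def)
  have "openin (Esp d) (topspace (Esp d) - X)" using assms by (simp add: closedin_def)
  then have "openin (top_of_set (Rn d)) (fvecs (topspace (Esp d) - X))" by (rule openin_fvecs)
  then obtain T where T: "open T" "fvecs (topspace (Esp d) - X) = Rn d \<inter> T" by (auto simp: openin_open)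
  have "v \<in> fvecs X \<longleftrightarrow> v \<in> Rn d \<inter> (- T)" for v
  proof -
    have "v \<in> Rn d \<inter> T \<longleftrightarrow> v \<in> Rn d \<and> coord v \<notin> X" using T(2) coord_topspace by (auto simp: fvecs_def)
    then show ?thesis using sub by (auto simp: fvecs_def)
  qed
  then have "fvecs X = Rn d \<inter> (- T)" by blast
  then show "closed (fvecs X)" using T closed_Rn by auto
qed

subsection \<open>Polyhedra\<close>

definition affine_fun :: "nat \<Rightarrow> ((nat \<Rightarrow> real) \<Rightarrow> real) \<Rightarrow> bool" where
  "affine_fun d f \<longleftrightarrow> (\<exists>a b. \<forall>x. f x = b + (\<Sum>i<d. a i * x i))"

lemma affine_fun_const [intro, simp]: "affine_fun d (\<lambda>x. c)"
  unfolding affine_fun_def by (rule exI[of _ "\<lambda>_. 0"], rule exI[of _ c]) auto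

lemma affine_fun_coord [intro, simp]: "i < d \<Longrightarrow> affine_fun d (\<lambda>x. x i)"
  unfolding affine_fun_def
  by (rule exI[of _ "\<lambda>j. if j = i then 1 else 0"], rule exI[of _ 0]) (auto simp: if_distrib[of "\<lambda>y. y * _"] cong: if_cong)

lemma affine_fun_add [intro]:
  assumes "affine_fun d f" "affine_fun d g"
  shows "affine_fun d (\<lambda>x. f x + g x)"
proof -
  obtain a b a' b' where "\<And>x. f x = b + (\<Sum>i<d. a i * x i)" "\<And>x. g x = b' + (\<Sum>i<d. a' i * x i)"
    using assms by (auto simp: affine_fun_def)
  then show ?thesis unfolding affine_fun_def
    by (intro exI[of _ "\<lambda>i. a i + a' i"] exI[of _ "b + b'"]) (auto simp: algebra_simps sum.distrib)
qed

lemma affine_fun_cmul [intro]: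
  assumes "affine_fun d f"
  shows "affine_fun d (\<lambda>x. c * f x)"
proof -
  obtain a b where "\<And>x. f x = b + (\<Sum>i<d. a i * x i)" using assms by (auto simp: affine_fun_def)
  then show ?thesis unfolding affine_fun_def
    by (intro exI[of _ "\<lambda>i. c * a i"] exI[of _ "c * b"]) (auto simp: algebra_simps sum_distrib_left)
qed

lemma affine_fun_diff [intro]:
  assumes "affine_fun d f" "affine_fun d g"
  shows "affine_fun d (\<lambda>x. f x - g x)"
  using affine_fun_add[OF assms(1) affine_fun_cmul[OF assms(2), of "-1"]] by simp

lemma affine_fun_sum [intro]:
  assumes "\<And>k. k \<in> K \<Longrightarrow> affine_fun d (f k)"
  shows "affine_fun d (\<lambda>x. \<Sum>k\<in>K. f k x)"
  using assms by (induction K rule: infinite_finite_induct) auto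

lemma affine_fun_convex_comb:
  assumes "affine_fun d f" "u + v = 1"
  shows "f (\<lambda>i. u * x i + v * y i) = u * f x + v * f y"
proof -
  obtain a b where f: "\<And>x. f x = b + (\<Sum>i<d. a i * x i)" using assms(1) by (auto simp: affine_fun_def)
  have "b = u * b + v * b" using assms(2) by (metis distrib_right mult_1)
  then show ?thesis unfolding f by (simp add: algebra_simps sum.distrib sum_distrib_left)
qed

lemma continuous_affine_fun: "affine_fun d f \<Longrightarrow> continuous_on UNIV f"
proof -
  assume "affine_fun d f"
  then obtain a b where "f = (\<lambda>x. b + (\<Sum>i<d. a i * x i))" by (auto simp: affine_fun_def)
  then show ?thesis by (auto intro!: continuous_intros)
qed

text \<open>Strict and weak inequality treated at once: an open polyhedron and its closed counterpart are
  described by the same list of affine functions.\<close>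

definition rel :: "bool \<Rightarrow> real \<Rightarrow> real \<Rightarrow> bool" where
  "rel b u v \<longleftrightarrow> (if b then u < v else u \<le> v)"

definition polyhedron_of :: "bool \<Rightarrow> nat \<Rightarrow> ((nat \<Rightarrow> real) \<Rightarrow> real) set \<Rightarrow> (nat \<Rightarrow> real) set" where
  "polyhedron_of b d F = {x \<in> topspace (Esp d). \<forall>f\<in>F. rel b 0 (f x)}"

lemma convex_polyhedron_of:
  assumes F: "\<And>f. f \<in> F \<Longrightarrow> affine_fun d f"
  shows "convex_fun (polyhedron_of b d F)"
  unfolding convex_fun_def
proof (intro ballI allI impI)
  fix x y :: "nat \<Rightarrow> real" and u v :: real
  assume x: "x \<in> polyhedron_of b d F" and y: "y \<in> polyhedron_of b d F" and uv: "0 \<le> u" "0 \<le> v" "u + v = 1"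
  have "rel b 0 (f (\<lambda>i. u * x i + v * y i))" if f: "f \<in> F" for f
  proof -
    have "rel b 0 (f x)" "rel b 0 (f y)" using x y f by (auto simp: polyhedron_of_def)
    moreover have "u > 0 \<or> v > 0" using uv by linarith
    ultimately have "rel b 0 (u * f x + v * f y)" using uv
      by (auto simp: rel_def add_nonneg_pos add_pos_nonneg split: if_splits)
    then show ?thesis using affine_fun_convex_comb[OF F[OF f] uv(3)] by simp
  qed
  then show "(\<lambda>i. u * x i + v * y i) \<in> polyhedron_of b d F"
    using x y by (auto simp: polyhedron_of_def topspace_E)
qed

lemma openin_polyhedron_of:
  assumes "finite F" "\<And>f. f \<in> F \<Longrightarrow> affine_fun d f"
  shows "openin (Esp d) (polyhedron_of True d F)"
proof -
  have "open (\<Inter>f\<in>F. {x. 0 < f x})"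
    using assms by (intro open_INT ballI open_Collect_less continuous_on_const continuous_affine_fun) auto
  moreover have "polyhedron_of True d F = (\<Inter>f\<in>F. {x. 0 < f x}) \<inter> topspace (Esp d)"
    by (auto simp: polyhedron_of_def rel_def)
  ultimately show ?thesis using openin_Esp_iff by blast
qed

lemma closedin_polyhedron_of:
  assumes "\<And>f. f \<in> F \<Longrightarrow> affine_fun d f"
  shows "closedin (Esp d) (polyhedron_of False d F)"
proof -
  have "closed (\<Inter>f\<in>F. {x. 0 \<le> f x})"
    using assms by (intro closed_INT ballI closed_Collect_le continuous_on_const continuous_affine_fun) auto
  moreover have "closed (topspace (Esp d))"
    using closedin_Euclidean_imp_closed closedin_topspace by blast
  moreover have "polyhedron_of False d F = (\<Inter>f\<in>F. {x. 0 \<le> f x}) \<inter> topspace (Esp d)"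
    by (auto simp: polyhedron_of_def rel_def)
  ultimately show ?thesis unfolding closedin_Euclidean_space_iff by auto
qed

text \<open>Where one of the functions vanishes, a small step against a coordinate with nonzero
  coefficient makes it negative.\<close>

lemma interior_of_polyhedron_of:
  assumes F: "finite F" "\<And>f. f \<in> F \<Longrightarrow> affine_fun d f"
    and nonconst: "\<And>f. f \<in> F \<Longrightarrow> \<exists>x\<in>topspace (Esp d). f x \<noteq> f (\<lambda>_. 0)"
  shows "Esp d interior_of polyhedron_of False d F = polyhedron_of True d F"
proof
  have "polyhedron_of True d F \<subseteq> polyhedron_of False d F" by (auto simp: polyhedron_of_def rel_def intro: less_imp_le)
  then show "polyhedron_of True d F \<subseteq> Esp d interior_of polyhedron_of False d F"
    using openin_polyhedron_of[OF F] by (intro interior_of_maximal)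
  show "Esp d interior_of polyhedron_of False d F \<subseteq> polyhedron_of True d F"
  proof
    fix x assume "x \<in> Esp d interior_of polyhedron_of False d F"
    then obtain e where x: "x \<in> topspace (Esp d)" and e: "e > 0"
      "\<And>y. y \<in> topspace (Esp d) \<Longrightarrow> (\<forall>i<d. \<bar>y i - x i\<bar> < e) \<Longrightarrow> y \<in> polyhedron_of False d F"
      unfolding interior_of_Esp_box by blast
    have "0 < f x" if f: "f \<in> F" for f
    proof (rule ccontr)
      assume "\<not> 0 < f x"
      obtain a b where ab: "\<And>x. f x = b + (\<Sum>i<d. a i * x i)" using F(2)[OF f] by (auto simp: affine_fun_def)
      have "\<exists>j<d. a j \<noteq> 0"
      proof (rule ccontr)
        assume "\<not> (\<exists>j<d. a j \<noteq> 0)"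
        then have "f y = b" for y by (simp add: ab)
        then show False using nonconst[OF f] by auto
      qed
      then obtain j where j: "j < d" "a j \<noteq> 0" by blast
      define y where "y = x(j := x j - sgn (a j) * (e / 2))"
      have "y \<in> topspace (Esp d)" using x j by (auto simp: y_def topspace_E)
      moreover have "\<forall>i<d. \<bar>y i - x i\<bar> < e" using e(1) by (auto simp: y_def abs_mult sgn_if)
      ultimately have "y \<in> polyhedron_of False d F" by (rule e(2))
      then have "0 \<le> f y" using f by (auto simp: polyhedron_of_def rel_def)
      moreover have "f y = f x - \<bar>a j\<bar> * (e / 2)"
      proof -
        have "(\<Sum>i<d. a i * y i) = (\<Sum>i<d. a i * x i - (if i = j then \<bar>a j\<bar> * (e / 2) else 0))"
          by (intro sum.cong) (auto simp: y_def algebra_simps abs_sgn)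
        also have "\<dots> = (\<Sum>i<d. a i * x i) - \<bar>a j\<bar> * (e / 2)" using j by (simp add: sum_subtractf)
        finally show ?thesis by (simp add: ab)
      qed
      moreover have "\<bar>a j\<bar> * (e / 2) > 0" using j e by simp
      ultimately show False using \<open>\<not> 0 < f x\<close> by linarith
    qed
    then show "x \<in> polyhedron_of True d F" using x by (auto simp: polyhedron_of_def rel_def)
  qed
qed

section \<open>Operations on codes\<close>

abbreviation open_realizable :: "nat \<Rightarrow> 'i set \<Rightarrow> 'i set set \<Rightarrow> bool" where
  "open_realizable d S C \<equiv> \<exists>U. open_convex_realization d S C U"

abbreviation closed_realizable :: "nat \<Rightarrow> 'i set \<Rightarrow> 'i set set \<Rightarrow> bool" where
  "closed_realizable d S C \<equiv> \<exists>X. closed_convex_realization d S C X"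

abbreviation nd_closed_realizable :: "nat \<Rightarrow> 'i set \<Rightarrow> 'i set set \<Rightarrow> bool" where
  "nd_closed_realizable d S C \<equiv> \<exists>X. closed_convex_realization d S C X \<and> nondegenerate_closed d S X"

abbreviation nd_realizable :: "nat \<Rightarrow> 'i set \<Rightarrow> 'i set set \<Rightarrow> bool" where
  "nd_realizable d S C \<equiv>
     (\<exists>U. open_convex_realization d S C U \<and> nondegenerate_open d S U) \<or> nd_closed_realizable d S C"

lemma Inf_dimensions:
  fixes a :: enat
  assumes "\<And>d. Q d \<longleftrightarrow> a \<le> enat d"
  shows "Inf {enat d | d. Q d} = a"
proof (rule antisym)
  show "a \<le> Inf {enat d | d. Q d}" using assms by (intro Inf_greatest) auto
  show "Inf {enat d | d. Q d} \<le> a"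
  proof (cases a)
    case (enat n)
    then show ?thesis using assms[of n] by (intro Inf_lower) auto
  qed simp
qed

lemma code_of_word:
  assumes "p \<in> topspace (Esp d)"
  shows "{i \<in> S. p \<in> U i} \<in> code_of d S U"
  using assms by (auto simp: code_of_def)

lemma code_ofE:
  assumes "\<sigma> \<in> code_of d S U"
  obtains p where "p \<in> topspace (Esp d)" "\<sigma> = {i \<in> S. p \<in> U i}"
proof -
  obtain p where p: "p \<in> topspace (Esp d)" "\<forall>i\<in>S. p \<in> U i \<longleftrightarrow> i \<in> \<sigma>" "\<sigma> \<subseteq> S"
    using assms by (auto simp: code_of_def)
  then have "\<sigma> = {i \<in> S. p \<in> U i}" by auto
  with p(1) show thesis by (rule that)
qed

lemma code_of_eqI:
  assumes "\<And>p. p \<in> topspace (Esp d) \<Longrightarrow> {i \<in> S. p \<in> U i} \<in> C"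
    and "\<And>\<sigma>. \<sigma> \<in> C \<Longrightarrow> \<exists>p\<in>topspace (Esp d). \<sigma> = {i \<in> S. p \<in> U i}"
  shows "code_of d S U = C"
proof (intro equalityI subsetI)
  fix \<sigma> assume "\<sigma> \<in> code_of d S U"
  then show "\<sigma> \<in> C" using assms(1) by (elim code_ofE) auto
next
  fix \<sigma> assume "\<sigma> \<in> C"
  then show "\<sigma> \<in> code_of d S U" using assms(2) code_of_word by metis
qed

text \<open>Every subfamily of a realization realizes the pulled-back code, so passing to a subset of the
  base set, relabelling, and selecting a summand of a disjoint union are all instances of this one
  operation.\<close>

definition pull :: "('j \<Rightarrow> 'i) \<Rightarrow> 'j set \<Rightarrow> 'i set set \<Rightarrow> 'j set set" where
  "pull g S C = (\<lambda>\<sigma>. {j \<in> S. g j \<in> \<sigma>}) ` C"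

lemma code_of_pull:
  assumes "g ` S' \<subseteq> S"
  shows "code_of d S' (\<lambda>j. U (g j)) = pull g S' (code_of d S U)"
proof (rule code_of_eqI)
  fix p assume "p \<in> topspace (Esp d)"
  then have "{i \<in> S. p \<in> U i} \<in> code_of d S U" by (rule code_of_word)
  moreover have "{j \<in> S'. p \<in> U (g j)} = {j \<in> S'. g j \<in> {i \<in> S. p \<in> U i}}" using assms by auto
  ultimately show "{j \<in> S'. p \<in> U (g j)} \<in> pull g S' (code_of d S U)" unfolding pull_def by blast
next
  fix \<tau> assume "\<tau> \<in> pull g S' (code_of d S U)"
  then obtain \<sigma> where "\<sigma> \<in> code_of d S U" "\<tau> = {j \<in> S'. g j \<in> \<sigma>}" by (auto simp: pull_def)
  then obtain p where p: "p \<in> topspace (Esp d)" "\<tau> = {j \<in> S'. g j \<in> {i \<in> S. p \<in> U i}}" by (auto elim: code_ofE)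
  then have "\<tau> = {j \<in> S'. p \<in> U (g j)}" using assms by auto
  then show "\<exists>p\<in>topspace (Esp d). \<tau> = {j \<in> S'. p \<in> U (g j)}" using p(1) by blast
qed

lemma realization_pull:
  assumes g: "g ` S' \<subseteq> S"
  shows "open_convex_realization d S C U \<Longrightarrow> open_convex_realization d S' (pull g S' C) (\<lambda>j. U (g j))"
    and "closed_convex_realization d S C U \<Longrightarrow> closed_convex_realization d S' (pull g S' C) (\<lambda>j. U (g j))"
    and "nondegenerate_open d S U \<Longrightarrow> nondegenerate_open d S' (\<lambda>j. U (g j))"
    and "nondegenerate_closed d S U \<Longrightarrow> nondegenerate_closed d S' (\<lambda>j. U (g j))"
  using g code_of_pull[OF g, of d U] code_of_pull[OF g, of d "\<lambda>i. Esp d closure_of U i"]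
    code_of_pull[OF g, of d "\<lambda>i. Esp d interior_of U i"]
  unfolding open_convex_realization_def closed_convex_realization_def nondegenerate_open_def nondegenerate_closed_def
  by auto

lemma realizable_pull:
  assumes "g ` S' \<subseteq> S"
  shows "open_realizable d S C \<Longrightarrow> open_realizable d S' (pull g S' C)"
    and "closed_realizable d S C \<Longrightarrow> closed_realizable d S' (pull g S' C)"
    and "nd_closed_realizable d S C \<Longrightarrow> nd_closed_realizable d S' (pull g S' C)"
    and "nd_realizable d S C \<Longrightarrow> nd_realizable d S' (pull g S' C)"
  using realization_pull[OF assms] by blast+

lemma pull_pull:
  assumes "g ` S' \<subseteq> S"
  shows "pull g S' (pull f S C) = pull (f \<circ> g) S' C"
  using assms by (auto simp: pull_def image_image intro!: image_cong)

lemma relabel_nat: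
  fixes S :: "'i set"
  assumes C: "is_code S C"
  obtains S' :: "nat set" and C' where "is_code S' C'"
    "\<And>d. open_realizable d S' C' \<longleftrightarrow> open_realizable d S C"
    "\<And>d. closed_realizable d S' C' \<longleftrightarrow> closed_realizable d S C"
    "\<And>d. nd_realizable d S' C' \<longleftrightarrow> nd_realizable d S C"
proof -
  have fS: "finite S" and CS: "C \<subseteq> Pow S" and eC: "{} \<in> C" using C by (auto simp: is_code_def)
  obtain h :: "'i \<Rightarrow> nat" where h: "inj_on h S" using finite_imp_inj_to_nat_seg[OF fS] by blast
  define g where "g = inv_into S h"
  define C' where "C' = pull g (h ` S) C"
  have gh: "g (h i) = i" if "i \<in> S" for i using h that by (simp add: g_def)
  have img: "g ` (h ` S) \<subseteq> S" using gh by auto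
  have img': "h ` S \<subseteq> h ` S" by simp
  have restore: "C = pull h S C'"
  proof -
    have "pull h S C' = pull (g \<circ> h) S C" unfolding C'_def by (rule pull_pull) simp
    also have "\<dots> = (\<lambda>\<sigma>. \<sigma>) ` C" unfolding pull_def
    proof (rule image_cong)
      fix \<sigma> assume "\<sigma> \<in> C"
      then have "\<sigma> \<subseteq> S" using CS by auto
      then show "{j \<in> S. (g \<circ> h) j \<in> \<sigma>} = \<sigma>" using gh by auto
    qed simp
    finally show ?thesis by simp
  qed
  have code: "is_code (h ` S) C'"
    using fS eC by (auto simp: is_code_def C'_def pull_def intro!: image_eqI[where x = "{}"])
  note there = realizable_pull[OF img, of _ C, folded C'_def]
  note restore' = realizable_pull[OF img', of _ C', folded restore]
  show thesis by (rule that[OF code]) (use there restore' in blast)+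
qed

definition disjoint_code :: "'k set \<Rightarrow> ('k \<Rightarrow> 'i set set) \<Rightarrow> ('k \<times> 'i) set set" where
  "disjoint_code K C = insert {} (\<Union>k\<in>K. (\<lambda>\<sigma>. Pair k ` \<sigma>) ` C k)"

lemma pull_disjoint_code:
  assumes "k \<in> K" "\<And>k. k \<in> K \<Longrightarrow> is_code (S k) (C k)"
  shows "pull (Pair k) (S k) (disjoint_code K C) = C k"
proof -
  have CS: "\<sigma> \<subseteq> S k" if "\<sigma> \<in> C k" for \<sigma> using assms that by (auto simp: is_code_def)
  have e: "{} \<in> C k" using assms by (auto simp: is_code_def)
  show ?thesis
  proof (intro equalityI subsetI)
    fix \<tau> assume "\<tau> \<in> pull (Pair k) (S k) (disjoint_code K C)"
    then obtain \<sigma> where s: "\<sigma> \<in> disjoint_code K C" "\<tau> = {j \<in> S k. (k, j) \<in> \<sigma>}" by (auto simp: pull_def)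
    show "\<tau> \<in> C k"
    proof (cases "\<sigma> = {}")
      case False
      then obtain k' \<rho> where r: "k' \<in> K" "\<rho> \<in> C k'" "\<sigma> = Pair k' ` \<rho>" using s(1) by (auto simp: disjoint_code_def)
      show ?thesis
      proof (cases "k' = k")
        case True
        then have "\<tau> = \<rho>" using r s CS[of \<rho>] by auto
        then show ?thesis using r True by simp
      next
        case False
        then have "\<tau> = {}" using r s by auto
        then show ?thesis using e by simp
      qed
    qed (use s e in simp)
  next
    fix \<tau> assume t: "\<tau> \<in> C k"
    then have "Pair k ` \<tau> \<in> disjoint_code K C" using assms(1) by (auto simp: disjoint_code_def)
    moreover have "\<tau> = {j \<in> S k. (k, j) \<in> Pair k ` \<tau>}" using CS[OF t] by auto
    ultimately show "\<tau> \<in> pull (Pair k) (S k) (disjoint_code K C)" unfolding pull_def by blast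
  qed
qed

definition shift :: "real \<Rightarrow> (nat \<Rightarrow> real) \<Rightarrow> nat \<Rightarrow> real" where
  "shift c x = x(0 := x 0 - c)"

text \<open>Family \<open>k\<close> is translated by \<open>4 M k\<close> along the first axis and cut down to a slab of half-width \<open>M\<close>
  about its new position, so that distinct families stay apart even after taking closures.  Cutting
  loses no codeword once \<open>M\<close> bounds the first coordinates of points witnessing them.\<close>

definition slab_copy ::
  "bool \<Rightarrow> nat \<Rightarrow> real \<Rightarrow> (nat \<Rightarrow> 'i \<Rightarrow> (nat \<Rightarrow> real) set) \<Rightarrow> nat \<times> 'i \<Rightarrow> (nat \<Rightarrow> real) set" where
  "slab_copy b d M U = (\<lambda>(k, i). {x \<in> topspace (Esp d).
      shift (4 * M * real k) x \<in> U k i \<and> rel b \<bar>x 0 - 4 * M * real k\<bar> M})"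

lemma shift_topspace: "d \<ge> 1 \<Longrightarrow> shift c x \<in> topspace (Esp d) \<longleftrightarrow> x \<in> topspace (Esp d)"
  by (auto simp: shift_def topspace_E)

lemma continuous_shift: "continuous_on UNIV (shift c)"
proof (rule continuous_on_coordinatewise_then_product)
  fix i show "continuous_on UNIV (\<lambda>x. shift c x i)"
    by (cases "i = 0") (auto simp: shift_def intro!: continuous_intros)
qed

lemma convex_fun_slab_copy:
  assumes "convex_fun (U k i)"
  shows "convex_fun (slab_copy b d M U (k, i))"
  unfolding convex_fun_def
proof (intro ballI allI impI)
  fix x y :: "nat \<Rightarrow> real" and u v :: real
  define c where "c = 4 * M * real k"
  assume x: "x \<in> slab_copy b d M U (k, i)" and y: "y \<in> slab_copy b d M U (k, i)"
    and uv: "0 \<le> u" "0 \<le> v" "u + v = 1"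
  define w where "w = (\<lambda>i. u * x i + v * y i)"
  have c1: "c = u * c + v * c" using uv(3) by (metis distrib_right mult_1)
  have "shift c w = (\<lambda>j. u * shift c x j + v * shift c y j)"
    using c1 by (auto simp: shift_def w_def algebra_simps)
  then have 1: "shift c w \<in> U k i"
    using x y uv assms by (auto simp: slab_copy_def c_def convex_fun_def)
  have 2: "rel b \<bar>w 0 - c\<bar> M"
  proof -
    have "w 0 - c = u * (x 0 - c) + v * (y 0 - c)" using c1 by (simp add: w_def algebra_simps)
    then have "\<bar>w 0 - c\<bar> \<le> u * \<bar>x 0 - c\<bar> + v * \<bar>y 0 - c\<bar>"
      using uv abs_triangle_ineq[of "u * (x 0 - c)" "v * (y 0 - c)"] by (simp add: abs_mult)
    moreover have "rel b \<bar>x 0 - c\<bar> M" "rel b \<bar>y 0 - c\<bar> M" using x y by (auto simp: slab_copy_def c_def)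
    then have "rel b (u * \<bar>x 0 - c\<bar> + v * \<bar>y 0 - c\<bar>) M"
      using uv by (auto simp: rel_def intro: convex_bound_lt convex_bound_le split: if_splits)
    ultimately show ?thesis by (auto simp: rel_def split: if_splits)
  qed
  have "w \<in> topspace (Esp d)" using x y by (auto simp: slab_copy_def w_def topspace_E)
  then show "(\<lambda>i. u * x i + v * y i) \<in> slab_copy b d M U (k, i)"
    using 1 2 unfolding w_def[symmetric] by (simp add: slab_copy_def c_def)
qed

lemma openin_slab_copy:
  assumes "openin (Esp d) (U k i)" "d \<ge> 1"
  shows "openin (Esp d) (slab_copy True d M U (k, i))"
proof -
  obtain T where T: "open T" "U k i = T \<inter> topspace (Esp d)" using assms(1) openin_Esp_iff by blast
  define T' where "T' = shift (4 * M * real k) -` T \<inter> {x. \<bar>x 0 - 4 * M * real k\<bar> < M}"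
  have "open T'" unfolding T'_def
    by (intro open_Int open_vimage[OF T(1) continuous_shift] open_Collect_less continuous_intros) auto
  moreover have "slab_copy True d M U (k, i) = T' \<inter> topspace (Esp d)"
    using T(2) shift_topspace[OF assms(2)] by (auto simp: slab_copy_def T'_def rel_def)
  ultimately show ?thesis using openin_Esp_iff by blast
qed

lemma closedin_slab_copy:
  assumes "closedin (Esp d) (U k i)" "d \<ge> 1"
  shows "closedin (Esp d) (slab_copy False d M U (k, i))"
proof -
  have T: "closed (U k i)" using assms(1) closedin_Euclidean_imp_closed by blast
  have "closed (topspace (Esp d))" using closedin_Euclidean_imp_closed closedin_topspace by blast
  then have "closed (shift (4 * M * real k) -` U k i \<inter> {x. \<bar>x 0 - 4 * M * real k\<bar> \<le> M} \<inter> topspace (Esp d))"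
    by (intro closed_Int closed_vimage[OF T continuous_shift] closed_Collect_le continuous_intros) auto
  also have "shift (4 * M * real k) -` U k i \<inter> {x. \<bar>x 0 - 4 * M * real k\<bar> \<le> M} \<inter> topspace (Esp d)
      = slab_copy False d M U (k, i)"
    by (auto simp: slab_copy_def rel_def)
  finally show ?thesis unfolding closedin_Euclidean_space_iff by (auto simp: slab_copy_def)
qed

lemma interior_of_slab_copy:
  assumes "d \<ge> 1"
  shows "Esp d interior_of slab_copy False d M U (k, i)
       = slab_copy True d M (\<lambda>k i. Esp d interior_of U k i) (k, i)" (is "?L = ?R")
proof
  define c where "c = 4 * M * real k"
  have "openin (Esp d) ?R" using assms by (intro openin_slab_copy) auto
  moreover have "?R \<subseteq> slab_copy False d M U (k, i)"
    using interior_of_subset[of "Esp d" "U k i"] by (auto simp: slab_copy_def rel_def)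
  ultimately show "?R \<subseteq> ?L" by (intro interior_of_maximal)
  show "?L \<subseteq> ?R"
  proof
    fix x assume "x \<in> ?L"
    then obtain e where x: "x \<in> topspace (Esp d)" and e: "e > 0"
      "\<And>y. y \<in> topspace (Esp d) \<Longrightarrow> (\<forall>j<d. \<bar>y j - x j\<bar> < e) \<Longrightarrow> y \<in> slab_copy False d M U (k, i)"
      unfolding interior_of_Esp_box by blast
    have "y \<in> U k i" if y: "y \<in> topspace (Esp d)" "\<forall>j<d. \<bar>y j - shift c x j\<bar> < e" for y
    proof -
      have "shift (- c) y \<in> slab_copy False d M U (k, i)"
      proof (rule e(2))
        show "shift (- c) y \<in> topspace (Esp d)" using y assms shift_topspace by blast
        have "\<bar>shift (- c) y j - x j\<bar> = \<bar>y j - shift c x j\<bar>" for j by (simp add: shift_def algebra_simps)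
        then show "\<forall>j<d. \<bar>shift (- c) y j - x j\<bar> < e" using y(2) by simp
      qed
      moreover have "shift c (shift (- c) y) = y" by (auto simp: shift_def)
      ultimately show ?thesis by (simp add: slab_copy_def c_def)
    qed
    then have 1: "shift c x \<in> Esp d interior_of U k i"
      unfolding interior_of_Esp_box using e(1) x shift_topspace[OF assms] by blast
    have 2: "\<bar>x 0 - c\<bar> < M"
    proof -
      define s where "s = (if x 0 - c \<ge> 0 then 1 else -1 :: real)"
      have "x(0 := x 0 + s * (e / 2)) \<in> slab_copy False d M U (k, i)"
      proof (rule e(2))
        show "x(0 := x 0 + s * (e / 2)) \<in> topspace (Esp d)" using x assms by (auto simp: topspace_E)
        show "\<forall>j<d. \<bar>(x(0 := x 0 + s * (e / 2))) j - x j\<bar> < e" using e(1) by (auto simp: s_def)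
      qed
      then have "\<bar>x 0 + s * (e / 2) - c\<bar> \<le> M" by (simp add: slab_copy_def rel_def c_def)
      then show ?thesis using e(1) by (auto simp: s_def split: if_splits)
    qed
    show "x \<in> ?R" using 1 2 x by (simp add: slab_copy_def rel_def c_def)
  qed
qed

definition witnessed_below ::
  "nat \<Rightarrow> 'k set \<Rightarrow> ('k \<Rightarrow> 'i set) \<Rightarrow> ('k \<Rightarrow> 'i \<Rightarrow> (nat \<Rightarrow> real) set) \<Rightarrow> ('k \<Rightarrow> 'i set set) \<Rightarrow> real \<Rightarrow> bool" where
  "witnessed_below d K S U C M \<longleftrightarrow>
     (\<forall>k\<in>K. \<forall>\<sigma>\<in>C k. \<exists>p\<in>topspace (Esp d). \<bar>p 0\<bar> < M \<and> \<sigma> = {i \<in> S k. p \<in> U k i})"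

lemma code_of_slab_copy:
  assumes d: "d \<ge> 1" and M: "M > 0"
    and code: "\<And>k. k \<in> K \<Longrightarrow> code_of d (S k) (U k) = C k"
    and wit: "witnessed_below d K S U C M"
  shows "code_of d (Sigma K S) (slab_copy b d M U) = disjoint_code K C"
proof -
  define c where "c k = 4 * M * real k" for k
  have apart: "k = k'" if "rel b \<bar>z - c k\<bar> M" "rel b \<bar>z - c k'\<bar> M" for k k' :: nat and z
  proof (rule ccontr)
    assume "k \<noteq> k'"
    then have "1 \<le> \<bar>real k - real k'\<bar>" by linarith
    then have "4 * M \<le> 4 * M * \<bar>real k - real k'\<bar>" using M by simp
    also have "\<dots> = \<bar>c k - c k'\<bar>" using M by (simp add: c_def abs_mult flip: right_diff_distrib)
    also have "\<dots> \<le> 2 * M" using that by (auto simp: rel_def split: if_splits)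
    finally show False using M by simp
  qed
  show ?thesis
  proof (rule code_of_eqI)
    fix p assume p: "p \<in> topspace (Esp d)"
    let ?w = "{z \<in> Sigma K S. p \<in> slab_copy b d M U z}"
    show "?w \<in> disjoint_code K C"
    proof (cases "\<exists>k\<in>K. rel b \<bar>p 0 - c k\<bar> M")
      case False
      then have "?w = {}" by (auto simp: slab_copy_def c_def)
      then show ?thesis by (simp add: disjoint_code_def)
    next
      case True
      then obtain k where k: "k \<in> K" "rel b \<bar>p 0 - c k\<bar> M" by blast
      have "?w = Pair k ` {i \<in> S k. shift (c k) p \<in> U k i}"
      proof (intro equalityI subsetI)
        fix z assume "z \<in> ?w"
        then obtain k' i where z: "z = (k', i)" "k' \<in> K" "i \<in> S k'" "shift (c k') p \<in> U k' i" "rel b \<bar>p 0 - c k'\<bar> M"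
          by (auto simp: slab_copy_def c_def)
        have "k' = k" by (rule apart[OF z(5) k(2)])
        then show "z \<in> Pair k ` {i \<in> S k. shift (c k) p \<in> U k i}" using z by auto
      next
        fix z assume "z \<in> Pair k ` {i \<in> S k. shift (c k) p \<in> U k i}"
        then show "z \<in> ?w" using k p by (auto simp: slab_copy_def c_def)
      qed
      moreover have "{i \<in> S k. shift (c k) p \<in> U k i} \<in> C k"
        using code_of_word[of "shift (c k) p" d "S k" "U k"] p shift_topspace[OF d] code[OF k(1)] by simp
      ultimately show ?thesis using k(1) by (auto simp: disjoint_code_def)
    qed
  next
    fix \<sigma> assume "\<sigma> \<in> disjoint_code K C"
    then consider "\<sigma> = {}" | k \<rho> where "k \<in> K" "\<rho> \<in> C k" "\<sigma> = Pair k ` \<rho>" by (auto simp: disjoint_code_def)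
    then show "\<exists>p\<in>topspace (Esp d). \<sigma> = {z \<in> Sigma K S. p \<in> slab_copy b d M U z}"
    proof cases
      case 1
      define p where "p = (\<lambda>i::nat. if i = 0 then - 2 * M else 0 :: real)"
      have "p \<in> topspace (Esp d)" using d by (auto simp: p_def topspace_E)
      moreover have "\<not> rel b \<bar>p 0 - c k\<bar> M" for k
      proof -
        have "c k \<ge> 0" using M by (simp add: c_def)
        then show ?thesis using M by (auto simp: rel_def p_def)
      qed
      then have "{} = {z \<in> Sigma K S. p \<in> slab_copy b d M U z}" by (auto simp: slab_copy_def c_def)
      ultimately show ?thesis using 1 by blast
    next
      case 2
      obtain q where q: "q \<in> topspace (Esp d)" "\<bar>q 0\<bar> < M" "\<rho> = {i \<in> S k. q \<in> U k i}"
        using wit 2(1,2) unfolding witnessed_below_def by blast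
      define p where "p = shift (- c k) q"
      have p: "p \<in> topspace (Esp d)" using q d shift_topspace by (simp add: p_def)
      have sp: "shift (c k) p = q" by (auto simp: p_def shift_def)
      have rb: "rel b \<bar>p 0 - c k\<bar> M" using q(2) by (simp add: p_def shift_def rel_def)
      have "\<sigma> = {z \<in> Sigma K S. p \<in> slab_copy b d M U z}"
      proof (intro equalityI subsetI)
        fix z assume "z \<in> \<sigma>"
        then show "z \<in> {z \<in> Sigma K S. p \<in> slab_copy b d M U z}"
          using 2 q(3) p sp rb by (auto simp: slab_copy_def c_def)
      next
        fix z assume "z \<in> {z \<in> Sigma K S. p \<in> slab_copy b d M U z}"
        then obtain k' i where z: "z = (k', i)" "k' \<in> K" "i \<in> S k'" "shift (c k') p \<in> U k' i" "rel b \<bar>p 0 - c k'\<bar> M"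
          by (auto simp: slab_copy_def c_def)
        have "k' = k" by (rule apart[OF z(5) rb])
        then show "z \<in> \<sigma>" using z 2 q(3) sp by auto
      qed
      then show ?thesis using p by blast
    qed
  qed
qed

lemma bounded_witnesses:
  assumes K: "finite K" and C: "\<And>k. k \<in> K \<Longrightarrow> finite (C k)"
    and code: "\<And>k. k \<in> K \<Longrightarrow> code_of d (S k) (U k) = C k"
  shows "\<exists>M>0. \<forall>M'\<ge>M. witnessed_below d K S U C M'"
proof -
  have "\<exists>p. \<forall>z\<in>Sigma K C. p z \<in> topspace (Esp d) \<and> snd z = {i \<in> S (fst z). p z \<in> U (fst z) i}"
  proof (rule bchoice, rule ballI)
    fix z assume "z \<in> Sigma K C"
    then have "snd z \<in> code_of d (S (fst z)) (U (fst z))" using code by auto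
    then show "\<exists>p. p \<in> topspace (Esp d) \<and> snd z = {i \<in> S (fst z). p \<in> U (fst z) i}"
      by (elim code_ofE) blast
  qed
  then obtain p where p: "\<And>k \<sigma>. k \<in> K \<Longrightarrow> \<sigma> \<in> C k \<Longrightarrow>
      p (k, \<sigma>) \<in> topspace (Esp d) \<and> \<sigma> = {i \<in> S k. p (k, \<sigma>) \<in> U k i}" by fastforce
  define M where "M = Max (insert 0 ((\<lambda>z. \<bar>p z 0\<bar>) ` Sigma K C)) + 1"
  have fin: "finite (insert 0 ((\<lambda>z. \<bar>p z 0\<bar>) ` Sigma K C))" using K C by auto
  have "0 \<le> M - 1" unfolding M_def using fin by simp
  moreover have "\<bar>p (k, \<sigma>) 0\<bar> \<le> M - 1" if "k \<in> K" "\<sigma> \<in> C k" for k \<sigma>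
    unfolding M_def using fin that by (simp add: Max_ge_iff)
  ultimately have M: "M > 0" "\<And>k \<sigma>. k \<in> K \<Longrightarrow> \<sigma> \<in> C k \<Longrightarrow> \<bar>p (k, \<sigma>) 0\<bar> < M" by force+
  have "\<exists>p\<in>topspace (Esp d). \<bar>p 0\<bar> < M' \<and> \<sigma> = {i \<in> S k. p \<in> U k i}"
    if "M' \<ge> M" "k \<in> K" "\<sigma> \<in> C k" for M' k \<sigma>
    using p[OF that(2,3)] M(2)[OF that(2,3)] that(1) by (intro bexI[of _ "p (k, \<sigma>)"]) auto
  then show ?thesis using M(1) unfolding witnessed_below_def by blast
qed

lemma finite_code: "is_code S C \<Longrightarrow> finite C"
  using finite_subset by (auto simp: is_code_def)

lemma realizable_disjoint_code:
  fixes K :: "nat set"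
  assumes d: "d \<ge> 1" and K: "finite K" and C: "\<And>k. k \<in> K \<Longrightarrow> is_code (S k) (C k)"
  shows "(\<And>k. k \<in> K \<Longrightarrow> open_realizable d (S k) (C k)) \<Longrightarrow> open_realizable d (Sigma K S) (disjoint_code K C)"
    and "(\<And>k. k \<in> K \<Longrightarrow> closed_realizable d (S k) (C k)) \<Longrightarrow> closed_realizable d (Sigma K S) (disjoint_code K C)"
    and "(\<And>k. k \<in> K \<Longrightarrow> nd_closed_realizable d (S k) (C k)) \<Longrightarrow> nd_closed_realizable d (Sigma K S) (disjoint_code K C)"
proof -
  have fC: "\<And>k. k \<in> K \<Longrightarrow> finite (C k)" using C finite_code by blast
  show "open_realizable d (Sigma K S) (disjoint_code K C)" if each: "\<And>k. k \<in> K \<Longrightarrow> open_realizable d (S k) (C k)"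
  proof -
    obtain U where U: "\<And>k. k \<in> K \<Longrightarrow> open_convex_realization d (S k) (C k) (U k)"
      using each bchoice[of K "\<lambda>k U. open_convex_realization d (S k) (C k) U"] by auto
    then have co: "\<And>k. k \<in> K \<Longrightarrow> code_of d (S k) (U k) = C k" by (auto simp: open_convex_realization_def)
    obtain M where M: "M > 0" "\<And>M'. M' \<ge> M \<Longrightarrow> witnessed_below d K S U C M'"
      using bounded_witnesses[of K C d S U] K fC co by blast
    have "open_convex_realization d (Sigma K S) (disjoint_code K C) (slab_copy True d M U)"
      unfolding open_convex_realization_def
    proof (intro conjI ballI)
      show "code_of d (Sigma K S) (slab_copy True d M U) = disjoint_code K C"
        by (rule code_of_slab_copy[OF d M(1) co M(2)[OF order_refl]])
      fix z assume "z \<in> Sigma K S"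
      then obtain k i where z: "z = (k, i)" "k \<in> K" "i \<in> S k" by auto
      then show "openin (Esp d) (slab_copy True d M U z)" "convex_fun (slab_copy True d M U z)"
        using U[OF z(2)] openin_slab_copy[OF _ d, of U k i] convex_fun_slab_copy[of U k i]
        by (auto simp: open_convex_realization_def)
    qed
    then show ?thesis by blast
  qed
  show "closed_realizable d (Sigma K S) (disjoint_code K C)" if each: "\<And>k. k \<in> K \<Longrightarrow> closed_realizable d (S k) (C k)"
  proof -
    obtain U where U: "\<And>k. k \<in> K \<Longrightarrow> closed_convex_realization d (S k) (C k) (U k)"
      using each bchoice[of K "\<lambda>k U. closed_convex_realization d (S k) (C k) U"] by auto
    then have co: "\<And>k. k \<in> K \<Longrightarrow> code_of d (S k) (U k) = C k" by (auto simp: closed_convex_realization_def)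
    obtain M where M: "M > 0" "\<And>M'. M' \<ge> M \<Longrightarrow> witnessed_below d K S U C M'"
      using bounded_witnesses[of K C d S U] K fC co by blast
    have "closed_convex_realization d (Sigma K S) (disjoint_code K C) (slab_copy False d M U)"
      unfolding closed_convex_realization_def
    proof (intro conjI ballI)
      show "code_of d (Sigma K S) (slab_copy False d M U) = disjoint_code K C"
        by (rule code_of_slab_copy[OF d M(1) co M(2)[OF order_refl]])
      fix z assume "z \<in> Sigma K S"
      then obtain k i where z: "z = (k, i)" "k \<in> K" "i \<in> S k" by auto
      then show "closedin (Esp d) (slab_copy False d M U z)" "convex_fun (slab_copy False d M U z)"
        using U[OF z(2)] closedin_slab_copy[OF _ d, of U k i] convex_fun_slab_copy[of U k i]
        by (auto simp: closed_convex_realization_def)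
    qed
    then show ?thesis by blast
  qed
  show "nd_closed_realizable d (Sigma K S) (disjoint_code K C)" if each: "\<And>k. k \<in> K \<Longrightarrow> nd_closed_realizable d (S k) (C k)"
  proof -
    obtain U where U: "\<And>k. k \<in> K \<Longrightarrow> closed_convex_realization d (S k) (C k) (U k)"
      "\<And>k. k \<in> K \<Longrightarrow> nondegenerate_closed d (S k) (U k)"
      using each bchoice[of K "\<lambda>k U. closed_convex_realization d (S k) (C k) U \<and> nondegenerate_closed d (S k) U"] by auto
    then have co: "\<And>k. k \<in> K \<Longrightarrow> code_of d (S k) (U k) = C k" by (auto simp: closed_convex_realization_def)
    define V where "V k i = Esp d interior_of U k i" for k i
    have coV: "code_of d (S k) (V k) = C k" if "k \<in> K" for k
      using U(2)[OF that] co[OF that] by (simp add: nondegenerate_closed_def V_def[abs_def])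
    obtain M1 where M1: "M1 > 0" "\<And>M'. M' \<ge> M1 \<Longrightarrow> witnessed_below d K S U C M'"
      using bounded_witnesses[of K C d S U] K fC co by blast
    obtain M2 where M2: "M2 > 0" "\<And>M'. M' \<ge> M2 \<Longrightarrow> witnessed_below d K S V C M'"
      using bounded_witnesses[of K C d S V] K fC coV by blast
    define M where "M = max M1 M2"
    have M: "M > 0" "M \<ge> M1" "M \<ge> M2" using M1(1) by (auto simp: M_def)
    have c1: "code_of d (Sigma K S) (slab_copy False d M U) = disjoint_code K C"
      by (rule code_of_slab_copy[OF d M(1) co M1(2)[OF M(2)]])
    have c2: "code_of d (Sigma K S) (slab_copy True d M V) = disjoint_code K C"
      by (rule code_of_slab_copy[OF d M(1) coV M2(2)[OF M(3)]])
    have "closed_convex_realization d (Sigma K S) (disjoint_code K C) (slab_copy False d M U)"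
      unfolding closed_convex_realization_def
    proof (intro conjI ballI)
      show "code_of d (Sigma K S) (slab_copy False d M U) = disjoint_code K C"
        by (rule c1)
      fix z assume "z \<in> Sigma K S"
      then obtain k i where z: "z = (k, i)" "k \<in> K" "i \<in> S k" by auto
      then show "closedin (Esp d) (slab_copy False d M U z)" "convex_fun (slab_copy False d M U z)"
        using U(1)[OF z(2)] closedin_slab_copy[OF _ d, of U k i] convex_fun_slab_copy[of U k i]
        by (auto simp: closed_convex_realization_def)
    qed
    moreover have "(\<lambda>z. Esp d interior_of slab_copy False d M U z) = slab_copy True d M V"
      using interior_of_slab_copy[OF d, of M U] by (auto simp: V_def[abs_def])
    then have "nondegenerate_closed d (Sigma K S) (slab_copy False d M U)"
      unfolding nondegenerate_closed_def using c1 c2 by simp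
    ultimately show ?thesis by blast
  qed
qed

lemma is_code_disjoint:
  assumes "finite K" "\<And>k. k \<in> K \<Longrightarrow> is_code (S k) (C k)"
  shows "is_code (Sigma K S) (disjoint_code K C)"
proof -
  have "finite (Sigma K S)" using assms by (intro finite_SigmaI) (auto simp: is_code_def)
  moreover have "disjoint_code K C \<subseteq> Pow (Sigma K S)" using assms(2) by (fastforce simp: disjoint_code_def is_code_def)
  ultimately show ?thesis by (simp add: is_code_def disjoint_code_def)
qed

section \<open>The codes\<close>

text \<open>The petals form a sunflower and the pieces a chain in which consecutive pieces overlap.
  \<open>Lpart i\<close> contains what piece \<open>i\<close> has outside piece \<open>i + 1\<close>, and \<open>Rpart (i + 1)\<close> contains what piece
  \<open>i + 1\<close> has outside piece \<open>i\<close>; both reach into the overlap, but they are disjoint, and for closed sets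
  this forces the union of the chain to be convex.  \<open>Link\<close> is that union, and its presence imposes
  convexity on open sets as well.  \<open>Ambient\<close> contains everything; \<open>Low\<close> and \<open>High\<close> are disjoint and
  cover all of it but a part of the centre.\<close>

datatype neuron = Ambient | Low | High | Link | Petal nat | Piece nat | Lpart nat | Rpart nat

definition wall :: "nat \<Rightarrow> neuron set" where
  "wall m = Petal ` {..<m}"

definition piece_word :: "nat \<Rightarrow> neuron set" where
  "piece_word i = {Piece i, Lpart i, Rpart i}"

definition corner_word :: "nat \<Rightarrow> neuron set" where
  "corner_word i = {Piece i, Rpart i, Piece (Suc i), Lpart (Suc i)}"

definition corner_words :: "nat \<Rightarrow> neuron set set" where
  "corner_words i = {corner_word i, insert (Lpart i) (corner_word i), insert (Rpart (Suc i)) (corner_word i)}"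

definition chain_words :: "nat \<Rightarrow> neuron set set" where
  "chain_words n = piece_word ` {..<n} \<union> (\<Union>i\<in>{i. Suc i < n}. corner_words i)"

text \<open>The argument \<^term>\<open>I\<close> lists the codewords on the chain, and thereby which petals meet it
  where.\<close>

definition flower_code :: "nat \<Rightarrow> neuron set set \<Rightarrow> neuron set set" where
  "flower_code m I =
     {{}, {Ambient} \<union> wall m, {Ambient, Low} \<union> wall m, {Ambient, High} \<union> wall m, {Ambient, Low}}
     \<union> (\<lambda>i. {Ambient, Low, Petal i}) ` {..<m} \<union> (\<lambda>w. {Ambient, Low, Link} \<union> w) ` I"

definition base :: "nat \<Rightarrow> nat \<Rightarrow> neuron set" where
  "base m n = Petal ` {..<m} \<union> Piece ` {..<n} \<union> Lpart ` {..<n} \<union> Rpart ` {..<n}"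

definition link_base :: "nat \<Rightarrow> nat \<Rightarrow> neuron set" where
  "link_base m n = insert Link (base m n)"

definition split_base :: "nat \<Rightarrow> nat \<Rightarrow> neuron set" where
  "split_base m n = {Ambient, Low, High} \<union> base m n"

definition full_base :: "nat \<Rightarrow> nat \<Rightarrow> neuron set" where
  "full_base m n = insert Link (split_base m n)"

text \<open>Petal \<open>i\<close> meets the chain only where it consists of piece \<open>i\<close> alone.\<close>

definition private_pieces :: "nat \<Rightarrow> neuron set set" where
  "private_pieces n = chain_words n \<union> (\<lambda>i. insert (Petal i) (piece_word i)) ` {..<n}"

text \<open>With three petals and two pieces whose overlap lies in the middle petal, a segment in the chain
  joining the outer petals also meets the middle one.\<close>

definition shared_corner :: "neuron set set" where
  "shared_corner = {piece_word 0, piece_word 1,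
     insert (Petal 0) (piece_word 0), insert (Petal 2) (piece_word 1),
     insert (Petal 1) (piece_word 0), insert (Petal 1) (piece_word 1)} \<union> insert (Petal 1) ` corner_words 0"

lemma wall_Pow: "wall m \<subseteq> base m n"
  by (auto simp: wall_def base_def)

lemma chain_words_subset: "w \<in> chain_words n \<Longrightarrow> w \<subseteq> Piece ` {..<n} \<union> Lpart ` {..<n} \<union> Rpart ` {..<n}"
  by (auto simp: chain_words_def corner_words_def piece_word_def corner_word_def)

lemma private_pieces_subset: "w \<in> private_pieces n \<Longrightarrow> w \<subseteq> base n n"
proof -
  assume "w \<in> private_pieces n"
  then consider "w \<in> chain_words n" | i where "i < n" "w = insert (Petal i) (piece_word i)"
    by (auto simp: private_pieces_def)
  then show ?thesis
  proof cases
    case 1 then show ?thesis using chain_words_subset[OF 1] unfolding base_def by blast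
  next
    case 2 then show ?thesis by (simp add: base_def piece_word_def)
  qed
qed

lemma shared_corner_subset: "w \<in> shared_corner \<Longrightarrow> w \<subseteq> base 3 2"
  by (auto simp: shared_corner_def base_def piece_word_def corner_word_def corner_words_def)

lemma is_code_flower:
  assumes "\<And>w. w \<in> I \<Longrightarrow> w \<subseteq> base m n"
  shows "is_code (full_base m n) (flower_code m I)"
  unfolding is_code_def
proof (intro conjI)
  show "finite (full_base m n)" by (simp add: full_base_def split_base_def base_def)
  show "{} \<in> flower_code m I" by (simp add: flower_code_def)
  show "flower_code m I \<subseteq> Pow (full_base m n)"
  proof
    fix \<sigma> assume "\<sigma> \<in> flower_code m I"
    then consider "\<sigma> \<subseteq> {Ambient, Low, High} \<union> wall m" | i where "i < m" "\<sigma> = {Ambient, Low, Petal i}"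
      | w where "w \<in> I" "\<sigma> = {Ambient, Low, Link} \<union> w"
      unfolding flower_code_def by blast
    then show "\<sigma> \<in> Pow (full_base m n)"
    proof cases
      case 1 then show ?thesis using wall_Pow[of m n] by (auto simp: full_base_def split_base_def)
    next
      case 2 then show ?thesis by (auto simp: full_base_def split_base_def base_def)
    next
      case 3 then show ?thesis using assms[of w] by (auto simp: full_base_def split_base_def)
    qed
  qed
qed

lemma is_code_pull: "is_code S C \<Longrightarrow> finite S' \<Longrightarrow> is_code S' (pull g S' C)"
  by (auto simp: is_code_def pull_def intro!: image_eqI[where x = "{}"])

subsection \<open>Slicing a chain by a linear coordinate\<close>

text \<open>Piece \<open>i\<close> is given by \<open>\<bar>t - i\<bar> \<le> 3/4\<close>, so it overlaps the next piece for \<open>t\<close> between \<open>i + 1/4\<close> and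
  \<open>i + 3/4\<close>.  There \<open>Lpart i\<close> ends at \<open>i + 5/12\<close> and \<open>Rpart (i + 1)\<close> starts at \<open>i + 7/12\<close>, so that each of
  the three corner words occurs.  The outermost pieces are unbounded, so that the chain covers the
  whole line.\<close>

definition in_slab :: "bool \<Rightarrow> nat \<Rightarrow> real \<Rightarrow> real \<Rightarrow> nat \<Rightarrow> real \<Rightarrow> bool" where
  "in_slab b n l u i t \<longleftrightarrow> (i = 0 \<or> rel b (real i - l) t) \<and> (Suc i = n \<or> rel b t (real i + u))"

definition chain_word :: "bool \<Rightarrow> nat \<Rightarrow> real \<Rightarrow> neuron set" where
  "chain_word b n t =
     Piece ` {i. i < n \<and> in_slab b n (3/4) (3/4) i t} \<union> Lpart ` {i. i < n \<and> in_slab b n (3/4) (5/12) i t}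
     \<union> Rpart ` {i. i < n \<and> in_slab b n (5/12) (3/4) i t}"

lemma chain_word_single:
  assumes i: "i < n" "i = 0 \<or> real i - 1/4 < t" "Suc i = n \<or> t < real i + 1/4"
  shows "chain_word b n t = piece_word i"
proof -
  have "in_slab b n l u j t \<longleftrightarrow> j = i" if "j < n" and lu: "5/12 \<le> l" "l \<le> 3/4" "5/12 \<le> u" "u \<le> 3/4" for j l u
  proof
    assume j: "in_slab b n l u j t"
    show "j = i"
    proof (rule ccontr)
      assume "j \<noteq> i"
      then consider "Suc j \<le> i" | "Suc i \<le> j" by linarith
      then show False
      proof cases
        case 1
        then have "real j + 1 \<le> real i" by linarith
        moreover have "t \<le> real j + u" using j 1 i by (auto simp: in_slab_def rel_def split: if_splits)
        ultimately show False using i 1 lu by auto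
      next
        case 2
        then have "real i + 1 \<le> real j" by linarith
        moreover have "real j - l \<le> t" using j 2 by (auto simp: in_slab_def rel_def split: if_splits)
        ultimately show False using i 2 lu \<open>j < n\<close> by auto
      qed
    qed
  next
    assume "j = i"
    then show "in_slab b n l u j t" using i lu by (auto simp: in_slab_def rel_def)
  qed
  then have "{j. j < n \<and> in_slab b n l u j t} = {i}" if "5/12 \<le> l" "l \<le> 3/4" "5/12 \<le> u" "u \<le> 3/4" for l u
    using that i by auto
  then show ?thesis by (auto simp: chain_word_def piece_word_def)
qed

lemma chain_word_corner:
  assumes i: "Suc i < n" and t: "t = real i + r" "0 < r" "r < 1"
  shows "chain_word b n t =
     (if rel b r (3/4) then {Piece i, Rpart i} else {}) \<union> (if rel b r (5/12) then {Lpart i} else {})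
     \<union> (if rel b (1/4) r then {Piece (Suc i), Lpart (Suc i)} else {}) \<union> (if rel b (7/12) r then {Rpart (Suc i)} else {})"
proof -
  have slab: "{j. j < n \<and> in_slab b n l u j t}
      = (if rel b r u then {i} else {}) \<union> (if rel b (1 - l) r then {Suc i} else {})"
    if lu: "5/12 \<le> l" "l \<le> 3/4" "5/12 \<le> u" "u \<le> 3/4" for l u
  proof -
    have 1: "\<not> in_slab b n l u j t" if "j < i" for j
    proof -
      have "real j + 1 \<le> real i" using that by linarith
      then show ?thesis using that i t lu by (auto simp: in_slab_def rel_def)
    qed
    have 2: "\<not> in_slab b n l u j t" if "Suc i < j" for j
    proof -
      have "real i + 2 \<le> real j" using that by linarith
      then show ?thesis using that i t lu by (auto simp: in_slab_def rel_def)
    qed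
    have 3: "in_slab b n l u i t \<longleftrightarrow> rel b r u" using i t lu by (auto simp: in_slab_def rel_def)
    have 4: "in_slab b n l u (Suc i) t \<longleftrightarrow> rel b (1 - l) r" using i t lu by (auto simp: in_slab_def rel_def)
    have "j < i \<or> j = i \<or> j = Suc i \<or> Suc i < j" for j by linarith
    then show ?thesis using 1 2 3 4 i by (auto; metis)
  qed
  have "1 - 3/4 = (1/4 :: real)" "1 - 5/12 = (7/12 :: real)" by simp_all
  then show ?thesis
    using slab[of "3/4" "3/4"] slab[of "3/4" "5/12"] slab[of "5/12" "3/4"] by (auto simp: chain_word_def)
qed

lemma chain_word_in_chain_words:
  assumes "n \<ge> 1"
  shows "chain_word b n t \<in> chain_words n"
proof -
  have single: "chain_word b n t \<in> chain_words n"
    if "i < n" "i = 0 \<or> real i - 1/4 < t" "Suc i = n \<or> t < real i + 1/4" for i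
    using chain_word_single[OF that] that(1) by (auto simp: chain_words_def)
  consider "t \<le> 0" | "t \<ge> real (n - 1)" | "0 < t" "t < real (n - 1)" by linarith
  then show ?thesis
  proof cases
    case 1 then show ?thesis using single[of 0] assms by auto
  next
    case 2 then show ?thesis using single[of "n - 1"] assms by auto
  next
    case 3
    define i where "i = nat \<lfloor>t\<rfloor>"
    define r where "r = t - real i"
    have r: "0 \<le> r" "r < 1" "t = real i + r" using 3 by (auto simp: r_def i_def) linarith
    have "real i < real (n - 1)" using 3 r by linarith
    then have i: "Suc i < n" by auto
    show ?thesis
    proof (cases "r < 1/4")
      case True
      then show ?thesis using single[of i] i r by auto
    next
      case False
      then have r0: "0 < r" by linarith
      note w = chain_word_corner[OF i r(3) r0 r(2), of b]
      consider "\<not> rel b (1/4) r" | "\<not> rel b r (3/4)"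
        | "rel b (1/4) r" "rel b r (3/4)" "rel b r (5/12)" | "rel b (1/4) r" "rel b r (3/4)" "rel b (7/12) r"
        | "rel b (1/4) r" "rel b r (3/4)" "\<not> rel b r (5/12)" "\<not> rel b (7/12) r" by blast
      then show ?thesis
      proof cases
        case 1
        then have "chain_word b n t = piece_word i" unfolding w using r by (auto simp: rel_def piece_word_def split: if_splits)
        then show ?thesis using i by (auto simp: chain_words_def)
      next
        case 2
        then have "chain_word b n t = piece_word (Suc i)" unfolding w using r by (auto simp: rel_def piece_word_def split: if_splits)
        then show ?thesis using i by (auto simp: chain_words_def)
      next
        case 3
        then have "\<not> rel b (7/12) r" by (auto simp: rel_def split: if_splits)
        then have "chain_word b n t = insert (Lpart i) (corner_word i)" unfolding w using 3 by (auto simp: corner_word_def)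
        then show ?thesis using i by (auto simp: chain_words_def corner_words_def)
      next
        case 4
        then have "\<not> rel b r (5/12)" by (auto simp: rel_def split: if_splits)
        then have "chain_word b n t = insert (Rpart (Suc i)) (corner_word i)" unfolding w using 4 by (auto simp: corner_word_def)
        then show ?thesis using i by (auto simp: chain_words_def corner_words_def)
      next
        case 5
        then have "chain_word b n t = corner_word i" unfolding w by (auto simp: corner_word_def)
        then show ?thesis using i by (auto simp: chain_words_def corner_words_def)
      qed
    qed
  qed
qed

lemma corner_words_attained:
  assumes "w \<in> corner_words i" "Suc i < n"
  obtains r where "1/4 < r" "r < 3/4" "\<And>b. chain_word b n (real i + r) = w"
proof -
  consider "w = corner_word i" | "w = insert (Lpart i) (corner_word i)" | "w = insert (Rpart (Suc i)) (corner_word i)"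
    using assms(1) by (auto simp: corner_words_def)
  then show thesis
  proof cases
    case 1
    show ?thesis by (rule that[of "1/2"]) (use chain_word_corner[OF assms(2) refl, of "1/2"] 1 in \<open>auto simp: rel_def corner_word_def\<close>)
  next
    case 2
    show ?thesis by (rule that[of "1/3"]) (use chain_word_corner[OF assms(2) refl, of "1/3"] 2 in \<open>auto simp: rel_def corner_word_def\<close>)
  next
    case 3
    show ?thesis by (rule that[of "2/3"]) (use chain_word_corner[OF assms(2) refl, of "2/3"] 3 in \<open>auto simp: rel_def corner_word_def\<close>)
  qed
qed

subsection \<open>Reading off codewords\<close>

lemma affine_fun_divide [intro]: "affine_fun d f \<Longrightarrow> affine_fun d (\<lambda>x. f x / c)"
  using affine_fun_cmul[of d f "1 / c"] by simp

lemma affine_fun_minus [intro]: "affine_fun d f \<Longrightarrow> affine_fun d (\<lambda>x. - f x)"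
  using affine_fun_cmul[of d f "-1"] by simp

lemma rel_diff [simp]: "rel b 0 (u - v) \<longleftrightarrow> rel b v u"
  by (auto simp: rel_def)

lemma rel_weak: "rel b u v \<Longrightarrow> u \<le> v"
  by (auto simp: rel_def split: if_splits)

lemma rel_strict: "u < v \<Longrightarrow> rel b u v"
  by (auto simp: rel_def)

lemma not_rel: "\<not> rel b u v \<Longrightarrow> v \<le> u"
  by (auto simp: rel_def split: if_splits)

lemma rel_trans: "u \<le> v \<Longrightarrow> rel b v w \<Longrightarrow> rel b u w"
  by (auto simp: rel_def split: if_splits)

lemma word_full_base:
  "{\<nu> \<in> full_base m n. mem \<nu>} =
     (if mem Ambient then {Ambient} else {}) \<union> (if mem Low then {Low} else {}) \<union> (if mem High then {High} else {})
     \<union> (if mem Link then {Link} else {}) \<union> Petal ` {i. i < m \<and> mem (Petal i)} \<union> Piece ` {i. i < n \<and> mem (Piece i)}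
     \<union> Lpart ` {i. i < n \<and> mem (Lpart i)} \<union> Rpart ` {i. i < n \<and> mem (Rpart i)}"
  by (auto simp: full_base_def split_base_def base_def)

lemma word_split_base:
  "{\<nu> \<in> split_base m n. mem \<nu>} =
     (if mem Ambient then {Ambient} else {}) \<union> (if mem Low then {Low} else {}) \<union> (if mem High then {High} else {})
     \<union> Petal ` {i. i < m \<and> mem (Petal i)} \<union> Piece ` {i. i < n \<and> mem (Piece i)}
     \<union> Lpart ` {i. i < n \<and> mem (Lpart i)} \<union> Rpart ` {i. i < n \<and> mem (Rpart i)}"
  by (auto simp: split_base_def base_def)

lemma word_link_base:
  "{\<nu> \<in> link_base m n. mem \<nu>} =
     (if mem Link then {Link} else {}) \<union> Petal ` {i. i < m \<and> mem (Petal i)} \<union> Piece ` {i. i < n \<and> mem (Piece i)}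
     \<union> Lpart ` {i. i < n \<and> mem (Lpart i)} \<union> Rpart ` {i. i < n \<and> mem (Rpart i)}"
  by (auto simp: link_base_def base_def)

lemma petals_trichotomy:
  obtains (all) "\<forall>j<n. Q j" "{i. i < n \<and> (\<forall>j<n. j \<noteq> i \<longrightarrow> Q j)} = {..<n}"
  | (one) i where "i < n" "\<not> Q i" "\<forall>j<n. j \<noteq> i \<longrightarrow> Q j" "{i. i < n \<and> (\<forall>j<n. j \<noteq> i \<longrightarrow> Q j)} = {i}"
  | (none) "\<not> (\<forall>j<n. Q j)" "{i. i < n \<and> (\<forall>j<n. j \<noteq> i \<longrightarrow> Q j)} = {}"
proof (cases "\<forall>j<n. Q j")
  case True then show thesis by (intro all) auto
next
  case False
  then obtain k where k: "k < n" "\<not> Q k" by blast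
  show thesis
  proof (cases "\<forall>j<n. j \<noteq> k \<longrightarrow> Q j")
    case True then show thesis using k by (intro one[of k]) auto
  next
    case F2: False
    then obtain l where l: "l < n" "l \<noteq> k" "\<not> Q l" by blast
    have "{i. i < n \<and> (\<forall>j<n. j \<noteq> i \<longrightarrow> Q j)} = {}" using k l by blast
    then show thesis using False by (intro none)
  qed
qed

lemma flower_codeI:
  "{} \<in> flower_code m I" "{Ambient} \<union> wall m \<in> flower_code m I" "{Ambient, Low} \<union> wall m \<in> flower_code m I"
  "{Ambient, High} \<union> wall m \<in> flower_code m I" "{Ambient, Low} \<in> flower_code m I"
  by (simp_all add: flower_code_def)

lemma flower_code_petalI: "i < m \<Longrightarrow> {Ambient, Low, Petal i} \<in> flower_code m I"
  unfolding flower_code_def by (intro UnI1[OF UnI2] imageI) simp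

lemma flower_code_linkI: "w \<in> I \<Longrightarrow> {Ambient, Low, Link} \<union> w \<in> flower_code m I"
  unfolding flower_code_def by (intro UnI2 imageI)

lemma private_piecesI:
  "w \<in> chain_words n \<Longrightarrow> w \<in> private_pieces n"
  "i < n \<Longrightarrow> insert (Petal i) (piece_word i) \<in> private_pieces n"
  by (simp_all add: private_pieces_def)

lemma flower_codeE:
  assumes "\<sigma> \<in> flower_code m I"
  obtains (empty) "\<sigma> = {}" | (wall) "\<sigma> = {Ambient} \<union> wall m" | (low) "\<sigma> = {Ambient, Low} \<union> wall m"
    | (high) "\<sigma> = {Ambient, High} \<union> wall m" | (ambient) "\<sigma> = {Ambient, Low}"
    | (petal) i where "i < m" "\<sigma> = {Ambient, Low, Petal i}"
    | (link) w where "w \<in> I" "\<sigma> = {Ambient, Low, Link} \<union> w"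
proof -
  from assms consider
      "\<sigma> \<in> {{}, {Ambient} \<union> wall m, {Ambient, Low} \<union> wall m, {Ambient, High} \<union> wall m, {Ambient, Low}}"
    | "\<sigma> \<in> (\<lambda>i. {Ambient, Low, Petal i}) ` {..<m}" | "\<sigma> \<in> (\<lambda>w. {Ambient, Low, Link} \<union> w) ` I"
    unfolding flower_code_def by (elim UnE)
  then show thesis
  proof cases
    case 1
    then show thesis by (elim insertE emptyE) (fact that)+
  next
    case 2
    then show thesis by (elim imageE) (rule petal; simp)
  next
    case 3
    then show thesis by (elim imageE) (rule link; simp)
  qed
qed

lemma private_piecesE:
  assumes "w \<in> private_pieces n"
  obtains (petal) i where "i < n" "w = insert (Petal i) (piece_word i)"
    | (piece) i where "i < n" "w = piece_word i"
    | (corner) i where "Suc i < n" "w \<in> corner_words i"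
  using assms unfolding private_pieces_def chain_words_def by auto

section \<open>A fat realization in dimension \<^term>\<open>n\<close>\<close>

definition csum :: "nat \<Rightarrow> (nat \<Rightarrow> real) \<Rightarrow> real" where
  "csum n x = (\<Sum>k<n. x k)"

definition pos :: "nat \<Rightarrow> (nat \<Rightarrow> real) \<Rightarrow> real" where
  "pos n x = - (\<Sum>k<n. real k * x k)"

definition gap :: "nat \<Rightarrow> real" where
  "gap n = 1 / (16 * real n)"

definition slab_funs ::
  "nat \<Rightarrow> ((nat \<Rightarrow> real) \<Rightarrow> real) \<Rightarrow> real \<Rightarrow> real \<Rightarrow> nat \<Rightarrow> ((nat \<Rightarrow> real) \<Rightarrow> real) set" where
  "slab_funs n t l u i = (if i = 0 then {} else {\<lambda>x. t x - (real i - l)})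
     \<union> (if Suc i = n then {} else {\<lambda>x. (real i + u) - t x})"

lemma slab_funs_iff: "(\<forall>f\<in>slab_funs n t l u i. rel b 0 (f x)) \<longleftrightarrow> in_slab b n l u i (t x)"
  by (auto simp: slab_funs_def in_slab_def)

definition ambient_funs :: "nat \<Rightarrow> ((nat \<Rightarrow> real) \<Rightarrow> real) set" where
  "ambient_funs n = insert (\<lambda>x. csum n x + 1) ((\<lambda>k x. x k - ((csum n x + 1) / real n - 1)) ` {..<n})"

definition link_funs :: "nat \<Rightarrow> ((nat \<Rightarrow> real) \<Rightarrow> real) set" where
  "link_funs n = insert (\<lambda>x. (gap n - 1) - csum n x) (ambient_funs n)"

text \<open>The centre of the sunflower is the positive orthant and petal \<open>i\<close> sticks out of it in the
  direction of the negative \<open>i\<close>-th axis.  The link is a thin slab close to \<open>\<Sum>k<n. x k = -1\<close> which meets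
  petal \<open>i\<close> only near minus the \<open>i\<close>-th unit vector, where \<^const>\<open>pos\<close> is near \<open>i\<close>.  The ambient set
  narrows upwards, and enters the orthant at height \<open>\<Sum>k<n. x k = n - 1\<close>.\<close>

fun fat_funs :: "nat \<Rightarrow> neuron \<Rightarrow> ((nat \<Rightarrow> real) \<Rightarrow> real) set" where
  "fat_funs n Ambient = ambient_funs n"
| "fat_funs n Low = insert (\<lambda>x. real n - (csum n x + 1)) (ambient_funs n)"
| "fat_funs n High = insert (\<lambda>x. (csum n x + 1) - 2 * real n) (ambient_funs n)"
| "fat_funs n Link = link_funs n"
| "fat_funs n (Petal i) = (\<lambda>j x. x j) ` ({..<n} - {i}) \<union> ambient_funs n"
| "fat_funs n (Piece i) = slab_funs n (pos n) (3/4) (3/4) i \<union> link_funs n"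
| "fat_funs n (Lpart i) = slab_funs n (pos n) (3/4) (5/12) i \<union> link_funs n"
| "fat_funs n (Rpart i) = slab_funs n (pos n) (5/12) (3/4) i \<union> link_funs n"

definition fat_set :: "bool \<Rightarrow> nat \<Rightarrow> nat \<Rightarrow> neuron \<Rightarrow> (nat \<Rightarrow> real) set" where
  "fat_set b d n \<nu> = polyhedron_of b d (fat_funs n \<nu>)"

definition in_ambient :: "bool \<Rightarrow> nat \<Rightarrow> (nat \<Rightarrow> real) \<Rightarrow> bool" where
  "in_ambient b n p \<longleftrightarrow> rel b (-1) (csum n p) \<and> (\<forall>k<n. rel b ((csum n p + 1) / real n - 1) (p k))"

lemma ambient_iff: "(\<forall>f\<in>ambient_funs n. rel b 0 (f p)) \<longleftrightarrow> in_ambient b n p"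
proof -
  have "rel b 0 (csum n p + 1) \<longleftrightarrow> rel b (-1) (csum n p)" by (auto simp: rel_def)
  then show ?thesis by (auto simp: ambient_funs_def in_ambient_def)
qed

lemma fat_word_eq:
  assumes p: "p \<in> topspace (Esp d)" and amb: "in_ambient b n p"
  shows "{\<nu> \<in> full_base n n. p \<in> fat_set b d n \<nu>} = {Ambient}
     \<union> (if rel b (csum n p + 1) (real n) then {Low} else {}) \<union> (if rel b (2 * real n) (csum n p + 1) then {High} else {})
     \<union> (if rel b (csum n p) (gap n - 1) then {Link} \<union> chain_word b n (pos n p) else {})
     \<union> Petal ` {i. i < n \<and> (\<forall>j<n. j \<noteq> i \<longrightarrow> rel b 0 (p j))}"
proof -
  have A: "\<forall>f\<in>ambient_funs n. rel b 0 (f p)" using amb ambient_iff by blast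
  have L: "(\<forall>f\<in>link_funs n. rel b 0 (f p)) \<longleftrightarrow> rel b (csum n p) (gap n - 1)" using A by (simp add: link_funs_def)
  have mem: "p \<in> fat_set b d n \<nu> \<longleftrightarrow> (\<forall>f\<in>fat_funs n \<nu>. rel b 0 (f p))" for \<nu>
    using p by (simp add: fat_set_def polyhedron_of_def)
  have "p \<in> fat_set b d n Ambient" "p \<in> fat_set b d n Low \<longleftrightarrow> rel b (csum n p + 1) (real n)"
    "p \<in> fat_set b d n High \<longleftrightarrow> rel b (2 * real n) (csum n p + 1)"
    "p \<in> fat_set b d n Link \<longleftrightarrow> rel b (csum n p) (gap n - 1)"
    unfolding mem fat_funs.simps ball_simps rel_diff L using A by blast+
  moreover have "p \<in> fat_set b d n (Petal i) \<longleftrightarrow> (\<forall>j<n. j \<noteq> i \<longrightarrow> rel b 0 (p j))" for i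
    using A unfolding mem fat_funs.simps ball_Un by auto
  moreover have "p \<in> fat_set b d n (Piece i) \<longleftrightarrow> in_slab b n (3/4) (3/4) i (pos n p) \<and> rel b (csum n p) (gap n - 1)"
    "p \<in> fat_set b d n (Lpart i) \<longleftrightarrow> in_slab b n (3/4) (5/12) i (pos n p) \<and> rel b (csum n p) (gap n - 1)"
    "p \<in> fat_set b d n (Rpart i) \<longleftrightarrow> in_slab b n (5/12) (3/4) i (pos n p) \<and> rel b (csum n p) (gap n - 1)" for i
    unfolding mem fat_funs.simps ball_Un slab_funs_iff L by (rule refl)+
  ultimately show ?thesis unfolding word_full_base by (auto simp: chain_word_def)
qed

lemma fat_word_outside:
  assumes p: "p \<in> topspace (Esp d)" and amb: "\<not> in_ambient b n p"
  shows "{\<nu> \<in> full_base n n. p \<in> fat_set b d n \<nu>} = {}"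
proof -
  have "\<not> (\<forall>f\<in>fat_funs n \<nu>. rel b 0 (f p))" for \<nu>
  proof -
    have "ambient_funs n \<subseteq> fat_funs n \<nu>" by (cases \<nu>) (auto simp: link_funs_def)
    then show ?thesis using amb ambient_iff[of n b p] by blast
  qed
  then show ?thesis by (auto simp: fat_set_def polyhedron_of_def)
qed

text \<open>The width of the link leaves room \<open>gap n\<close> for the nonnegative coordinates together, and weighting
  them by at most \<open>n\<close> changes \<^const>\<open>pos\<close> by at most \<open>n * gap n = 1/16\<close>; so petal \<open>i\<close> meets the link
  inside piece \<open>i\<close> and away from its neighbours.\<close>

lemma pos_near_petal:
  assumes n: "n \<ge> 2" and amb: "in_ambient b n p" and s: "rel b (csum n p) (gap n - 1)"
    and i: "i < n" and pj: "\<forall>j<n. j \<noteq> i \<longrightarrow> rel b 0 (p j)"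
  shows "real i - 1/4 < pos n p" "pos n p < real i + 1/4"
proof -
  have s1: "-1 \<le> csum n p" using amb rel_weak by (auto simp: in_ambient_def)
  have s2: "csum n p \<le> gap n - 1" using s rel_weak by blast
  have pj0: "0 \<le> p j" if "j < n" "j \<noteq> i" for j using pj that rel_weak by blast
  have "(csum n p + 1) / real n - 1 \<le> p i" using amb i rel_weak by (auto simp: in_ambient_def)
  moreover have "0 \<le> (csum n p + 1) / real n" using s1 by simp
  ultimately have pi: "-1 \<le> p i" by linarith
  define R where "R = (\<Sum>j\<in>{..<n} - {i}. p j)"
  have sR: "csum n p = p i + R" unfolding csum_def R_def using i by (subst sum.remove[of _ i]) auto
  have R0: "0 \<le> R" unfolding R_def using pj0 by (intro sum_nonneg) auto
  have Rg: "R \<le> gap n" and pig: "p i \<le> gap n - 1" using sR s2 pi R0 by linarith+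
  define T where "T = (\<Sum>j\<in>{..<n} - {i}. real j * p j)"
  have tT: "pos n p = - (real i * p i) - T" unfolding pos_def T_def using i by (subst sum.remove[of _ i]) auto
  have T0: "0 \<le> T" unfolding T_def using pj0 by (intro sum_nonneg mult_nonneg_nonneg) auto
  have "T \<le> (\<Sum>j\<in>{..<n} - {i}. real n * p j)" unfolding T_def using pj0 by (intro sum_mono mult_right_mono) auto
  also have "\<dots> = real n * R" by (simp add: R_def sum_distrib_left)
  also have "\<dots> \<le> real n * gap n" using Rg by (intro mult_left_mono) auto
  also have ng: "real n * gap n = 1/16" using n by (simp add: gap_def)
  finally have T1: "T \<le> 1/16" .
  have "real i * p i \<ge> real i * (-1)" using pi by (intro mult_left_mono) auto
  moreover have "real i * p i \<le> real i * (gap n - 1)" using pig by (intro mult_left_mono) auto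
  moreover have "real i * gap n \<le> real n * gap n" using i by (intro mult_right_mono) (auto simp: gap_def)
  moreover have "real i * (gap n - 1) = real i * gap n - real i" by (simp add: algebra_simps)
  ultimately show "real i - 1/4 < pos n p" "pos n p < real i + 1/4" using tT T0 T1 ng by linarith+
qed

lemma fat_word_in_code:
  assumes n: "n \<ge> 2" and p: "p \<in> topspace (Esp d)"
  shows "{\<nu> \<in> full_base n n. p \<in> fat_set b d n \<nu>} \<in> flower_code n (private_pieces n)"
proof (cases "in_ambient b n p")
  case False
  then show ?thesis unfolding fat_word_outside[OF p False] by (simp add: flower_code_def)
next
  case amb: True
  note w = fat_word_eq[OF p amb]
  have n0: "real n > 0" using n by simp
  have g: "gap n \<le> 1/32" "gap n > 0" using n by (auto simp: gap_def field_simps)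
  have low: "rel b (csum n p + 1) (real n)" if j: "j < n" "\<not> rel b 0 (p j)" for j
  proof (rule ccontr)
    assume "\<not> ?thesis"
    then have "real n \<le> csum n p + 1" by (rule not_rel)
    then have "0 \<le> (csum n p + 1) / real n - 1" using n0 by (simp add: field_simps)
    moreover have "rel b ((csum n p + 1) / real n - 1) (p j)" using amb j by (simp add: in_ambient_def)
    ultimately show False using j rel_trans by blast
  qed
  have not_high: "\<not> rel b (2 * real n) (csum n p + 1)" if "rel b (csum n p + 1) (real n)"
    using that n0 by (auto simp: rel_def split: if_splits)
  have link_low: "rel b (csum n p + 1) (real n)" if "rel b (csum n p) (gap n - 1)"
    using rel_weak[OF that] g n by (intro rel_strict) linarith
  show ?thesis
  proof (cases rule: petals_trichotomy[of n "\<lambda>j. rel b 0 (p j)"])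
    case all
    have "csum n p \<ge> 0" unfolding csum_def using all(1) rel_weak by (intro sum_nonneg) auto
    then have "\<not> rel b (csum n p) (gap n - 1)" using g rel_weak by force
    then show ?thesis unfolding w all(2) using not_high by (auto simp: flower_code_def wall_def)
  next
    case (one i)
    note lo = low[OF one(1,2)]
    show ?thesis
    proof (cases "rel b (csum n p) (gap n - 1)")
      case True
      have "chain_word b n (pos n p) = piece_word i"
        using pos_near_petal[OF n amb True one(1,3)] one(1) by (intro chain_word_single) auto
      then have "{\<nu> \<in> full_base n n. p \<in> fat_set b d n \<nu>} = {Ambient, Low, Link} \<union> insert (Petal i) (piece_word i)"
        unfolding w one(4) using lo not_high True by auto
      then show ?thesis using flower_code_linkI[OF private_piecesI(2)[OF one(1)]] by simp
    next
      case False
      then have "{\<nu> \<in> full_base n n. p \<in> fat_set b d n \<nu>} = {Ambient, Low, Petal i}"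
        unfolding w one(4) using lo not_high by auto
      then show ?thesis using flower_code_petalI[OF one(1)] by simp
    qed
  next
    case none
    then have lo: "rel b (csum n p + 1) (real n)" using low by blast
    show ?thesis
    proof (cases "rel b (csum n p) (gap n - 1)")
      case True
      then have "{\<nu> \<in> full_base n n. p \<in> fat_set b d n \<nu>} = {Ambient, Low, Link} \<union> chain_word b n (pos n p)"
        unfolding w none(2) using lo not_high by auto
      moreover have "chain_word b n (pos n p) \<in> chain_words n" using n by (intro chain_word_in_chain_words) auto
      ultimately show ?thesis using flower_code_linkI[OF private_piecesI(1)] by simp
    next
      case False
      then have "{\<nu> \<in> full_base n n. p \<in> fat_set b d n \<nu>} = {Ambient, Low}"
        unfolding w none(2) using lo not_high by auto
      then show ?thesis using flower_codeI(5) by simp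
    qed
  qed
qed

lemma sum_two_values:
  fixes i n :: nat
  assumes "i < n"
  shows "(\<Sum>k<n. f k * (if k = i then a else if k < n then c else 0)) = f i * a + (\<Sum>k\<in>{..<n} - {i}. f k * (c::real))"
  using assms by (subst sum.remove[of _ i]) (auto intro!: sum.cong)

lemma csum_two_values:
  assumes "i < n"
  shows "csum n (\<lambda>k. if k = i then a else if k < n then c else 0) = a + (real n - 1) * c"
  using sum_two_values[OF assms, of "\<lambda>_. 1" a c] assms by (simp add: csum_def of_nat_diff)

lemma sum_two_points:
  fixes i j n :: nat
  assumes "i < n" "j < n" "i \<noteq> j"
  shows "(\<Sum>k<n. f k * (if k = i then a else if k = j then c else 0)) = f i * a + f j * (c::real)"
proof -
  have "(\<Sum>k<n. f k * (if k = i then a else if k = j then c else 0))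
      = (\<Sum>k<n. (if k = i then f i * a else 0) + (if k = j then f j * c else 0))"
    using assms by (intro sum.cong) auto
  then show ?thesis using assms by (simp add: sum.distrib)
qed

text \<open>The witnesses avoid the boundaries of all sets involved, so that each serves the open and the
  closed family alike.\<close>

lemma fat_word_attained:
  assumes n: "n \<ge> 2" "n \<le> d" and \<sigma>: "\<sigma> \<in> flower_code n (private_pieces n)"
  shows "\<exists>p\<in>topspace (Esp d). \<sigma> = {\<nu> \<in> full_base n n. p \<in> fat_set b d n \<nu>}"
proof -
  have n0: "real n > 0" and n2: "real n \<ge> 2" using n by auto
  have g: "gap n \<le> 1/32" "gap n > 0" using n by (auto simp: gap_def field_simps)
  have top: "(\<lambda>k. if k < n then f k else 0) \<in> topspace (Esp d)" for f :: "nat \<Rightarrow> real"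
    using n by (auto simp: topspace_E)
  \<comment> \<open>a point far enough above the bottom facet of the ambient set\<close>
  have amb: "in_ambient b n p" if "-1 < csum n p" "\<And>k. k < n \<Longrightarrow> (csum n p + 1) / real n - 1 < p k" for p
    using that rel_strict by (auto simp: in_ambient_def)
  have w_wall: "{\<nu> \<in> full_base n n. p \<in> fat_set b d n \<nu>} = {Ambient}
      \<union> (if rel b (real n * x + 1) (real n) then {Low} else {}) \<union> (if rel b (2 * real n) (real n * x + 1) then {High} else {}) \<union> wall n"
    if p: "p = (\<lambda>k. if k < n then x else 0)" and x: "x > 0" for p x
  proof -
    have cs: "csum n p = real n * x" by (simp add: p csum_def)
    have "1 / real n < 1" using n2 by simp
    moreover have "(csum n p + 1) / real n = x + 1 / real n" using n0 by (simp add: cs add_divide_distrib)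
    moreover have "0 < csum n p" using x n0 by (simp add: cs)
    moreover have "p k = x" if "k < n" for k using that by (simp add: p)
    ultimately have a: "in_ambient b n p" by (intro amb) simp_all
    have nl: "\<not> rel b (csum n p) (gap n - 1)"
    proof -
      have "real n * x > 0" using n0 x by simp
      then show ?thesis unfolding cs rel_def using g by auto
    qed
    have "{i. i < n \<and> (\<forall>j<n. j \<noteq> i \<longrightarrow> rel b 0 (p j))} = {..<n}" using x by (auto simp: p rel_def)
    then show ?thesis using fat_word_eq[OF _ a, of d] top[of "\<lambda>_. x"] nl by (simp add: p[symmetric] cs wall_def)
  qed
  \<comment> \<open>two coordinates negative, all others zero: no petal contains the point\<close>
  have pair: "in_ambient b n p \<and> csum n p = - x - y \<and> pos n p = real i * x + real j * y
      \<and> p \<in> topspace (Esp d) \<and> {i. i < n \<and> (\<forall>j<n. j \<noteq> i \<longrightarrow> rel b 0 (p j))} = {}"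
    if p: "p = (\<lambda>k. if k = i then - x else if k = j then - y else 0)" and ij: "i < n" "j < n" "i \<noteq> j"
      and xy: "x > 0" "y > 0" "x + y < 1" "x < 1 - (1 - x - y) / real n" "y < 1 - (1 - x - y) / real n" for p i j x y
  proof -
    have cs: "csum n p = - x - y" unfolding csum_def p using sum_two_points[OF ij, of "\<lambda>_. 1" "- x" "- y"] by simp
    have ps: "pos n p = real i * x + real j * y" unfolding pos_def p using sum_two_points[OF ij, of real "- x" "- y"] by simp
    have "in_ambient b n p"
    proof (rule amb)
      show "-1 < csum n p" using xy cs by simp
      fix k assume "k < n"
      have "1 - x - y + 0 < 1 * real n" using n2 xy by linarith
      then have "(1 - x - y) / real n < 1" using n0 by (simp add: field_simps)
      moreover have "(csum n p + 1) / real n = (1 - x - y) / real n" by (simp add: cs)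
      moreover have "p k = - x \<or> p k = - y \<or> p k = 0" by (simp add: p)
      ultimately show "(csum n p + 1) / real n - 1 < p k" using xy by (elim disjE) linarith+
    qed
    moreover have "p \<in> topspace (Esp d)" using ij n by (auto simp: p topspace_E)
    moreover have "\<not> rel b 0 (p i)" "\<not> rel b 0 (p j)" using ij xy by (auto simp: p rel_def)
    then have "{i. i < n \<and> (\<forall>j<n. j \<noteq> i \<longrightarrow> rel b 0 (p j))} = {}" using ij by blast
    ultimately show ?thesis using cs ps by blast
  qed
  define \<sigma>' where "\<sigma>' = 1 - gap n / 2"
  have linkpair: "\<exists>p\<in>topspace (Esp d). {\<nu> \<in> full_base n n. p \<in> fat_set b d n \<nu>}
      = {Ambient, Low, Link} \<union> chain_word b n (real i * x + real j * y)"
    if ij: "i < n" "j < n" "i \<noteq> j" and xy: "x > 1/32" "y > 1/32" "x + y = \<sigma>'" for i j x y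
  proof -
    have "gap n / 2 / real n \<le> gap n / 2" using n2 g by (simp add: field_simps)
    then have "(1 - x - y) / real n \<le> 1/64" using xy g by (simp add: \<sigma>'_def diff_diff_eq)
    then have c: "x > 0" "y > 0" "x + y < 1" "x < 1 - (1 - x - y) / real n" "y < 1 - (1 - x - y) / real n"
      using xy g unfolding \<sigma>'_def by linarith+
    note P = pair[OF refl ij c]
    let ?p = "\<lambda>k. if k = i then - x else if k = j then - y else 0"
    have cs: "csum n ?p = gap n / 2 - 1" using P xy by (simp add: \<sigma>'_def)
    have "rel b (csum n ?p + 1) (real n)" unfolding cs using g n2 by (intro rel_strict) linarith
    moreover have "\<not> rel b (2 * real n) (csum n ?p + 1)" unfolding cs using g n2 by (auto simp: rel_def)
    moreover have "rel b (csum n ?p) (gap n - 1)" unfolding cs using g by (intro rel_strict) linarith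
    ultimately show ?thesis using fat_word_eq[of ?p d b n] P by (intro bexI[of _ ?p]) auto
  qed
  \<comment> \<open>one coordinate negative, all others positive\<close>
  have single: "\<exists>p\<in>topspace (Esp d). {\<nu> \<in> full_base n n. p \<in> fat_set b d n \<nu>} = {Ambient}
      \<union> (if rel b (s + 1) (real n) then {Low} else {}) \<union> (if rel b (2 * real n) (s + 1) then {High} else {})
     \<union> (if rel b s (gap n - 1) then {Link} \<union> piece_word i else {}) \<union> {Petal i}"
    if i: "i < n" and s: "s = - x + (real n - 1) * y" "-1 < s" and xy: "x > 0" "y > 0" "(s + 1) / real n - 1 < - x" for i x y s
  proof -
    define p where "p = (\<lambda>k. if k = i then - x else if k < n then y else 0)"
    have cs: "csum n p = s" unfolding p_def s(1) by (rule csum_two_values[OF i])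
    have a: "in_ambient b n p" using xy s by (intro amb) (auto simp: cs, auto simp: p_def)
    have t: "p \<in> topspace (Esp d)" using i n by (auto simp: p_def topspace_E)
    have nr: "\<not> rel b 0 (p i)" using xy by (auto simp: p_def rel_def)
    have ot: "\<forall>j<n. j \<noteq> i \<longrightarrow> rel b 0 (p j)" using xy by (auto simp: p_def rel_def)
    have "{i. i < n \<and> (\<forall>j<n. j \<noteq> i \<longrightarrow> rel b 0 (p j))} = {i}" using i nr ot by blast
    moreover have "chain_word b n (pos n p) = piece_word i" if "rel b s (gap n - 1)"
      using pos_near_petal[OF n(1) a _ i ot] that i cs by (intro chain_word_single) auto
    ultimately show ?thesis using fat_word_eq[OF t a] t by (intro bexI[of _ p]) (auto simp: cs)
  qed
  from \<sigma> show ?thesis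
  proof (cases rule: flower_codeE)
    case empty
    define p :: "nat \<Rightarrow> real" where "p = (\<lambda>k. if k = 0 then - 2 else if k = 1 then 0 else 0)"
    have "csum n p = - 2" unfolding csum_def p_def using sum_two_points[of 0 n 1 "\<lambda>_. 1" "-2" 0] n by simp
    then have "\<not> in_ambient b n p" by (auto simp: in_ambient_def rel_def)
    moreover have "p \<in> topspace (Esp d)" using n by (auto simp: p_def topspace_E)
    ultimately show ?thesis using empty fat_word_outside by blast
  next
    case wall
    have "\<not> rel b (real n * 1 + 1) (real n)" "\<not> rel b (2 * real n) (real n * 1 + 1)" using n2 by (auto simp: rel_def)
    then show ?thesis using wall w_wall[OF refl, of 1] top[of "\<lambda>_. 1"] by (intro bexI[of _ "\<lambda>k. if k < n then 1 else 0"]) auto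
  next
    case low
    have "real n * (1 / (2 * real n)) = 1/2" using n0 by simp
    then have "rel b (real n * (1 / (2 * real n)) + 1) (real n)" "\<not> rel b (2 * real n) (real n * (1 / (2 * real n)) + 1)"
      using n2 by (auto simp: rel_def)
    then show ?thesis using low n0 w_wall[OF refl, of "1 / (2 * real n)"] top[of "\<lambda>_. 1 / (2 * real n)"]
      by (intro bexI[of _ "\<lambda>k. if k < n then 1 / (2 * real n) else 0"]) auto
  next
    case high
    have "\<not> rel b (real n * 2 + 1) (real n)" "rel b (2 * real n) (real n * 2 + 1)" using n2 by (auto simp: rel_def)
    then show ?thesis using high w_wall[OF refl, of 2] top[of "\<lambda>_. 2"] by (intro bexI[of _ "\<lambda>k. if k < n then 2 else 0"]) auto
  next
    case ambient
    have "3 / 4 / real n \<le> 3 / 4 / 2" using n2 by (intro divide_left_mono) auto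
    then have P: "in_ambient b n p \<and> csum n p = - (1/8) - 1/8 \<and> pos n p = real 0 * (1/8) + real 1 * (1/8)
      \<and> p \<in> topspace (Esp d) \<and> {i. i < n \<and> (\<forall>j<n. j \<noteq> i \<longrightarrow> rel b 0 (p j))} = {}"
      if "p = (\<lambda>k. if k = 0 then - (1/8) else if k = 1 then - (1/8) else 0)" for p
      using n by (intro pair[OF that]) auto
    define p :: "nat \<Rightarrow> real" where "p = (\<lambda>k. if k = 0 then - (1/8) else if k = 1 then - (1/8) else 0)"
    note P' = P[OF p_def]
    have cs: "csum n p = -1/4" using P' by simp
    have "rel b (csum n p + 1) (real n)" "\<not> rel b (2 * real n) (csum n p + 1)" "\<not> rel b (csum n p) (gap n - 1)"
      unfolding cs using g n2 by (auto simp: rel_def)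
    then show ?thesis using ambient P' fat_word_eq[of p d b n] by (intro bexI[of _ p]) auto
  next
    case (petal i)
    define s where "s = - (1/8) + (real n - 1) * (1/8)"
    have s8: "s = (real n - 2) / 8" by (simp add: s_def field_simps)
    have s0: "0 \<le> s" unfolding s8 using n2 by simp
    have s_n: "s + 1 < real n" unfolding s8 using n2 by (simp add: field_simps)
    have s_g: "gap n - 1 < s" using s0 g by linarith
    have "(s + 1) / real n - 1 < - (1/8)" using n2 by (simp add: s_def field_simps)
    then have "\<exists>p\<in>topspace (Esp d). {\<nu> \<in> full_base n n. p \<in> fat_set b d n \<nu>} = {Ambient}
      \<union> (if rel b (s + 1) (real n) then {Low} else {}) \<union> (if rel b (2 * real n) (s + 1) then {High} else {})
     \<union> (if rel b s (gap n - 1) then {Link} \<union> piece_word i else {}) \<union> {Petal i}"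
      using petal s0 by (intro single[OF _ s_def]) auto
    moreover have "rel b (s + 1) (real n)" "\<not> rel b (2 * real n) (s + 1)" "\<not> rel b s (gap n - 1)"
        using s_n s_g n0 by (auto simp: rel_def)
    ultimately show ?thesis using petal by (auto simp: insert_commute)
  next
    case (link w)
    from link(1) show ?thesis
    proof (cases rule: private_piecesE)
      case (petal i)
      define s where "s = - (1 - gap n / 2) + (real n - 1) * (gap n / (8 * real n))"
      have "(real n - 1) * (gap n / (8 * real n)) = gap n / 8 - gap n / (8 * real n)" using n0 by (simp add: field_simps)
      moreover have "gap n / (8 * real n) > 0" using g n0 by simp
      moreover have "gap n / (8 * real n) \<le> gap n / 8" using g n2 by (simp add: field_simps)
      ultimately have s: "-1 + gap n / 2 \<le> s" "s < -1 + 5/8 * gap n" by (auto simp: s_def)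
      have "(s + 1) / real n \<le> (5/8 * gap n) / 2" using s n2 g by (intro frac_le) auto
      then have "(s + 1) / real n - 1 < - (1 - gap n / 2)" using g by linarith
      then have "\<exists>p\<in>topspace (Esp d). {\<nu> \<in> full_base n n. p \<in> fat_set b d n \<nu>} = {Ambient}
        \<union> (if rel b (s + 1) (real n) then {Low} else {}) \<union> (if rel b (2 * real n) (s + 1) then {High} else {})
       \<union> (if rel b s (gap n - 1) then {Link} \<union> piece_word i else {}) \<union> {Petal i}"
        using petal s g n0 by (intro single[OF _ s_def]) auto
      moreover have "rel b (s + 1) (real n)" "\<not> rel b (2 * real n) (s + 1)" "rel b s (gap n - 1)"
        using g n2 s by (auto simp: rel_def)
      ultimately show ?thesis using petal link by (auto simp: insert_commute)
    next
      case (piece i)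
      define j where "j = (if i = 0 then 1 else i - 1)"
      have j: "j < n" "j \<noteq> i" using piece n by (auto simp: j_def)
      obtain p where p: "p \<in> topspace (Esp d)" "{\<nu> \<in> full_base n n. p \<in> fat_set b d n \<nu>}
        = {Ambient, Low, Link} \<union> chain_word b n (real i * (\<sigma>' - 1/8) + real j * (1/8))"
        using linkpair[OF piece(1) j(1) j(2)[symmetric], of "\<sigma>' - 1/8" "1/8"] g by (auto simp: \<sigma>'_def)
      have ig: "0 \<le> real i * (gap n / 2)" "real i * (gap n / 2) \<le> 1/32"
      proof -
        have "real i * (gap n / 2) \<le> real n * (gap n / 2)" using piece g by (intro mult_right_mono) auto
        then show "real i * (gap n / 2) \<le> 1/32" using n0 by (simp add: gap_def)
        show "0 \<le> real i * (gap n / 2)" using g by simp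
      qed
      have "real i * (\<sigma>' - 1/8) + real j * (1/8) = real i - real i * (gap n / 2) + (real j - real i) / 8"
        by (simp add: \<sigma>'_def field_simps)
      moreover have "\<bar>real j - real i\<bar> = 1" by (auto simp: j_def of_nat_diff)
      moreover have "ri - 1/4 < \<tau> \<and> \<tau> < ri + 1/4"
        if "\<tau> = ri - \<delta> + (rj - ri) / 8" "\<bar>rj - ri\<bar> = 1" "0 \<le> \<delta>" "\<delta> \<le> 1/32" for \<tau> \<delta> ri rj :: real
        using that by (auto simp: abs_if field_simps split: if_splits)
      ultimately have "real i - 1/4 < real i * (\<sigma>' - 1/8) + real j * (1/8) \<and> real i * (\<sigma>' - 1/8) + real j * (1/8) < real i + 1/4"
        using ig by blast
      then have "chain_word b n (real i * (\<sigma>' - 1/8) + real j * (1/8)) = piece_word i"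
        using piece by (intro chain_word_single) auto
      then show ?thesis using p piece link by (intro bexI[of _ p]) auto
    next
      case (corner i)
      obtain r where r: "1/4 < r" "r < 3/4" "\<And>b. chain_word b n (real i + r) = w"
        using corner_words_attained[OF corner(2,1)] by metis
      have ig: "0 \<le> real i * (gap n / 2)" "real i * (gap n / 2) \<le> 1/32"
      proof -
        have "real i * (gap n / 2) \<le> real n * (gap n / 2)" using corner g by (intro mult_right_mono) auto
        then show "real i * (gap n / 2) \<le> 1/32" using n0 by (simp add: gap_def)
        show "0 \<le> real i * (gap n / 2)" using g by simp
      qed
      define y where "y = r + real i * (gap n / 2)"
      have "\<sigma>' - y > 1/32" "y > 1/32" using r ig g unfolding y_def \<sigma>'_def by linarith+
      then obtain p where p: "p \<in> topspace (Esp d)" "{\<nu> \<in> full_base n n. p \<in> fat_set b d n \<nu>}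
        = {Ambient, Low, Link} \<union> chain_word b n (real i * (\<sigma>' - y) + real (Suc i) * y)"
        using linkpair[of i "Suc i" "\<sigma>' - y" y] corner(1) by auto
      have "real i * (\<sigma>' - y) + real (Suc i) * y = real i + r" by (simp add: \<sigma>'_def y_def algebra_simps)
      then show ?thesis using p link r(3) by (intro bexI[of _ p]) auto
  qed
  qed
qed

lemma fat_funs_affine:
  assumes "n \<le> d" "\<nu> \<in> full_base n n" "f \<in> fat_funs n \<nu>"
  shows "affine_fun d f"
proof -
  have cs: "affine_fun d (csum n)" unfolding csum_def[abs_def] using assms(1) by (intro affine_fun_sum) auto
  have ps: "affine_fun d (pos n)" unfolding pos_def[abs_def] using assms(1) by (intro affine_fun_minus affine_fun_sum affine_fun_cmul) auto
  have A: "affine_fun d g" if "g \<in> ambient_funs n" for g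
    using that assms(1) unfolding ambient_funs_def
    by (auto intro!: affine_fun_diff affine_fun_add affine_fun_divide cs)
  have L: "affine_fun d g" if "g \<in> link_funs n" for g
    using that A unfolding link_funs_def by (auto intro!: affine_fun_diff cs)
  have S: "affine_fun d g" if "g \<in> slab_funs n (pos n) l u i" for g l u i
    using that ps unfolding slab_funs_def by (auto intro!: affine_fun_diff split: if_splits)
  show ?thesis using assms A L S by (cases \<nu>) (auto intro!: affine_fun_diff affine_fun_add cs)
qed

lemma fat_funs_nonconstant:
  assumes n: "n \<ge> 2" "n \<le> d" and f: "\<nu> \<in> full_base n n" "f \<in> fat_funs n \<nu>"
  shows "\<exists>x\<in>topspace (Esp d). f x \<noteq> f (\<lambda>_. 0)"
proof -
  define e :: "nat \<Rightarrow> nat \<Rightarrow> real" where "e j = (\<lambda>k. if k = j then 1 else 0)" for j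
  have e: "e j \<in> topspace (Esp d)" if "j < n" for j using that n by (auto simp: e_def topspace_E)
  have ce: "csum n (e j) = 1" if "j < n" for j using that by (simp add: csum_def e_def)
  have c0: "csum n (\<lambda>_. 0) = 0" "pos n (\<lambda>_. 0) = 0" by (simp_all add: csum_def pos_def)
  have pe: "pos n (e 1) = - 1"
  proof -
    have "(\<Sum>k<n. real k * e 1 k) = (\<Sum>k<n. if k = 1 then 1 else 0)" by (intro sum.cong) (auto simp: e_def)
    then show ?thesis using n by (simp add: pos_def)
  qed
  have A: "\<exists>j<n. g (e j) \<noteq> g (\<lambda>_. 0)" if "g \<in> ambient_funs n" for g
  proof -
    show ?thesis
    proof (cases "g = (\<lambda>x. csum n x + 1)")
      case True
      then show ?thesis using ce[of 0] c0 n by (intro exI[of _ 0]) auto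
    next
      case False
      then have "g \<in> (\<lambda>k x. x k - ((csum n x + 1) / real n - 1)) ` {..<n}"
        using that unfolding ambient_funs_def by blast
      then obtain k where k: "g = (\<lambda>x. x k - ((csum n x + 1) / real n - 1))" "k \<in> {..<n}" by (rule imageE)
      have "g (e k) - g (\<lambda>_. 0) = 1 - 1 / real n" using k ce[of k] c0 by (simp add: e_def add_divide_distrib)
      moreover have "1 - 1 / real n \<noteq> 0" using n by simp
      ultimately show ?thesis using k(2) by (intro exI[of _ k]) auto
    qed
  qed
  have L: "\<exists>j<n. g (e j) \<noteq> g (\<lambda>_. 0)" if g: "g \<in> link_funs n" for g
  proof (cases "g \<in> ambient_funs n")
    case False
    then have "g = (\<lambda>x. (gap n - 1) - csum n x)" using g by (auto simp: link_funs_def)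
    then show ?thesis using ce[of 0] c0 n by (intro exI[of _ 0]) auto
  qed (rule A)
  have S: "\<exists>j<n. g (e j) \<noteq> g (\<lambda>_. 0)" if "g \<in> slab_funs n (pos n) l u i" for g l u i
    using that pe c0 n unfolding slab_funs_def by (intro exI[of _ 1]) (auto split: if_splits)
  have "\<exists>j<n. f (e j) \<noteq> f (\<lambda>_. 0)"
  proof (cases \<nu>)
    case Low
    show ?thesis
    proof (cases "f \<in> ambient_funs n")
      case False
      then show ?thesis using Low f ce[of 0] c0 n by (intro exI[of _ 0]) auto
    qed (rule A)
  next
    case High
    show ?thesis
    proof (cases "f \<in> ambient_funs n")
      case False
      then show ?thesis using High f ce[of 0] c0 n by (intro exI[of _ 0]) auto
    qed (rule A)
  next
    case (Petal i)
    then consider "f \<in> ambient_funs n" | j where "j < n" "f = (\<lambda>x. x j)" using f by auto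
    then show ?thesis using A by cases (auto simp: e_def)
  qed (use f A L S in auto)
  then show ?thesis using e by blast
qed

lemma finite_fat_funs: "finite (fat_funs n \<nu>)"
  by (cases \<nu>) (auto simp: ambient_funs_def link_funs_def slab_funs_def)

text \<open>The closed and the open polyhedra have the same code, and the open ones are the interiors of the
  closed ones, which is nondegeneracy.\<close>

proposition private_flower_fat_realization:
  assumes n: "n \<ge> 2" "n \<le> d"
  shows "nd_closed_realizable d (full_base n n) (flower_code n (private_pieces n))"
    and "open_realizable d (full_base n n) (flower_code n (private_pieces n))"
proof -
  have code: "code_of d (full_base n n) (fat_set b d n) = flower_code n (private_pieces n)" for b
    by (rule code_of_eqI[OF fat_word_in_code[OF n(1)] fat_word_attained[OF n]])
  have op: "open_convex_realization d (full_base n n) (flower_code n (private_pieces n)) (fat_set True d n)"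
    unfolding open_convex_realization_def
  proof (intro conjI ballI code)
    fix \<nu> assume nu: "\<nu> \<in> full_base n n"
    show "openin (Esp d) (fat_set True d n \<nu>)" "convex_fun (fat_set True d n \<nu>)"
      unfolding fat_set_def
      by (intro openin_polyhedron_of convex_polyhedron_of finite_fat_funs fat_funs_affine[OF n(2) nu]; assumption)+
  qed
  have cl: "closed_convex_realization d (full_base n n) (flower_code n (private_pieces n)) (fat_set False d n)"
    unfolding closed_convex_realization_def
  proof (intro conjI ballI code)
    fix \<nu> assume nu: "\<nu> \<in> full_base n n"
    show "closedin (Esp d) (fat_set False d n \<nu>)" "convex_fun (fat_set False d n \<nu>)"
      unfolding fat_set_def
      by (intro closedin_polyhedron_of convex_polyhedron_of fat_funs_affine[OF n(2) nu]; assumption)+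
  qed
  have int: "Esp d interior_of fat_set False d n \<nu> = fat_set True d n \<nu>" if "\<nu> \<in> full_base n n" for \<nu>
    unfolding fat_set_def using that
    by (intro interior_of_polyhedron_of finite_fat_funs fat_funs_affine[OF n(2) that] fat_funs_nonconstant[OF n that])
  have "code_of d (full_base n n) (\<lambda>\<nu>. Esp d interior_of fat_set False d n \<nu>) = code_of d (full_base n n) (fat_set True d n)"
    using int by (auto simp: code_of_def)
  then have nd: "nondegenerate_closed d (full_base n n) (fat_set False d n)"
    by (simp only: nondegenerate_closed_def code)
  then show "nd_closed_realizable d (full_base n n) (flower_code n (private_pieces n))"
    using cl nd by (intro exI[of _ "fat_set False d n"] conjI)
  show "open_realizable d (full_base n n) (flower_code n (private_pieces n))"
    using op by (rule exI[of _ "fat_set True d n"])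
qed

section \<open>Planar realizations\<close>

subsection \<open>The codes without some of the neurons\<close>

lemma pull_id: "pull id S C = (\<lambda>\<sigma>. S \<inter> \<sigma>) ` C"
  unfolding pull_def by (intro image_cong) auto

lemma pull_idI: "\<sigma> \<in> C \<Longrightarrow> S \<inter> \<sigma> = \<tau> \<Longrightarrow> \<tau> \<in> pull id S C"
  by (auto simp: pull_id)

abbreviation "link_code m n I \<equiv> pull id (link_base m n) (flower_code m I)"
abbreviation "split_code m n I \<equiv> pull id (split_base m n) (flower_code m I)"

lemma base_no_Link: "Link \<notin> base m n" "Ambient \<notin> base m n" "Low \<notin> base m n" "High \<notin> base m n"
  by (auto simp: base_def)

lemma link_codeI:
  "{} \<in> link_code m n I" "wall m \<in> link_code m n I" "i < m \<Longrightarrow> {Petal i} \<in> link_code m n I"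
  "w \<in> I \<Longrightarrow> w \<subseteq> base m n \<Longrightarrow> insert Link w \<in> link_code m n I"
proof -
  note B = wall_Pow[of m n] base_no_Link[of m n]
  show "{} \<in> link_code m n I" by (rule pull_idI[OF flower_codeI(1)]) simp
  show "wall m \<in> link_code m n I"
    by (rule pull_idI[OF flower_codeI(2)]) (use B in \<open>auto simp: link_base_def\<close>)
  show "{Petal i} \<in> link_code m n I" if "i < m"
    by (rule pull_idI[OF flower_code_petalI[OF that]]) (use that in \<open>auto simp: link_base_def base_def\<close>)
  show "insert Link w \<in> link_code m n I" if "w \<in> I" "w \<subseteq> base m n"
    by (rule pull_idI[OF flower_code_linkI[OF that(1)]]) (use that B in \<open>auto simp: link_base_def\<close>)
qed

lemma link_codeE [consumes 2]:
  assumes "\<forall>w\<in>I. w \<subseteq> base m n" "\<sigma> \<in> link_code m n I"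
  obtains (empty) "\<sigma> = {}" | (wall) "\<sigma> = wall m" | (petal) i where "i < m" "\<sigma> = {Petal i}"
    | (link) w where "w \<in> I" "\<sigma> = insert Link w"
proof -
  note B = wall_Pow[of m n] base_no_Link[of m n]
  obtain \<sigma>' where s: "\<sigma>' \<in> flower_code m I" "\<sigma> = link_base m n \<inter> \<sigma>'" using assms(2) by (auto simp: pull_id)
  from s(1) show thesis
  proof (cases rule: flower_codeE)
    case empty then show thesis using s that(1) by simp
  next
    case wall
    then have "\<sigma> = wall m" using s B by (auto simp: link_base_def)
    then show thesis by (rule that(2))
  next
    case low
    then have "\<sigma> = wall m" using s B by (auto simp: link_base_def)
    then show thesis by (rule that(2))
  next
    case high
    then have "\<sigma> = wall m" using s B by (auto simp: link_base_def)
    then show thesis by (rule that(2))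
  next
    case ambient
    then have "\<sigma> = {}" using s B by (auto simp: link_base_def)
    then show thesis by (rule that(1))
  next
    case (petal i)
    then have "\<sigma> = {Petal i}" using s by (auto simp: link_base_def base_def)
    then show thesis using that(3) petal by blast
  next
    case (link w)
    then have "\<sigma> = insert Link w" using s B assms(1)[rule_format, OF link(1)] by (auto simp: link_base_def)
    then show thesis using that(4) link by blast
  qed
qed

lemma split_codeI:
  "{} \<in> split_code m n I" "{Ambient} \<union> wall m \<in> split_code m n I" "{Ambient, Low} \<union> wall m \<in> split_code m n I"
  "{Ambient, High} \<union> wall m \<in> split_code m n I" "{Ambient, Low} \<in> split_code m n I"
  "i < m \<Longrightarrow> {Ambient, Low, Petal i} \<in> split_code m n I"
  "w \<in> I \<Longrightarrow> w \<subseteq> base m n \<Longrightarrow> {Ambient, Low} \<union> w \<in> split_code m n I"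
proof -
  note B = wall_Pow[of m n] base_no_Link[of m n]
  show "{} \<in> split_code m n I" by (rule pull_idI[OF flower_codeI(1)]) simp
  show "{Ambient} \<union> wall m \<in> split_code m n I"
    by (rule pull_idI[OF flower_codeI(2)]) (use B in \<open>auto simp: split_base_def\<close>)
  show "{Ambient, Low} \<union> wall m \<in> split_code m n I"
    by (rule pull_idI[OF flower_codeI(3)]) (use B in \<open>auto simp: split_base_def\<close>)
  show "{Ambient, High} \<union> wall m \<in> split_code m n I"
    by (rule pull_idI[OF flower_codeI(4)]) (use B in \<open>auto simp: split_base_def\<close>)
  show "{Ambient, Low} \<in> split_code m n I"
    by (rule pull_idI[OF flower_codeI(5)]) (auto simp: split_base_def)
  show "{Ambient, Low, Petal i} \<in> split_code m n I" if "i < m"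
    by (rule pull_idI[OF flower_code_petalI[OF that]]) (use that in \<open>auto simp: split_base_def base_def\<close>)
  show "{Ambient, Low} \<union> w \<in> split_code m n I" if "w \<in> I" "w \<subseteq> base m n"
    by (rule pull_idI[OF flower_code_linkI[OF that(1)]]) (use that B in \<open>auto simp: split_base_def\<close>)
qed

lemma split_codeE [consumes 2]:
  assumes "\<forall>w\<in>I. w \<subseteq> base m n" "\<sigma> \<in> split_code m n I"
  obtains (empty) "\<sigma> = {}" | (wall) "\<sigma> = {Ambient} \<union> wall m" | (low) "\<sigma> = {Ambient, Low} \<union> wall m"
    | (high) "\<sigma> = {Ambient, High} \<union> wall m" | (ambient) "\<sigma> = {Ambient, Low}"
    | (petal) i where "i < m" "\<sigma> = {Ambient, Low, Petal i}"
    | (link) w where "w \<in> I" "\<sigma> = {Ambient, Low} \<union> w"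
proof -
  note B = wall_Pow[of m n] base_no_Link[of m n]
  obtain \<sigma>' where s: "\<sigma>' \<in> flower_code m I" "\<sigma> = split_base m n \<inter> \<sigma>'" using assms(2) by (auto simp: pull_id)
  from s(1) show thesis
  proof (cases rule: flower_codeE)
    case empty then show thesis using s that(1) by simp
  next
    case wall
    then have "\<sigma> = {Ambient} \<union> wall m" using s B by (auto simp: split_base_def)
    then show thesis by (rule that(2))
  next
    case low
    then have "\<sigma> = {Ambient, Low} \<union> wall m" using s B by (auto simp: split_base_def)
    then show thesis by (rule that(3))
  next
    case high
    then have "\<sigma> = {Ambient, High} \<union> wall m" using s B by (auto simp: split_base_def)
    then show thesis by (rule that(4))
  next
    case ambient
    then have "\<sigma> = {Ambient, Low}" using s by (auto simp: split_base_def)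
    then show thesis by (rule that(5))
  next
    case (petal i)
    then have "\<sigma> = {Ambient, Low, Petal i}" using s by (auto simp: split_base_def base_def)
    then show thesis using that(6) petal by blast
  next
    case (link w)
    then have "\<sigma> = {Ambient, Low} \<union> w" using s B assms(1)[rule_format, OF link(1)] by (auto simp: split_base_def)
    then show thesis using that(7) link by blast
  qed
qed

definition plane_point :: "real \<Rightarrow> real \<Rightarrow> nat \<Rightarrow> real" where
  "plane_point x y = (\<lambda>k. if k = 0 then x else if k = 1 then y else 0)"

lemma plane_point: "plane_point x y 0 = x" "plane_point x y 1 = y" "plane_point x y (Suc 0) = y"
  "2 \<le> d \<Longrightarrow> plane_point x y \<in> topspace (Esp d)"
  by (auto simp: plane_point_def topspace_E)

subsection \<open>Closed sets: a fan of cones crossed by a line\<close>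

text \<open>The petals are cones with a common apex, so the centre is a single point and the dimension
  bound for fat sunflowers does not apply.\<close>

fun fan_funs :: "(nat \<Rightarrow> real) \<Rightarrow> (nat \<Rightarrow> real) \<Rightarrow> nat \<Rightarrow> neuron \<Rightarrow> ((nat \<Rightarrow> real) \<Rightarrow> real) set" where
  "fan_funs a c n (Petal i) = {\<lambda>p. - p 1, \<lambda>p. p 0 + a i * p 1, \<lambda>p. - p 0 - c i * p 1}"
| "fan_funs a c n (Piece i) = slab_funs n (\<lambda>p. p 0) (3/4) (3/4) i \<union> {\<lambda>p. p 1 + 1, \<lambda>p. - p 1 - 1}"
| "fan_funs a c n (Lpart i) = slab_funs n (\<lambda>p. p 0) (3/4) (5/12) i \<union> {\<lambda>p. p 1 + 1, \<lambda>p. - p 1 - 1}"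
| "fan_funs a c n (Rpart i) = slab_funs n (\<lambda>p. p 0) (5/12) (3/4) i \<union> {\<lambda>p. p 1 + 1, \<lambda>p. - p 1 - 1}"
| "fan_funs a c n _ = {\<lambda>p. p 1 + 1, \<lambda>p. - p 1 - 1}"

lemma fan_word:
  assumes p: "p \<in> topspace (Esp d)"
  shows "{\<nu> \<in> link_base m n. p \<in> polyhedron_of False d (fan_funs a c n \<nu>)} =
     (if p 1 = -1 then insert Link (chain_word False n (p 0)) else {})
     \<union> Petal ` {i. i < m \<and> p 1 \<le> 0 \<and> - a i * p 1 \<le> p 0 \<and> p 0 \<le> - c i * p 1}"
proof -
  have mem: "p \<in> polyhedron_of False d F \<longleftrightarrow> (\<forall>f\<in>F. rel False 0 (f p))" for F
    using p by (simp add: polyhedron_of_def)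
  have L: "(\<forall>f\<in>{\<lambda>p. p 1 + 1, \<lambda>p. - p 1 - 1}. rel False 0 (f p)) \<longleftrightarrow> p 1 = -1"
    by (auto simp: rel_def)
  have "p \<in> polyhedron_of False d (fan_funs a c n Link) \<longleftrightarrow> p 1 = -1"
    unfolding mem fan_funs.simps L by (rule refl)
  moreover have "p \<in> polyhedron_of False d (fan_funs a c n (Petal i)) \<longleftrightarrow> p 1 \<le> 0 \<and> - a i * p 1 \<le> p 0 \<and> p 0 \<le> - c i * p 1" for i
    unfolding mem fan_funs.simps by (auto simp: rel_def)
  moreover have "p \<in> polyhedron_of False d (fan_funs a c n (Piece i)) \<longleftrightarrow> in_slab False n (3/4) (3/4) i (p 0) \<and> p 1 = -1"
    "p \<in> polyhedron_of False d (fan_funs a c n (Lpart i)) \<longleftrightarrow> in_slab False n (3/4) (5/12) i (p 0) \<and> p 1 = -1"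
    "p \<in> polyhedron_of False d (fan_funs a c n (Rpart i)) \<longleftrightarrow> in_slab False n (5/12) (3/4) i (p 0) \<and> p 1 = -1" for i
    unfolding mem fan_funs.simps ball_Un slab_funs_iff L by (rule refl)+
  ultimately show ?thesis unfolding word_link_base by (auto simp: chain_word_def)
qed

lemma fan_realization:
  assumes d: "2 \<le> d" and ac: "\<And>i. i < m \<Longrightarrow> a i \<le> c i" "\<And>i j. i < j \<Longrightarrow> j < m \<Longrightarrow> c i < a j"
    and I: "\<And>w. w \<in> I \<Longrightarrow> w \<subseteq> base m n"
    and on_line: "\<And>t. chain_word False n t \<union> Petal ` {i. i < m \<and> a i \<le> t \<and> t \<le> c i} \<in> I"
    and line_attained: "\<And>w. w \<in> I \<Longrightarrow> \<exists>t. w = chain_word False n t \<union> Petal ` {i. i < m \<and> a i \<le> t \<and> t \<le> c i}"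
  shows "closed_realizable d (link_base m n) (link_code m n I)"
proof -
  define X where "X \<nu> = polyhedron_of False d (fan_funs a c n \<nu>)" for \<nu>
  have code: "code_of d (link_base m n) X = link_code m n I"
  proof (rule code_of_eqI)
    fix p assume p: "p \<in> topspace (Esp d)"
    note w = fan_word[OF p, of m n a c, folded X_def]
    show "{\<nu> \<in> link_base m n. p \<in> X \<nu>} \<in> link_code m n I"
    proof (cases "p 1 = -1")
      case True
      have "{\<nu> \<in> link_base m n. p \<in> X \<nu>} = insert Link (chain_word False n (p 0) \<union> Petal ` {i. i < m \<and> a i \<le> p 0 \<and> p 0 \<le> c i})"
        unfolding w using True by auto
      then show ?thesis using link_codeI(4)[OF on_line I[OF on_line]] by simp
    next
      case False
      define P where "P = {i. i < m \<and> p 1 \<le> 0 \<and> - a i * p 1 \<le> p 0 \<and> p 0 \<le> - c i * p 1}"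
      have word: "{\<nu> \<in> link_base m n. p \<in> X \<nu>} = Petal ` P" unfolding w P_def using False by simp
      consider "p 1 = 0" "p 0 = 0" | "p 1 = 0" "p 0 \<noteq> 0" | "p 1 > 0" | "p 1 < 0" by linarith
      then show ?thesis
      proof cases
        case 1
        then have "P = {..<m}" by (auto simp: P_def)
        then show ?thesis unfolding word using link_codeI(2) by (simp add: wall_def)
      next
        case 2
        then have "P = {}" by (auto simp: P_def)
        then show ?thesis unfolding word using link_codeI(1) by simp
      next
        case 3
        then have "P = {}" by (auto simp: P_def)
        then show ?thesis unfolding word using link_codeI(1) by simp
      next
        case 4
        have le: "\<not> (i \<in> P \<and> j \<in> P \<and> i < j)" for i j
        proof
          assume ij: "i \<in> P \<and> j \<in> P \<and> i < j"
          then have "- a j * p 1 \<le> - c i * p 1" by (auto simp: P_def)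
          then have "a j \<le> c i" using 4 by (simp add: mult_le_cancel_right)
          then show False using ac(2)[of i j] ij by (auto simp: P_def)
        qed
        have "P = {} \<or> (\<exists>i. P = {i})" using le by (metis is_singletonI' is_singleton_def linorder_neqE_nat)
        then show ?thesis
        proof (elim disjE exE)
          assume "P = {}"
          then show ?thesis unfolding word using link_codeI(1) by simp
        next
          fix i assume i: "P = {i}"
          then have "i < m" by (auto simp: P_def)
          then show ?thesis unfolding word i using link_codeI(3) by simp
        qed
      qed
    qed
  next
    fix \<sigma> assume \<sigma>: "\<sigma> \<in> link_code m n I"
    have "\<forall>w\<in>I. w \<subseteq> base m n" using I by blast
    from this \<sigma> show "\<exists>p\<in>topspace (Esp d). \<sigma> = {\<nu> \<in> link_base m n. p \<in> X \<nu>}"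
    proof (cases rule: link_codeE)
      case empty
      then show ?thesis using d fan_word[of "plane_point 0 1" d m n a c, folded X_def]
        by (intro bexI[of _ "plane_point 0 1"]) (auto simp: plane_point)
    next
      case wall
      then show ?thesis using d fan_word[of "plane_point 0 0" d m n a c, folded X_def]
        by (intro bexI[of _ "plane_point 0 0"]) (auto simp: plane_point wall_def)
    next
      case (petal i)
      have "j = i" if "j < m" "2 * a j \<le> 2 * a i" "2 * a i \<le> 2 * c j" for j
        using that petal(1) ac(1)[of i] ac(1)[of j] ac(2)[of i j] ac(2)[of j i]
        by (cases i j rule: linorder_cases) auto
      then have "{j. j < m \<and> 2 * a j \<le> 2 * a i \<and> 2 * a i \<le> 2 * c j} = {i}" using petal(1) ac(1)[of i] by auto
      then show ?thesis using petal(2) d fan_word[of "plane_point (2 * a i) (-2)" d m n a c, folded X_def]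
        by (intro bexI[of _ "plane_point (2 * a i) (-2)"]) (auto simp: plane_point mult.commute)
    next
      case (link w)
      obtain t where t: "w = chain_word False n t \<union> Petal ` {i. i < m \<and> a i \<le> t \<and> t \<le> c i}"
        using line_attained[OF link(1)] by blast
      show ?thesis using link(2) t d fan_word[of "plane_point t (-1)" d m n a c, folded X_def]
        by (intro bexI[of _ "plane_point t (-1)"]) (auto simp: plane_point)
    qed
  qed
  have aff: "affine_fun d f" if f: "f \<in> fan_funs a c n \<nu>" for f \<nu>
  proof -
    have c0: "affine_fun d (\<lambda>p. p 0)" "affine_fun d (\<lambda>p. p 1)" "affine_fun d (\<lambda>p. p (Suc 0))" using d by auto
    have S: "affine_fun d g" if "g \<in> slab_funs n (\<lambda>p. p 0) l u i" for g l u i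
      using that c0 unfolding slab_funs_def by (auto intro!: affine_fun_diff split: if_splits)
    have L: "affine_fun d g" if "g \<in> {\<lambda>p. p 1 + 1, \<lambda>p. - p 1 - 1}" for g
      using that c0 by (auto intro!: affine_fun_diff affine_fun_add affine_fun_minus)
    show ?thesis
    proof (cases \<nu>)
      case (Petal i)
      then show ?thesis using f c0 by (auto intro!: affine_fun_diff affine_fun_add affine_fun_minus affine_fun_cmul)
    next
      case (Piece i)
      have "f \<in> slab_funs n (\<lambda>p. p 0) (3/4) (3/4) i \<or> f \<in> {\<lambda>p. p 1 + 1, \<lambda>p. - p 1 - 1}" using f unfolding Piece fan_funs.simps Un_iff .
      then show ?thesis using S L by blast
    next
      case (Lpart i)
      have "f \<in> slab_funs n (\<lambda>p. p 0) (3/4) (5/12) i \<or> f \<in> {\<lambda>p. p 1 + 1, \<lambda>p. - p 1 - 1}" using f unfolding Lpart fan_funs.simps Un_iff .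
      then show ?thesis using S L by blast
    next
      case (Rpart i)
      have "f \<in> slab_funs n (\<lambda>p. p 0) (5/12) (3/4) i \<or> f \<in> {\<lambda>p. p 1 + 1, \<lambda>p. - p 1 - 1}" using f unfolding Rpart fan_funs.simps Un_iff .
      then show ?thesis using S L by blast
    qed (use f L in simp_all)
  qed
  have "closed_convex_realization d (link_base m n) (link_code m n I) X"
    unfolding closed_convex_realization_def
  proof (intro conjI ballI code)
    fix \<nu>
    show "closedin (Esp d) (X \<nu>)" unfolding X_def by (rule closedin_polyhedron_of) (rule aff)
    show "convex_fun (X \<nu>)" unfolding X_def by (rule convex_polyhedron_of) (rule aff)
  qed
  then show ?thesis by (rule exI[of _ X])
qed

lemma mem_if_singleton: "x \<in> (if P then {y} else {}) \<longleftrightarrow> x = y \<and> P"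
  by simp

lemma below_2: "{i. i < (2::nat) \<and> Q i} = (if Q 0 then {0} else {}) \<union> (if Q 1 then {1} else {})"
proof (rule set_eqI)
  fix x :: nat
  have "x < 2 \<and> Q x \<longleftrightarrow> x = 0 \<and> Q 0 \<or> x = 1 \<and> Q 1" by (auto simp: less_2_cases_iff)
  then show "x \<in> {i. i < 2 \<and> Q i} \<longleftrightarrow> x \<in> (if Q 0 then {0} else {}) \<union> (if Q 1 then {1} else {})"
    by (simp only: mem_Collect_eq Un_iff mem_if_singleton)
qed

lemma below_3: "{i. i < (3::nat) \<and> Q i}
    = (if Q 0 then {0} else {}) \<union> (if Q 1 then {1} else {}) \<union> (if Q 2 then {2} else {})"
proof (rule set_eqI)
  fix x :: nat
  have "x < 3 \<longleftrightarrow> x = 0 \<or> x = 1 \<or> x = 2" by linarith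
  then have "x < 3 \<and> Q x \<longleftrightarrow> x = 0 \<and> Q 0 \<or> x = 1 \<and> Q 1 \<or> x = 2 \<and> Q 2" by auto
  then show "x \<in> {i. i < 3 \<and> Q i} \<longleftrightarrow>
      x \<in> (if Q 0 then {0} else {}) \<union> (if Q 1 then {1} else {}) \<union> (if Q 2 then {2} else {})"
    by (simp only: mem_Collect_eq Un_iff mem_if_singleton disj_assoc)
qed

lemma no_nat_between:
  assumes "0 < r" "r < 1"
  shows "{j. j < n \<and> real j \<le> real i + r \<and> real i + r \<le> real j} = {}"
proof -
  have False if "real j \<le> real i + r" "real i + r \<le> real j" for j
  proof -
    have "real i < real j" "real j < real (Suc i)" using that assms by simp_all
    then have "i < j" "j < Suc i" by (simp_all only: of_nat_less_iff)
    then show False by simp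
  qed
  then show ?thesis by blast
qed

text \<open>The petals are rays, the \<open>i\<close>-th one crossing the line of the chain at \<open>t = i\<close>.\<close>

lemma private_fan_realization:
  assumes "n \<ge> 1" "d \<ge> 2"
  shows "closed_realizable d (link_base n n) (link_code n n (private_pieces n))"
proof (rule fan_realization[where a = real and c = real, OF assms(2)])
  fix t :: real
  show "chain_word False n t \<union> Petal ` {i. i < n \<and> real i \<le> t \<and> t \<le> real i} \<in> private_pieces n"
  proof (cases "\<exists>i<n. t = real i")
    case True
    then obtain i where i: "i < n" "t = real i" by blast
    then have "chain_word False n t = piece_word i" by (intro chain_word_single) auto
    moreover have "{j. j < n \<and> real j \<le> t \<and> t \<le> real j} = {i}" using i by auto
    ultimately show ?thesis using private_piecesI(2)[OF i(1)] by simp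
  next
    case False
    then have E: "{i. i < n \<and> real i \<le> t \<and> t \<le> real i} = {}" by force
    show ?thesis unfolding E using private_piecesI(1)[OF chain_word_in_chain_words[OF assms(1)]] by simp
  qed
next
  fix w assume "w \<in> private_pieces n"
  then show "\<exists>t. w = chain_word False n t \<union> Petal ` {i. i < n \<and> real i \<le> t \<and> t \<le> real i}"
  proof (cases rule: private_piecesE)
    case (petal i)
    have "chain_word False n (real i) = piece_word i" using petal by (intro chain_word_single) auto
    moreover have "{j. j < n \<and> real j \<le> real i \<and> real i \<le> real j} = {i}" using petal by auto
    ultimately show ?thesis using petal by (intro exI[of _ "real i"]) simp
  next
    case (piece i)
    have "chain_word False n (real i + 1/8) = piece_word i" using piece by (intro chain_word_single) auto
    moreover have "{j. j < n \<and> real j \<le> real i + 1/8 \<and> real i + 1/8 \<le> real j} = {}"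
      by (rule no_nat_between) auto
    ultimately show ?thesis unfolding piece by (intro exI[of _ "real i + 1/8"]) (simp only: image_empty Un_empty_right)
  next
    case (corner i)
    then obtain r where r: "1/4 < r" "r < 3/4" "chain_word False n (real i + r) = w"
      using corner_words_attained[of w i n] by metis
    moreover have "{j. j < n \<and> real j \<le> real i + r \<and> real i + r \<le> real j} = {}"
      using r by (intro no_nat_between) auto
    ultimately show ?thesis by (intro exI[of _ "real i + r"]) (simp only: image_empty Un_empty_right)
  qed
qed (use private_pieces_subset in auto)

text \<open>The outer petals are rays; the middle one is a cone that contains the overlap \<open>1/4 \<le> t \<le> 3/4\<close> of the
  two pieces.\<close>

lemma shared_corner_fan_realization:
  assumes "d \<ge> 2"
  shows "closed_realizable d (link_base 3 2) (link_code 3 2 shared_corner)"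
proof -
  define a :: "nat \<Rightarrow> real" where "a i = (if i = 0 then 0 else if i = 1 then 1/8 else 1)" for i
  define c :: "nat \<Rightarrow> real" where "c i = (if i = 0 then 0 else if i = 1 then 7/8 else 1)" for i
  have P: "{i. i < 3 \<and> a i \<le> t \<and> t \<le> c i} =
      (if t = 0 then {0} else {}) \<union> (if 1/8 \<le> t \<and> t \<le> 7/8 then {1} else {}) \<union> (if t = 1 then {2} else {})" for t
    unfolding below_3 by (auto simp: a_def c_def)
  have left: "chain_word False 2 t = piece_word 0" if "t < 1/4" for t
    using that by (intro chain_word_single) auto
  have right: "chain_word False 2 t = piece_word 1" if "t > 3/4" for t
    using that by (intro chain_word_single) auto
  have mid: "chain_word False 2 t \<in> corner_words 0" if t: "1/4 \<le> t" "t \<le> 3/4" for t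
  proof -
    have "chain_word False 2 t =
     (if rel False t (3/4) then {Piece 0, Rpart 0} else {}) \<union> (if rel False t (5/12) then {Lpart 0} else {})
     \<union> (if rel False (1/4) t then {Piece (Suc 0), Lpart (Suc 0)} else {}) \<union> (if rel False (7/12) t then {Rpart (Suc 0)} else {})"
      using t by (intro chain_word_corner) auto
    also have "\<dots> = corner_word 0 \<union> (if t \<le> 5/12 then {Lpart 0} else {}) \<union> (if 7/12 \<le> t then {Rpart (Suc 0)} else {})"
      using t by (auto simp: rel_def corner_word_def)
    also have "\<dots> \<in> corner_words 0" by (auto simp: corner_words_def)
    finally show ?thesis .
  qed
  show ?thesis
  proof (rule fan_realization[where a = a and c = c, OF assms])
    show "a i \<le> c i" if "i < 3" for i by (simp add: a_def c_def)
    show "c i < a j" if "i < j" "j < 3" for i j using that by (auto simp: a_def c_def)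
    fix t :: real
    consider "t < 0" | "t = 0" | "0 < t" "t < 1/8" | "1/8 \<le> t" "t < 1/4" | "1/4 \<le> t" "t \<le> 3/4" | "3/4 < t" "t \<le> 7/8"
      | "7/8 < t" "t \<noteq> 1" | "t = 1" by linarith
    then show "chain_word False 2 t \<union> Petal ` {i. i < 3 \<and> a i \<le> t \<and> t \<le> c i} \<in> shared_corner"
    proof cases
      case 5
      then show ?thesis unfolding P using mid[OF 5] by (auto simp: shared_corner_def)
    qed (unfold P, auto simp: left right shared_corner_def)
  next
    fix w assume w: "w \<in> shared_corner"
    have ex: "\<exists>t. w = chain_word False 2 t \<union> Petal ` {i. i < 3 \<and> a i \<le> t \<and> t \<le> c i}"
      if "w = chain_word False 2 t \<union> Petal ` ((if t = 0 then {0} else {}) \<union> (if 1/8 \<le> t \<and> t \<le> 7/8 then {1} else {}) \<union> (if t = 1 then {2} else {}))" for t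
      using that unfolding P by (rule exI)
    from w consider "w = piece_word 0" | "w = piece_word 1" | "w = insert (Petal 0) (piece_word 0)"
      | "w = insert (Petal 2) (piece_word 1)" | "w = insert (Petal 1) (piece_word 0)" | "w = insert (Petal 1) (piece_word 1)"
      | w' where "w' \<in> corner_words 0" "w = insert (Petal 1) w'"
      unfolding shared_corner_def by auto
    then show "\<exists>t. w = chain_word False 2 t \<union> Petal ` {i. i < 3 \<and> a i \<le> t \<and> t \<le> c i}"
    proof cases
      case 1 then show ?thesis by (intro ex[of "-1"]) (simp add: left)
    next
      case 2 then show ?thesis by (intro ex[of 2]) (simp add: right)
    next
      case 3 then show ?thesis by (intro ex[of 0]) (simp add: left)
    next
      case 4 then show ?thesis by (intro ex[of 1]) (simp add: right)
    next
      case 5 then show ?thesis by (intro ex[of "1/8"]) (simp add: left)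
    next
      case 6 then show ?thesis by (intro ex[of "7/8"]) (simp add: right)
    next
      case (7 w')
      have s: "Suc 0 < 2" by simp
      obtain r where r: "1/4 < r" "r < 3/4" "\<And>b. chain_word b 2 (real 0 + r) = w'"
        using corner_words_attained[OF 7(1) s] by metis
      then show ?thesis using 7 r(3)[of False] by (intro ex[of r]) simp
    qed
  qed (use shared_corner_subset in auto)
qed

subsection \<open>Open sets: a chain around a convex obstacle\<close>

text \<open>Petal \<open>i\<close> is cut out by all of the inequalities \<^term>\<open>0 < P j\<close> but the \<open>i\<close>-th, and piece \<open>i\<close> is the
  open half plane \<^term>\<open>H i < 0\<close>.  The pieces go round the convex region on which no \<open>H i\<close> is negative, and
  their union bends at its corners.  There two of the \<open>H i\<close> vanish, so that a corner belongs to no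
  piece; with closed half planes it would belong to two of them.  The functions in \<open>A\<close> bound the ambient
  set, and the sign of \<open>D i\<close> separates \<open>Lpart i\<close> from \<open>Rpart (i + 1)\<close>.\<close>

fun bend_funs ::
  "((nat \<Rightarrow> real) \<Rightarrow> real) set \<Rightarrow> ((nat \<Rightarrow> real) \<Rightarrow> real) \<Rightarrow> (nat \<Rightarrow> (nat \<Rightarrow> real) \<Rightarrow> real) \<Rightarrow> (nat \<Rightarrow> (nat \<Rightarrow> real) \<Rightarrow> real)
   \<Rightarrow> (nat \<Rightarrow> (nat \<Rightarrow> real) \<Rightarrow> real) \<Rightarrow> nat \<Rightarrow> nat \<Rightarrow> neuron \<Rightarrow> ((nat \<Rightarrow> real) \<Rightarrow> real) set" where
  "bend_funs A \<phi> P H D m n Low = insert (\<lambda>p. 1 - \<phi> p) A"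
| "bend_funs A \<phi> P H D m n High = insert (\<lambda>p. \<phi> p - 1) A"
| "bend_funs A \<phi> P H D m n (Petal i) = P ` ({..<m} - {i}) \<union> A"
| "bend_funs A \<phi> P H D m n (Piece i) = insert (\<lambda>p. 0 - H i p) A"
| "bend_funs A \<phi> P H D m n (Lpart i) = insert (\<lambda>p. 0 - H i p) ((if Suc i = n then {} else {D i}) \<union> A)"
| "bend_funs A \<phi> P H D m n (Rpart i) = insert (\<lambda>p. 0 - H i p) ((if i = 0 then {} else {\<lambda>p. 0 - D (i - 1) p}) \<union> A)"
| "bend_funs A \<phi> P H D m n _ = A"

definition bend_chain :: "(nat \<Rightarrow> 'p \<Rightarrow> real) \<Rightarrow> (nat \<Rightarrow> 'p \<Rightarrow> real) \<Rightarrow> nat \<Rightarrow> 'p \<Rightarrow> neuron set" where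
  "bend_chain H D n p = Piece ` {i. i < n \<and> H i p < 0}
     \<union> Lpart ` {i. i < n \<and> H i p < 0 \<and> (Suc i = n \<or> 0 < D i p)}
     \<union> Rpart ` {i. i < n \<and> H i p < 0 \<and> (i = 0 \<or> D (i - 1) p < 0)}"

definition bend_word where
  "bend_word \<phi> P H D m n p = {Ambient} \<union> (if \<phi> p < 1 then {Low} else {}) \<union> (if 1 < \<phi> p then {High} else {})
     \<union> Petal ` {i. i < m \<and> (\<forall>j<m. j \<noteq> i \<longrightarrow> 0 < P j p)} \<union> bend_chain H D n p"

lemma bend_word_eq:
  assumes p: "p \<in> topspace (Esp d)"
  shows "{\<nu> \<in> split_base m n. p \<in> polyhedron_of True d (bend_funs A \<phi> P H D m n \<nu>)} =
    (if \<forall>f\<in>A. 0 < f p then bend_word \<phi> P H D m n p else {})"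
proof -
  have mem: "p \<in> polyhedron_of True d F \<longleftrightarrow> (\<forall>f\<in>F. 0 < f p)" for F
    using p by (simp add: polyhedron_of_def rel_def)
  show ?thesis
  proof (cases "\<forall>f\<in>A. 0 < f p")
    case False
    have "A \<subseteq> bend_funs A \<phi> P H D m n \<nu>" for \<nu> by (cases \<nu>) auto
    then have "p \<notin> polyhedron_of True d (bend_funs A \<phi> P H D m n \<nu>)" for \<nu> using False unfolding mem by blast
    then show ?thesis unfolding if_not_P[OF False] by simp
  next
    case True
    have "p \<in> polyhedron_of True d (bend_funs A \<phi> P H D m n Ambient)"
      "p \<in> polyhedron_of True d (bend_funs A \<phi> P H D m n Low) \<longleftrightarrow> \<phi> p < 1"
      "p \<in> polyhedron_of True d (bend_funs A \<phi> P H D m n High) \<longleftrightarrow> 1 < \<phi> p"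
      using True unfolding mem by simp_all
    moreover have "p \<in> polyhedron_of True d (bend_funs A \<phi> P H D m n (Petal i)) \<longleftrightarrow> (\<forall>j<m. j \<noteq> i \<longrightarrow> 0 < P j p)" for i
      using True unfolding mem bend_funs.simps ball_Un by auto
    moreover have "p \<in> polyhedron_of True d (bend_funs A \<phi> P H D m n (Piece i)) \<longleftrightarrow> H i p < 0"
      "p \<in> polyhedron_of True d (bend_funs A \<phi> P H D m n (Lpart i)) \<longleftrightarrow> H i p < 0 \<and> (Suc i = n \<or> 0 < D i p)"
      "p \<in> polyhedron_of True d (bend_funs A \<phi> P H D m n (Rpart i)) \<longleftrightarrow> H i p < 0 \<and> (i = 0 \<or> D (i - 1) p < 0)" for i
      using True unfolding mem by auto
    ultimately show ?thesis using True unfolding word_split_base bend_word_def bend_chain_def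
      by (simp only: if_True) (simp add: Un_assoc)
  qed
qed

lemma bend_realization:
  assumes fin: "finite A" and aff: "\<And>f. f \<in> A \<Longrightarrow> affine_fun d f" "affine_fun d \<phi>"
      "\<And>i. affine_fun d (P i)" "\<And>i. affine_fun d (H i)" "\<And>i. affine_fun d (D i)"
    and I: "\<And>w. w \<in> I \<Longrightarrow> w \<subseteq> base m n"
    and outside: "\<exists>p\<in>topspace (Esp d). \<exists>f\<in>A. f p \<le> 0"
    and word: "\<And>p. p \<in> topspace (Esp d) \<Longrightarrow> \<forall>f\<in>A. 0 < f p \<Longrightarrow> bend_word \<phi> P H D m n p \<in> split_code m n I"
    and attained: "\<And>\<sigma>. \<sigma> \<in> split_code m n I \<Longrightarrow> \<sigma> \<noteq> {} \<Longrightarrow>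
       \<exists>p\<in>topspace (Esp d). (\<forall>f\<in>A. 0 < f p) \<and> bend_word \<phi> P H D m n p = \<sigma>"
  shows "open_realizable d (split_base m n) (split_code m n I)"
proof -
  define U where "U \<nu> = polyhedron_of True d (bend_funs A \<phi> P H D m n \<nu>)" for \<nu>
  have code: "code_of d (split_base m n) U = split_code m n I"
  proof (rule code_of_eqI)
    fix p assume p: "p \<in> topspace (Esp d)"
    show "{\<nu> \<in> split_base m n. p \<in> U \<nu>} \<in> split_code m n I"
      unfolding U_def bend_word_eq[OF p] using word[OF p] split_codeI(1) by simp
  next
    fix \<sigma> assume s: "\<sigma> \<in> split_code m n I"
    show "\<exists>p\<in>topspace (Esp d). \<sigma> = {\<nu> \<in> split_base m n. p \<in> U \<nu>}"
    proof (cases "\<sigma> = {}")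
      case True
      obtain p f where p: "p \<in> topspace (Esp d)" "f \<in> A" "f p \<le> 0" using outside by blast
      then have no: "\<not> (\<forall>f\<in>A. 0 < f p)" by force
      have "\<sigma> = {\<nu> \<in> split_base m n. p \<in> U \<nu>}"
        unfolding U_def bend_word_eq[OF p(1)] if_not_P[OF no] by (rule True)
      with p(1) show ?thesis by blast
    next
      case False
      obtain p where p: "p \<in> topspace (Esp d)" "\<forall>f\<in>A. 0 < f p" "bend_word \<phi> P H D m n p = \<sigma>"
        using attained[OF s False] by blast
      have "\<sigma> = {\<nu> \<in> split_base m n. p \<in> U \<nu>}"
        unfolding U_def bend_word_eq[OF p(1)] if_P[OF p(2)] by (rule p(3)[symmetric])
      with p(1) show ?thesis by blast
    qed
  qed
  have F: "finite (bend_funs A \<phi> P H D m n \<nu>)" for \<nu> using fin by (cases \<nu>) auto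
  have aff': "affine_fun d f" if "f \<in> bend_funs A \<phi> P H D m n \<nu>" for f \<nu>
    using that aff by (cases \<nu>) (auto intro!: affine_fun_diff split: if_splits)
  have "open_convex_realization d (split_base m n) (split_code m n I) U"
    unfolding open_convex_realization_def
  proof (intro conjI ballI code)
    fix \<nu>
    show "openin (Esp d) (U \<nu>)" unfolding U_def by (rule openin_polyhedron_of[OF F]) (rule aff')
    show "convex_fun (U \<nu>)" unfolding U_def by (rule convex_polyhedron_of) (rule aff')
  qed
  then show ?thesis by (rule exI[of _ U])
qed

text \<open>The lines \<open>y = 2 i x - i\<^sup>2\<close> touch the parabola \<open>y = x\<^sup>2\<close> at \<open>x = i\<close>; below the parabola, at
  \<open>y = x\<^sup>2 + w\<close>, the value \<open>(x - i)\<^sup>2 + w\<close> is negative for the indices \<open>i\<close> close to \<open>x\<close> only.\<close>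

definition tangent :: "nat \<Rightarrow> (nat \<Rightarrow> real) \<Rightarrow> real" where
  "tangent i p = p 1 - 2 * real i * p 0 + (real i)\<^sup>2"

lemma tangent_square: "tangent i p = (p 0 - real i)\<^sup>2 + (p 1 - (p 0)\<^sup>2)"
  by (simp add: tangent_def power2_eq_square algebra_simps)

text \<open>The value \<^term>\<open>tangent j p\<close> is a quadratic polynomial in \<open>j\<close> with leading coefficient 1.  If it is
  negative at two indices that are not neighbours, it is below \<open>-1\<close> in between.\<close>

lemma tangent_negative_adjacent:
  assumes "i < k" "k < n" "tangent i p < 0" "tangent k p < 0" and above: "\<And>j. j < n \<Longrightarrow> -1 < tangent j p"
  shows "k = Suc i"
proof (rule ccontr)
  assume "k \<noteq> Suc i"
  then have ik: "Suc i < k" using assms(1) by simp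
  define x where "x = p 0 - real i"
  define w where "w = p 1 - (p 0)\<^sup>2"
  define l where "l = real k - real i"
  have l: "l \<ge> 2" using ik by (simp add: l_def)
  have "tangent i p = x\<^sup>2 + w" "tangent (Suc i) p = (x - 1)\<^sup>2 + w" "tangent k p = (x - l)\<^sup>2 + w"
    by (simp_all add: tangent_square x_def w_def l_def algebra_simps)
  then have neg: "x\<^sup>2 + w < 0" "(x - l)\<^sup>2 + w < 0" and ab: "-1 < (x - 1)\<^sup>2 + w"
    using assms above[of "Suc i"] ik by auto
  have "l * ((x - 1)\<^sup>2 + w) = (l - 1) * (x\<^sup>2 + w) + ((x - l)\<^sup>2 + w) - l * (l - 1)"
    by (simp add: power2_eq_square algebra_simps)
  also have "\<dots> < - (l * (l - 1))"
  proof -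
    have "(l - 1) * (x\<^sup>2 + w) < 0" using l neg by (intro mult_pos_neg) auto
    then show ?thesis using neg by linarith
  qed
  also have "\<dots> \<le> - l" using l by (simp add: algebra_simps)
  finally have "l * ((x - 1)\<^sup>2 + w) < l * (-1)" by simp
  moreover have "l * (-1) < l * ((x - 1)\<^sup>2 + w)" using ab l by (intro mult_strict_left_mono) auto
  ultimately show False by simp
qed

text \<open>The tangents bound both the petals and the pieces, so that the centre is the region above all of
  them and piece \<open>i\<close> the part of the ambient set beyond the \<open>i\<close>-th.  The bound \<open>c * p 1 - 1 < tangent i p\<close>
  lifts the ambient set into the centre from \<open>c * p 1 = 1\<close> on, where \<open>Low\<close> and \<open>High\<close> are separated; with
  \<open>c = 1 / (4 n\<^sup>2)\<close> it still permits all values of \<open>tangent i p\<close> above \<open>-3/4\<close> at heights up to \<open>n\<^sup>2\<close>, where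
  the pieces are needed.\<close>

lemma private_bend_realization:
  assumes n: "n \<ge> 2" and d: "d \<ge> 2"
  shows "open_realizable d (split_base n n) (split_code n n (private_pieces n))"
proof -
  define c where "c = 1 / (4 * (real n)\<^sup>2)"
  have n2: "real n \<ge> 2" using n by simp
  have c0: "c > 0" and cn: "c * (real n)\<^sup>2 = 1/4" using n2 by (auto simp: c_def)
  define A where "A = (\<lambda>i p. tangent i p + 1) ` {..<n} \<union> (\<lambda>i p. tangent i p - (c * p 1 - 1)) ` {..<n}"
  define \<phi> where "\<phi> = (\<lambda>p :: nat \<Rightarrow> real. c * p 1)"
  define D where "D i p = tangent (Suc i) p - tangent i p" for i p
  have inA: "(\<forall>f\<in>A. 0 < f p) \<longleftrightarrow> (\<forall>i<n. -1 < tangent i p \<and> c * p 1 - 1 < tangent i p)" for p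
  proof -
    have "0 < tangent i p + 1 \<longleftrightarrow> -1 < tangent i p" for i by linarith
    then show ?thesis unfolding A_def by (auto simp: ball_Un)
  qed
  have tan_aff: "affine_fun d (tangent i)" for i
    unfolding tangent_def[abs_def] using d by (intro affine_fun_add affine_fun_diff affine_fun_cmul) auto
  have phi_aff: "affine_fun d (\<lambda>p. c * p 1)" using d by (intro affine_fun_cmul) auto
  define ch where "ch p = bend_chain tangent D n p" for p
  define W where "W p = {i. i < n \<and> (\<forall>j<n. j \<noteq> i \<longrightarrow> 0 < tangent j p)}" for p
  have bw: "bend_word \<phi> tangent tangent D n n p = {Ambient} \<union> (if c * p 1 < 1 then {Low} else {})
     \<union> (if 1 < c * p 1 then {High} else {}) \<union> Petal ` W p \<union> ch p" for p
    by (simp add: bend_word_def \<phi>_def W_def ch_def)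
  have ch0: "ch p = {}" if "\<forall>i<n. \<not> tangent i p < 0" for p
    using that by (auto simp: ch_def bend_chain_def)
  have ch1: "ch p = piece_word i" if i: "i < n" "tangent i p < 0" "\<forall>j<n. j \<noteq> i \<longrightarrow> \<not> tangent j p < 0" for p i
  proof -
    have "Suc i = n \<or> \<not> tangent (Suc i) p < 0" using i by (cases "Suc i = n") auto
    then have L: "Suc i = n \<or> 0 < D i p" using i(2) by (auto simp: D_def)
    have "i = 0 \<or> \<not> tangent (i - 1) p < 0" using i by (cases i) auto
    then have R: "i = 0 \<or> D (i - 1) p < 0" using i(2) by (cases i) (auto simp: D_def)
    have one: "{j. j < n \<and> tangent j p < 0 \<and> R j} = {i}" if "R i" for R
      using i that by auto
    show ?thesis using one[of "\<lambda>_. True"] one[of "\<lambda>i. Suc i = n \<or> 0 < D i p", OF L] one[of "\<lambda>i. i = 0 \<or> D (i - 1) p < 0", OF R]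
      by (auto simp: ch_def bend_chain_def piece_word_def)
  qed
  have ch2: "ch p = corner_word i \<union> (if tangent i p < tangent (Suc i) p then {Lpart i} else {})
      \<union> (if tangent (Suc i) p < tangent i p then {Rpart (Suc i)} else {})"
    if i: "Suc i < n" "tangent i p < 0" "tangent (Suc i) p < 0"
      "\<forall>j<n. j \<noteq> i \<longrightarrow> j \<noteq> Suc i \<longrightarrow> \<not> tangent j p < 0" for p i
  proof -
    have "Suc (Suc i) = n \<or> \<not> tangent (Suc (Suc i)) p < 0" using i by (cases "Suc (Suc i) = n") auto
    then have L: "Suc (Suc i) = n \<or> 0 < D (Suc i) p" using i(3) by (auto simp: D_def)
    have "i = 0 \<or> \<not> tangent (i - 1) p < 0" using i by (cases i) auto
    then have R: "i = 0 \<or> D (i - 1) p < 0" using i(2) by (cases i) (auto simp: D_def)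
    have two: "{j. j < n \<and> tangent j p < 0 \<and> R j} = {j \<in> {i, Suc i}. R j}" for R
      using i by auto
    have two0: "{j. j < n \<and> tangent j p < 0} = {i, Suc i}" using i by auto
    have S: "{j \<in> {i, Suc i}. Q j} = (if Q i then {i} else {}) \<union> (if Q (Suc i) then {Suc i} else {})" for Q
      by auto
    have ni: "Suc i \<noteq> n" "Suc i \<noteq> 0" "Suc i - 1 = i" using i(1) by simp_all
    have ch: "ch p = Piece ` {i, Suc i} \<union> Lpart ` ((if 0 < D i p then {i} else {}) \<union> {Suc i})
        \<union> Rpart ` ({i} \<union> (if D i p < 0 then {Suc i} else {}))"
      unfolding ch_def bend_chain_def two two0 S using L R ni by simp
    have "tangent i p < tangent (Suc i) p \<longleftrightarrow> 0 < D i p" "tangent (Suc i) p < tangent i p \<longleftrightarrow> D i p < 0"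
      by (auto simp: D_def)
    then show ?thesis unfolding ch by (auto simp: corner_word_def split: if_splits)
  qed
  show ?thesis
  proof (rule bend_realization[where A = A and \<phi> = \<phi> and P = tangent and H = tangent and D = D])
    show "finite A" by (simp add: A_def)
    show "affine_fun d f" if "f \<in> A" for f
      using that tan_aff phi_aff unfolding A_def by (auto intro!: affine_fun_add affine_fun_diff)
    show "affine_fun d \<phi>" using phi_aff by (simp add: \<phi>_def)
    show "affine_fun d (tangent i)" "affine_fun d (tangent i)" for i by (rule tan_aff)+
    show "affine_fun d (D i)" for i unfolding D_def[abs_def] by (intro affine_fun_diff tan_aff)
    show "w \<subseteq> base n n" if "w \<in> private_pieces n" for w using that by (rule private_pieces_subset)
    show "\<exists>p\<in>topspace (Esp d). \<exists>f\<in>A. f p \<le> 0"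
    proof -
      have "(\<lambda>p. tangent 0 p + 1) \<in> A" using n by (auto simp: A_def)
      moreover have "plane_point 0 (-1) \<in> topspace (Esp d)" using d by (rule plane_point)
      moreover have "tangent 0 (plane_point 0 (-1)) + 1 \<le> 0" by (simp add: tangent_def plane_point)
      ultimately show ?thesis by (intro bexI[of _ "plane_point 0 (-1)"] bexI[of _ "\<lambda>p. tangent 0 p + 1"])
    qed
  next
    fix p assume "p \<in> topspace (Esp d)" "\<forall>f\<in>A. 0 < f p"
    then have amb: "-1 < tangent i p" "c * p 1 - 1 < tangent i p" if "i < n" for i using that unfolding inA by auto
    have low: "c * p 1 < 1" if "i < n" "\<not> 0 < tangent i p" for i using amb(2)[OF that(1)] that(2) by linarith
    show "bend_word \<phi> tangent tangent D n n p \<in> split_code n n (private_pieces n)"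
    proof (cases "\<exists>i<n. tangent i p < 0")
      case False
      then have c: "ch p = {}" by (intro ch0) auto
      show ?thesis
      proof (cases rule: petals_trichotomy[of n "\<lambda>j. 0 < tangent j p"])
        case all
        have "bend_word \<phi> tangent tangent D n n p = {Ambient} \<union> (if c * p 1 < 1 then {Low} else {})
          \<union> (if 1 < c * p 1 then {High} else {}) \<union> wall n"
          unfolding bw c W_def all(2) wall_def by simp
        then show ?thesis using split_codeI(2-4)[of n n "private_pieces n"]
          by (cases "c * p 1" "1 :: real" rule: linorder_cases) (auto simp: insert_commute)
      next
        case (one i)
        then have "bend_word \<phi> tangent tangent D n n p = {Ambient, Low, Petal i}"
          unfolding bw c W_def using low[OF one(1,2)] by auto
        then show ?thesis using split_codeI(6)[OF one(1)] by simp
      next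
        case none
        then have "c * p 1 < 1" using low by blast
        then have "bend_word \<phi> tangent tangent D n n p = {Ambient, Low}" unfolding bw c W_def none(2) by auto
        then show ?thesis using split_codeI(5) by simp
      qed
    next
      case True
      define i where "i = (LEAST i. i < n \<and> tangent i p < 0)"
      have i: "i < n" "tangent i p < 0" using LeastI_ex[OF True[unfolded]] by (auto simp: i_def)
      have imin: "i \<le> k" if "k < n" "tangent k p < 0" for k unfolding i_def using that by (intro Least_le) auto
      have other: "k = i \<or> k = Suc i" if "k < n" "tangent k p < 0" for k
        using imin[OF that] tangent_negative_adjacent[of i k n p] that i amb(1) by (cases "k = i") auto
      have lo: "c * p 1 < 1" using low[OF i(1)] i(2) by simp
      have Wi: "W p \<subseteq> {i}"
      proof
        fix j assume "j \<in> W p"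
        then show "j \<in> {i}" using i by (cases "j = i") (auto simp: W_def)
      qed
      have eq: "bend_word \<phi> tangent tangent D n n p = {Ambient, Low} \<union> (Petal ` W p \<union> ch p)"
        unfolding bw using lo by auto
      have "Petal ` W p \<union> ch p \<in> private_pieces n"
      proof (cases "Suc i < n \<and> tangent (Suc i) p < 0")
        case True
        have W0: "W p = {}"
        proof -
          have "i \<notin> W p" using True by (auto simp: W_def)
          then show ?thesis using Wi by blast
        qed
        have "ch p = corner_word i \<union> (if tangent i p < tangent (Suc i) p then {Lpart i} else {})
          \<union> (if tangent (Suc i) p < tangent i p then {Rpart (Suc i)} else {})"
          using True i other by (intro ch2) auto
        then have "ch p \<in> corner_words i" by (auto simp: corner_words_def)
        then have "ch p \<in> chain_words n" using True by (auto simp: chain_words_def)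
        then show ?thesis unfolding W0 using private_piecesI(1) by simp
      next
        case False
        have ch: "ch p = piece_word i"
        proof (rule ch1[OF i])
          show "\<forall>j<n. j \<noteq> i \<longrightarrow> \<not> tangent j p < 0" 
          proof (intro allI impI)
            fix j assume "j < n" "j \<noteq> i"
            then show "\<not> tangent j p < 0" using other[of j] False by auto
          qed
        qed
        have "W p = {} \<or> W p = {i}" using Wi by blast
        then show ?thesis
        proof
          assume W: "W p = {}"
          have "piece_word i \<in> chain_words n" using i(1) by (simp add: chain_words_def)
          then show ?thesis unfolding W ch using private_piecesI(1) by simp
        next
          assume W: "W p = {i}"
          then show ?thesis unfolding W ch using private_piecesI(2)[OF i(1)] by simp
        qed
      qed
      then show ?thesis unfolding eq using private_pieces_subset by (intro split_codeI(7))
    qed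
  next
    fix \<sigma> assume s: "\<sigma> \<in> split_code n n (private_pieces n)" "\<sigma> \<noteq> {}"
    have goal: "\<exists>p\<in>topspace (Esp d). (\<forall>f\<in>A. 0 < f p) \<and> bend_word \<phi> tangent tangent D n n p = \<sigma>"
      if "\<forall>i<n. -1 < tangent i (plane_point x y) \<and> c * y - 1 < tangent i (plane_point x y)"
        "bend_word \<phi> tangent tangent D n n (plane_point x y) = \<sigma>" for x y
      using that d by (intro bexI[of _ "plane_point x y"] conjI) (simp_all add: inA plane_point)
    have tp: "tangent i (plane_point x y) = (x - real i)\<^sup>2 + (y - x\<^sup>2)" for i x y
      by (simp add: tangent_square plane_point)
    note bwp = bw[of "plane_point x y" for x y, unfolded plane_point]
    have sq1: "1 \<le> (real j - real i)\<^sup>2" if "j \<noteq> i" for i j :: nat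
    proof -
      have "1 \<le> \<bar>real j - real i\<bar>" using that by linarith
      then show ?thesis by (metis one_le_power power2_abs)
    qed
    have small: "c * y - 1 < - 3/4 + 1/100" if "y \<le> (real n)\<^sup>2" for y
    proof -
      have "c * y \<le> c * (real n)\<^sup>2" using c0 that by (intro mult_left_mono) auto
      then show ?thesis using cn by simp
    qed
    have "1 \<le> (real n)\<^sup>2" using n2 by (intro one_le_power) simp
    from small[OF this] have c1: "c < 1" by simp
    have "\<forall>w\<in>private_pieces n. w \<subseteq> base n n" using private_pieces_subset by blast
    from this s(1) show "\<exists>p\<in>topspace (Esp d). (\<forall>f\<in>A. 0 < f p) \<and> bend_word \<phi> tangent tangent D n n p = \<sigma>"
    proof (cases rule: split_codeE)
      case empty
      then show ?thesis using s(2) by simp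
    next
      case wall
      have y: "c * (1 / c) = 1" "1 / c > 0" using c0 by auto
      have t: "0 < tangent i (plane_point 0 (1 / c))" for i unfolding tp using y by (simp add: add_nonneg_pos)
      have "W (plane_point 0 (1 / c)) = {..<n}" using t by (auto simp: W_def)
      moreover have "ch (plane_point 0 (1 / c)) = {}" using t by (intro ch0) (simp add: not_less less_imp_le)
      ultimately show ?thesis using t y wall
        by (intro goal[of 0 "1 / c"]) (auto simp: bwp wall_def intro: less_trans[of _ 0])
    next
      case low
      have y: "c * 1 < 1" using c1 by simp
      have t: "0 < tangent i (plane_point 0 1)" for i unfolding tp by (simp add: add_nonneg_pos)
      have "W (plane_point 0 1) = {..<n}" using t by (auto simp: W_def)
      moreover have "ch (plane_point 0 1) = {}" using t by (intro ch0) (simp add: not_less less_imp_le)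
      ultimately show ?thesis using t y low
        by (intro goal[of 0 1]) (auto simp: bwp wall_def intro: less_trans[of _ 0])
    next
      case high
      have y: "c * (2 / c) = 2" "2 / c > 0" using c0 by auto
      have "2 / c > 1" using c0 c1 by (simp add: field_simps)
      then have t: "1 < tangent i (plane_point 0 (2 / c))" for i
        unfolding tp using zero_le_power2[of "0 - real i"] by (simp only: power_zero_numeral diff_zero)
      have t0: "0 < tangent i (plane_point 0 (2 / c))" for i using t[of i] by linarith
      have "W (plane_point 0 (2 / c)) = {..<n}" using t0 by (auto simp: W_def)
      moreover have "ch (plane_point 0 (2 / c)) = {}" using t0 by (intro ch0) (simp add: not_less less_imp_le)
      ultimately show ?thesis using t t0 y high
        by (intro goal[of 0 "2 / c"]) (auto simp: bwp wall_def intro: less_trans[of _ 0])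
    next
      case ambient
      have t: "tangent i (plane_point (1/2) 0) = real i * (real i - 1)" for i
        unfolding tp by (simp add: power2_eq_square algebra_simps)
      have t0: "0 \<le> real i * (real i - 1)" for i by (cases i) auto
      have "W (plane_point (1/2) 0) = {}"
      proof -
        have "\<not> 0 < tangent 0 (plane_point (1/2) 0)" "\<not> 0 < tangent 1 (plane_point (1/2) 0)" unfolding t by simp_all
        moreover have "\<exists>j<n. j \<noteq> i \<and> (j = 0 \<or> j = 1)" for i
          using n by (cases "i = 0") (auto intro: exI[of _ 1] exI[of _ 0])
        ultimately show ?thesis unfolding W_def by blast
      qed
      moreover have "ch (plane_point (1/2) 0) = {}" using t t0 by (intro ch0) (simp add: not_less)
      ultimately show ?thesis using ambient t t0
        by (intro goal[of "1/2" 0]) (auto simp: bwp intro: less_le_trans[OF _ t0])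
    next
      case (petal i)
      have t: "tangent j (plane_point (real i) ((real i)\<^sup>2)) = (real i - real j)\<^sup>2" for j unfolding tp by simp
      have yn: "(real i)\<^sup>2 \<le> (real n)\<^sup>2" using petal by (intro power_mono) auto
      have "W (plane_point (real i) ((real i)\<^sup>2)) = {i}" using petal by (auto simp: W_def t)
      moreover have "ch (plane_point (real i) ((real i)\<^sup>2)) = {}" by (intro ch0) (simp add: t)
      ultimately show ?thesis using petal small[OF yn]
        by (intro goal[of "real i" "(real i)\<^sup>2"]) (auto simp: bwp t intro: less_le_trans[OF _ zero_le_power2])
    next
      case (link w)
      from link(1) show ?thesis
      proof (cases rule: private_piecesE)
        case (petal i)
        define y where "y = (real i)\<^sup>2 - 1/4"
        have t: "tangent j (plane_point (real i) y) = (real i - real j)\<^sup>2 - 1/4" for j unfolding tp y_def by simp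
        have yn: "y \<le> (real n)\<^sup>2" 
        proof -
          have "(real i)\<^sup>2 \<le> (real n)\<^sup>2" using petal(1) by (intro power_mono) auto
          then show ?thesis unfolding y_def by linarith
        qed
        have ti: "tangent i (plane_point (real i) y) = - 1/4" unfolding t by simp
        have tj: "3/4 \<le> tangent j (plane_point (real i) y)" if "j \<noteq> i" for j unfolding t using sq1[of i j] that by simp
        have W: "W (plane_point (real i) y) = {i}"
        proof -
          have "j = i" if "j \<in> W (plane_point (real i) y)" for j
            using that ti petal(1) by (cases "j = i") (auto simp: W_def)
          moreover have "i \<in> W (plane_point (real i) y)"
          proof -
            have "0 < tangent j (plane_point (real i) y)" if "j \<noteq> i" for j using tj[OF that] by linarith
            then show ?thesis using petal(1) by (simp add: W_def)
          qed
          ultimately show ?thesis by blast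
        qed
        have C: "ch (plane_point (real i) y) = piece_word i" 
        proof (rule ch1)
          show "\<forall>j<n. j \<noteq> i \<longrightarrow> \<not> tangent j (plane_point (real i) y) < 0"
          proof (intro allI impI)
            fix j assume "j \<noteq> i"
            then show "\<not> tangent j (plane_point (real i) y) < 0" using tj[of j] by linarith
          qed
        qed (use petal ti in auto)
        have all: "- 1/4 \<le> tangent j (plane_point (real i) y)" for j using ti tj[of j] by (cases "j = i") auto
        show ?thesis
        proof (rule goal[of "real i" y])
          show "\<forall>j<n. -1 < tangent j (plane_point (real i) y) \<and> c * y - 1 < tangent j (plane_point (real i) y)"
          proof (intro allI impI)
            fix j show "-1 < tangent j (plane_point (real i) y) \<and> c * y - 1 < tangent j (plane_point (real i) y)"
              using all[of j] small[OF yn] by linarith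
          qed
          show "bend_word \<phi> tangent tangent D n n (plane_point (real i) y) = \<sigma>"
            unfolding bwp W C link(2) petal(2) using small[OF yn] by auto
        qed
      next
        case (piece i)
        define u :: real where "u = (if i = 0 then 1/4 else - 1/4)"
        define k where "k = (if i = 0 then 1 else i - 1)"
        define x where "x = real i + u"
        define y where "y = x\<^sup>2 - 9/16"
        have t: "tangent j (plane_point x y) = (real i + u - real j)\<^sup>2 - 9/16" for j unfolding tp y_def x_def by simp
        have k: "k < n" "k \<noteq> i" using piece n by (auto simp: k_def)
        have ti: "tangent i (plane_point x y) = - 1/2" unfolding t u_def by (simp add: power2_eq_square)
        have tk: "tangent k (plane_point x y) = 0" unfolding t u_def k_def by (cases i) (simp_all add: power2_eq_square)
        have tj: "0 \<le> tangent j (plane_point x y)" if "j \<noteq> i" for j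
        proof -
          have "1 \<le> \<bar>real i - real j\<bar>" using that by linarith
          moreover have "\<bar>u\<bar> = 1/4" by (simp add: u_def)
          ultimately have "3/4 \<le> \<bar>real i + u - real j\<bar>" by linarith
          then have "(3/4)\<^sup>2 \<le> \<bar>real i + u - real j\<bar>\<^sup>2" by (intro power_mono) auto
          then show ?thesis unfolding t by (simp add: power2_eq_square)
        qed
        have W: "W (plane_point x y) = {}" 
        proof -
          have "\<exists>j<n. j \<noteq> l \<and> \<not> 0 < tangent j (plane_point x y)" for l
            using piece(1) k ti tk by (cases "l = i") (auto intro: exI[of _ k] exI[of _ i])
          then show ?thesis unfolding W_def by blast
        qed
        have C: "ch (plane_point x y) = piece_word i" using piece(1) tj ti by (intro ch1) (auto simp: not_less)
        have all: "- 1/2 \<le> tangent j (plane_point x y)" for j using ti tj[of j] by (cases "j = i") auto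
        have x: "\<bar>x\<bar> \<le> real n" using piece(1) n by (auto simp: x_def u_def)
        have "x\<^sup>2 \<le> (real n)\<^sup>2" using power_mono[OF x, of 2] by simp
        then have yn: "y \<le> (real n)\<^sup>2" unfolding y_def by simp
        show ?thesis
        proof (rule goal[of x y])
          show "\<forall>j<n. -1 < tangent j (plane_point x y) \<and> c * y - 1 < tangent j (plane_point x y)"
          proof (intro allI impI)
            fix j show "-1 < tangent j (plane_point x y) \<and> c * y - 1 < tangent j (plane_point x y)"
              using all[of j] small[OF yn] by linarith
          qed
          show "bend_word \<phi> tangent tangent D n n (plane_point x y) = \<sigma>"
            unfolding bwp W C link(2) piece(2) using small[OF yn] by auto
        qed
      next
        case (corner i)
        have key: "\<exists>p\<in>topspace (Esp d). (\<forall>f\<in>A. 0 < f p) \<and> bend_word \<phi> tangent tangent D n n p = \<sigma>"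
          if u: "3/8 \<le> u" "u \<le> 5/8" and w: "w = corner_word i \<union> (if u < 1/2 then {Lpart i} else {}) \<union> (if 1/2 < u then {Rpart (Suc i)} else {})" for u :: real
        proof -
          define x where "x = real i + u"
          define y where "y = x\<^sup>2 - 1/2"
          have t: "tangent j (plane_point x y) = (real i + u - real j)\<^sup>2 - 1/2" for j unfolding tp y_def x_def by simp
          have u2: "u\<^sup>2 \<le> (5/8)\<^sup>2" "(1 - u)\<^sup>2 \<le> (5/8)\<^sup>2" using u by (auto intro!: power_mono)
          have ti: "tangent i (plane_point x y) = u\<^sup>2 - 1/2" unfolding t by simp
          have ti': "tangent (Suc i) (plane_point x y) = (1 - u)\<^sup>2 - 1/2" unfolding t by (simp add: power2_eq_square algebra_simps)
          have tj: "0 < tangent j (plane_point x y)" if "j \<noteq> i" "j \<noteq> Suc i" for j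
          proof -
            have "real j \<le> real i - 1 \<or> real i + 2 \<le> real j" using that by linarith
            then have "1 \<le> \<bar>real i + u - real j\<bar>" using u by linarith
            then have "1\<^sup>2 \<le> \<bar>real i + u - real j\<bar>\<^sup>2" by (intro power_mono) auto
            then show ?thesis unfolding t by simp
          qed
          have neg: "tangent i (plane_point x y) < 0" "tangent (Suc i) (plane_point x y) < 0"
            unfolding ti ti' using u2 by (auto simp: power2_eq_square)
          have "tangent (Suc i) (plane_point x y) - tangent i (plane_point x y) = 1 - 2 * u"
            unfolding ti ti' by (simp add: power2_eq_square algebra_simps)
          then have C: "ch (plane_point x y) = w"
            unfolding w using corner(1) neg tj by (subst ch2[of i]) (auto simp: not_less less_imp_le)
          have W: "W (plane_point x y) = {}"
          proof -
            have "\<exists>j<n. j \<noteq> l \<and> \<not> 0 < tangent j (plane_point x y)" for l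
              using corner(1) neg by (cases "l = i") (auto intro: exI[of _ "Suc i"] exI[of _ i])
            then show ?thesis unfolding W_def by blast
          qed
          have all: "- 1/2 \<le> tangent j (plane_point x y)" for j unfolding t by simp
          have x: "\<bar>x\<bar> \<le> real n" using corner(1) u by (auto simp: x_def)
          have "x\<^sup>2 \<le> (real n)\<^sup>2" using power_mono[OF x, of 2] by simp
          then have yn: "y \<le> (real n)\<^sup>2" unfolding y_def by simp
          show ?thesis
          proof (rule goal[of x y])
            show "\<forall>j<n. -1 < tangent j (plane_point x y) \<and> c * y - 1 < tangent j (plane_point x y)"
            proof (intro allI impI)
              fix j show "-1 < tangent j (plane_point x y) \<and> c * y - 1 < tangent j (plane_point x y)"
                using all[of j] small[OF yn] by linarith
            qed
            show "bend_word \<phi> tangent tangent D n n (plane_point x y) = \<sigma>"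
              unfolding bwp W C link(2) using small[OF yn] by auto
          qed
        qed
        consider "w = corner_word i" | "w = insert (Lpart i) (corner_word i)" | "w = insert (Rpart (Suc i)) (corner_word i)"
          using corner(2) by (auto simp: corner_words_def)
        then show ?thesis
        proof cases
          case 1 then show ?thesis by (intro key[of "1/2"]) auto
        next
          case 2 then show ?thesis by (intro key[of "3/8"]) auto
        next
          case 3 then show ?thesis by (intro key[of "5/8"]) auto
        qed
      qed
    qed
  qed
qed

lemma all_below_3: "(\<forall>j<(3::nat). R j) \<longleftrightarrow> R 0 \<and> R 1 \<and> R 2"
proof -
  have "j < 3 \<longleftrightarrow> j = 0 \<or> j = 1 \<or> j = 2" for j :: nat by linarith
  then show ?thesis by (simp only:) blast
qed

text \<open>Here the chain has a single corner, which points into the middle petal; in the part of the plane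
  that the ambient set leaves, the overlap of the two half planes is contained in that petal.\<close>

lemma shared_corner_bend_realization:
  assumes d: "d \<ge> 2"
  shows "open_realizable d (split_base 3 2) (split_code 3 2 shared_corner)"
proof -
  define \<phi> where "\<phi> = (\<lambda>p :: nat \<Rightarrow> real. 1/8 * p 1)"
  define P :: "nat \<Rightarrow> (nat \<Rightarrow> real) \<Rightarrow> real" where "P = (\<lambda>i p. if i = 0 then p 1 + p 0 + 1 else if i = 1 then p 1 else p 1 - p 0 + (1::real))"
  define H :: "nat \<Rightarrow> (nat \<Rightarrow> real) \<Rightarrow> real" where "H = (\<lambda>i p. if i = 0 then p 1 + (1/2 * p 0 + 1/2) else p 1 - (1/2 * p 0 - (1/2::real)))"
  define D where "D = (\<lambda>i::nat. \<lambda>p :: nat \<Rightarrow> real. 0 - p 0)"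
  define A where "A = {\<lambda>p. p 1 + p 0 + 2, \<lambda>p. p 1 - p 0 + 2, \<lambda>p. p 1 + p 0 + 2 - 1/8 * p 1,
     \<lambda>p. p 1 - p 0 + 2 - 1/8 * p 1, \<lambda>p :: nat \<Rightarrow> real. p 1 + 2/3}"
  define amb where "amb x y \<longleftrightarrow> 0 < y + x + 2 \<and> 0 < y - x + 2 \<and> 0 < y + x + 2 - 1/8 * y
     \<and> 0 < y - x + 2 - 1/8 * y \<and> 0 < y + (2/3 :: real)" for x y
  have inA: "(\<forall>f\<in>A. 0 < f p) \<longleftrightarrow> amb (p 0) (p 1)" for p
    unfolding A_def amb_def by (simp only: ball_simps simp_thms)
  define h0 where "h0 x y \<longleftrightarrow> y + (1/2 * x + 1/2) < (0::real)" for x y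
  define h1 where "h1 x y \<longleftrightarrow> y - (1/2 * x - 1/2) < (0::real)" for x y
  define petals where "petals x y = (if 0 < y \<and> 0 < y - x + 1 then {Petal 0} else {})
     \<union> (if 0 < y + x + 1 \<and> 0 < y - x + 1 then {Petal 1} else {}) \<union> (if 0 < y + x + 1 \<and> 0 < (y::real) then {Petal 2} else {})" for x y
  define pieces where "pieces x y = (if h0 x y then {Piece 0, Rpart 0} else {}) \<union> (if h0 x y \<and> x < 0 then {Lpart 0} else {})
     \<union> (if h1 x y then {Piece 1, Lpart 1} else {}) \<union> (if h1 x y \<and> 0 < x then {Rpart 1} else {})" for x y
  have bw: "bend_word \<phi> P H D 3 2 p = {Ambient} \<union> (if 1/8 * p 1 < 1 then {Low} else {})
     \<union> (if 1 < 1/8 * p 1 then {High} else {}) \<union> petals (p 0) (p 1) \<union> pieces (p 0) (p 1)" for p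
  proof -
    have "Petal ` {i. i < 3 \<and> (\<forall>j<3. j \<noteq> i \<longrightarrow> 0 < P j p)} = petals (p 0) (p 1)"
      unfolding all_below_3 below_3 by (simp add: P_def petals_def)
    moreover have "bend_chain H D 2 p = pieces (p 0) (p 1)"
      unfolding bend_chain_def below_2 by (auto simp: H_def D_def pieces_def h0_def h1_def)
    ultimately show ?thesis by (simp add: bend_word_def \<phi>_def)
  qed
  have c0: "affine_fun d (\<lambda>p. p 0)" "affine_fun d (\<lambda>p. p 1)" using d by auto
  have corner: "insert (Petal 1) w \<in> shared_corner" if "w \<in> corner_words 0" for w
    using that by (simp add: shared_corner_def)
  have sub: "\<forall>w\<in>shared_corner. w \<subseteq> base 3 2" using shared_corner_subset by blast
  have sc: "piece_word 0 \<in> shared_corner" "piece_word 1 \<in> shared_corner"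
     "insert (Petal 0) (piece_word 0) \<in> shared_corner" "insert (Petal 2) (piece_word 1) \<in> shared_corner"
     "insert (Petal 1) (piece_word 0) \<in> shared_corner" "insert (Petal 1) (piece_word 1) \<in> shared_corner"
    unfolding shared_corner_def by blast+
  have linkI: "{Ambient, Low} \<union> w \<in> split_code 3 2 shared_corner" if "w \<in> shared_corner" for w
    using split_codeI(7)[OF that] shared_corner_subset[OF that] .
  show ?thesis
  proof (rule bend_realization[where A = A and \<phi> = \<phi> and P = P and H = H and D = D])
    show "finite A" by (simp add: A_def)
    show "affine_fun d f" if "f \<in> A" for f
      using that c0 unfolding A_def by (auto intro!: affine_fun_add affine_fun_diff affine_fun_cmul)
    show "affine_fun d \<phi>" unfolding \<phi>_def by (intro affine_fun_cmul c0)
    show "affine_fun d (P i)" for i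
    proof -
      have "affine_fun d (\<lambda>p. p 1 + p 0 + 1)" "affine_fun d (\<lambda>p. p 1 - p 0 + 1)"
        by (intro affine_fun_add affine_fun_diff affine_fun_const c0)+
      then show ?thesis using c0(2) unfolding P_def by (cases "i = 0"; cases "i = 1") simp_all
    qed
    show "affine_fun d (H i)" for i
    proof -
      have "affine_fun d (\<lambda>p. p 1 + (1/2 * p 0 + 1/2))" "affine_fun d (\<lambda>p. p 1 - (1/2 * p 0 - 1/2))"
        by (intro affine_fun_add affine_fun_diff affine_fun_cmul affine_fun_const c0)+
      then show ?thesis unfolding H_def by (cases "i = 0") simp_all
    qed
    show "affine_fun d (D i)" for i unfolding D_def by (intro affine_fun_diff affine_fun_const c0)
    show "w \<subseteq> base 3 2" if "w \<in> shared_corner" for w using that by (rule shared_corner_subset)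
    show "\<exists>p\<in>topspace (Esp d). \<exists>f\<in>A. f p \<le> 0"
    proof -
      have "(\<lambda>p. p 1 + 2/3) \<in> A" by (simp add: A_def)
      moreover have "plane_point 0 (-1) \<in> topspace (Esp d)" using d by (rule plane_point)
      moreover have "plane_point 0 (-1) 1 + 2/3 \<le> 0" by (simp add: plane_point)
      ultimately show ?thesis by (intro bexI[of _ "plane_point 0 (-1)"] bexI[of _ "\<lambda>p. p 1 + 2/3"])
    qed
  next
    fix p assume "p \<in> topspace (Esp d)" "\<forall>f\<in>A. 0 < f p"
    define x where "x = p 0"
    define y where "y = p 1"
    have a: "0 < y + x + 2" "0 < y - x + 2" "0 < y + x + 2 - 1/8 * y" "0 < y - x + 2 - 1/8 * y" "0 < y + 2/3"
      using \<open>\<forall>f\<in>A. 0 < f p\<close> unfolding inA amb_def x_def y_def by blast+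
    have w: "bend_word \<phi> P H D 3 2 p = {Ambient} \<union> (if 1/8 * y < 1 then {Low} else {})
     \<union> (if 1 < 1/8 * y then {High} else {}) \<union> petals x y \<union> pieces x y" unfolding bw x_def y_def ..
    consider "h0 x y" "h1 x y" | "h0 x y" "\<not> h1 x y" | "\<not> h0 x y" "h1 x y" | "\<not> h0 x y" "\<not> h1 x y" by blast
    then show "bend_word \<phi> P H D 3 2 p \<in> split_code 3 2 shared_corner"
    proof cases
      case 1
      have f: "\<not> 0 < y" "0 < y + x + 1" "0 < y - x + 1" "1/8 * y < 1" "\<not> 1 < 1/8 * y"
        using 1 a unfolding h0_def h1_def by linarith+
      have "petals x y = {Petal 1}" unfolding petals_def using f by simp
      moreover have "pieces x y = corner_word 0 \<union> (if x < 0 then {Lpart 0} else {}) \<union> (if 0 < x then {Rpart (Suc 0)} else {})"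
        unfolding pieces_def using 1 by (auto simp: corner_word_def)
      moreover have "corner_word 0 \<union> (if x < 0 then {Lpart 0} else {}) \<union> (if 0 < x then {Rpart (Suc 0)} else {}) \<in> corner_words 0"
        by (auto simp: corner_words_def)
      ultimately have "bend_word \<phi> P H D 3 2 p = {Ambient, Low} \<union> insert (Petal 1) (pieces x y)" "pieces x y \<in> corner_words 0"
        unfolding w using f by auto
      then show ?thesis using linkI[OF corner] by simp
    next
      case 2
      have f: "\<not> (0 < y + x + 1 \<and> 0 < y)" "x < 0" "1/8 * y < 1" "\<not> 1 < 1/8 * y"
        using 2 a unfolding h0_def h1_def by linarith+
      have pc: "pieces x y = piece_word 0" unfolding pieces_def using 2 f by (auto simp: piece_word_def)
      have "petals x y = {} \<or> petals x y = {Petal 0} \<or> petals x y = {Petal 1}" unfolding petals_def using f by auto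
      then have "petals x y \<union> pieces x y \<in> shared_corner" unfolding pc by (elim disjE) (simp_all only: Un_empty_left Un_insert_left sc)
      moreover have "bend_word \<phi> P H D 3 2 p = {Ambient, Low} \<union> (petals x y \<union> pieces x y)"
        unfolding w if_P[OF f(3)] if_not_P[OF f(4)] by (simp add: insert_commute)
      ultimately show ?thesis using linkI by simp
    next
      case 3
      have f: "\<not> (0 < y - x + 1 \<and> 0 < y)" "0 < x" "1/8 * y < 1" "\<not> 1 < 1/8 * y"
        using 3 a unfolding h0_def h1_def by linarith+
      have pc: "pieces x y = piece_word 1" unfolding pieces_def using 3 f by (auto simp: piece_word_def)
      have "petals x y = {} \<or> petals x y = {Petal 2} \<or> petals x y = {Petal 1}" unfolding petals_def using f by auto
      then have "petals x y \<union> pieces x y \<in> shared_corner" unfolding pc by (elim disjE) (simp_all only: Un_empty_left Un_insert_left sc)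
      moreover have "bend_word \<phi> P H D 3 2 p = {Ambient, Low} \<union> (petals x y \<union> pieces x y)"
        unfolding w if_P[OF f(3)] if_not_P[OF f(4)] by (simp add: insert_commute)
      ultimately show ?thesis using linkI by simp
    next
      case 4
      have pc: "pieces x y = {}" unfolding pieces_def using 4 by simp
      have W: "wall 3 = {Petal 0, Petal 1, Petal 2}"
        by (auto simp: wall_def numeral_3_eq_3 numeral_2_eq_2 lessThan_Suc)
      show ?thesis
      proof (cases "0 < y \<and> 0 < y + x + 1 \<and> 0 < y - x + 1")
        case True
        have "bend_word \<phi> P H D 3 2 p = {Ambient} \<union> (if 1/8 * y < 1 then {Low} else {}) \<union> (if 1 < 1/8 * y then {High} else {}) \<union> wall 3"
          unfolding w pc W petals_def using True by auto
        then show ?thesis using split_codeI(2-4)[of 3 2 shared_corner]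
          by (cases "1/8 * y" "1 :: real" rule: linorder_cases) (auto simp: insert_commute)
      next
        case False
        then have f: "1/8 * y < 1" "\<not> 1 < 1/8 * y" using a by linarith+
        have "petals x y = {} \<or> petals x y = {Petal 0} \<or> petals x y = {Petal 1} \<or> petals x y = {Petal 2}"
          unfolding petals_def using False by auto
        then have "petals x y = {} \<or> (\<exists>i\<in>{..<3}. petals x y = {Petal i})"
          by (elim disjE) (simp_all add: numeral_3_eq_3 numeral_2_eq_2 lessThan_Suc)
        then consider "petals x y = {}" | i where "petals x y = {Petal i}" "i < 3" by blast
        then show ?thesis
        proof cases
          case 1
          have "bend_word \<phi> P H D 3 2 p = {Ambient, Low}" unfolding w pc 1 if_P[OF f(1)] if_not_P[OF f(2)] by auto
          then show ?thesis using split_codeI(5) by simp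
        next
          case (2 i)
          have "bend_word \<phi> P H D 3 2 p = {Ambient, Low, Petal i}" unfolding w pc 2(1) if_P[OF f(1)] if_not_P[OF f(2)] by auto
          then show ?thesis using split_codeI(6)[OF 2(2)] by simp
        qed
      qed
    qed
  next
    fix \<sigma> assume s: "\<sigma> \<in> split_code 3 2 shared_corner" "\<sigma> \<noteq> {}"
    have goal: "\<exists>p\<in>topspace (Esp d). (\<forall>f\<in>A. 0 < f p) \<and> bend_word \<phi> P H D 3 2 p = \<sigma>"
      if "amb x y" "{Ambient} \<union> (if 1/8 * y < 1 then {Low} else {}) \<union> (if 1 < 1/8 * y then {High} else {})
        \<union> petals x y \<union> pieces x y = \<sigma>" for x y
      using that d by (intro bexI[of _ "plane_point x y"] conjI) (simp_all only: inA bw plane_point)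
    note defs = amb_def petals_def pieces_def h0_def h1_def wall_def piece_word_def
    have W: "wall 3 = {Petal 0, Petal 1, Petal 2}"
      by (auto simp: wall_def numeral_3_eq_3 numeral_2_eq_2 lessThan_Suc)
    from sub s(1) show "\<exists>p\<in>topspace (Esp d). (\<forall>f\<in>A. 0 < f p) \<and> bend_word \<phi> P H D 3 2 p = \<sigma>"
    proof (cases rule: split_codeE)
      case empty then show ?thesis using s(2) by simp
    next
      case wall then show ?thesis by (intro goal[of 0 8]) (auto simp: defs W)
    next
      case low then show ?thesis by (intro goal[of 0 1]) (auto simp: defs W)
    next
      case high then show ?thesis by (intro goal[of 0 16]) (auto simp: defs W)
    next
      case ambient then show ?thesis by (intro goal[of "-1" 0]) (auto simp: defs)
    next
      case (petal i)
      then have "i = 0 \<or> i = 1 \<or> i = 2" by linarith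
      then show ?thesis
      proof (elim disjE)
        assume "i = 0" then show ?thesis using petal by (intro goal[of "-2" "9/10"]) (auto simp: defs)
      next
        assume "i = 1" then show ?thesis using petal by (intro goal[of 0 "-1/4"]) (auto simp: defs)
      next
        assume "i = 2" then show ?thesis using petal by (intro goal[of 2 "9/10"]) (auto simp: defs)
      qed
    next
      case (link w)
      have "(w = piece_word 0 \<or> w = piece_word 1 \<or> w = insert (Petal 0) (piece_word 0)
          \<or> w = insert (Petal 2) (piece_word 1) \<or> w = insert (Petal 1) (piece_word 0) \<or> w = insert (Petal 1) (piece_word 1)) \<or> w = insert (Petal 1) (corner_word 0) \<or> w = insert (Petal 1) (insert (Lpart 0) (corner_word 0))
          \<or> w = insert (Petal 1) (insert (Rpart (Suc 0)) (corner_word 0))"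
        using link(1) by (simp only: shared_corner_def corner_words_def image_insert image_empty Un_iff insert_iff empty_iff simp_thms disj_assoc)
      then show ?thesis
      proof (elim disjE)
        assume "w = piece_word 0" then show ?thesis using link(2) by (intro goal[of "-3/2" "-1/10"]) (auto simp: defs)
      next
        assume "w = piece_word 1" then show ?thesis using link(2) by (intro goal[of "3/2" "-1/10"]) (auto simp: defs)
      next
        assume "w = insert (Petal 0) (piece_word 0)" then show ?thesis using link(2) by (intro goal[of "-3/2" "1/10"]) (auto simp: defs)
      next
        assume "w = insert (Petal 2) (piece_word 1)" then show ?thesis using link(2) by (intro goal[of "3/2" "1/10"]) (auto simp: defs)
      next
        assume "w = insert (Petal 1) (piece_word 0)" then show ?thesis using link(2) by (intro goal[of "-1/2" "-2/5"]) (auto simp: defs)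
      next
        assume "w = insert (Petal 1) (piece_word 1)" then show ?thesis using link(2) by (intro goal[of "1/2" "-2/5"]) (auto simp: defs)
      next
        assume "w = insert (Petal 1) (corner_word 0)" then show ?thesis using link(2) by (intro goal[of 0 "-3/5"]) (auto simp: defs corner_word_def)
      next
        assume "w = insert (Petal 1) (insert (Lpart 0) (corner_word 0))" then show ?thesis using link(2) by (intro goal[of "-1/10" "-3/5"]) (auto simp: defs corner_word_def)
      next
        assume "w = insert (Petal 1) (insert (Rpart (Suc 0)) (corner_word 0))" then show ?thesis using link(2) by (intro goal[of "1/10" "-3/5"]) (auto simp: defs corner_word_def)
      qed
    qed
  qed
qed

section \<open>Lower bounds\<close>

subsection \<open>Incidences in the codewords\<close>

lemma realization_words:
  assumes "code_of d S X = pull id S F"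
  shows "v \<in> Rn d \<Longrightarrow> \<exists>\<sigma>\<in>F. \<forall>\<nu>\<in>S. v \<in> fvecs (X \<nu>) \<longleftrightarrow> \<nu> \<in> \<sigma>"
    and "\<sigma> \<in> F \<Longrightarrow> \<exists>v\<in>Rn d. \<forall>\<nu>\<in>S. v \<in> fvecs (X \<nu>) \<longleftrightarrow> \<nu> \<in> \<sigma>"
proof -
  assume "v \<in> Rn d"
  then have "{\<nu> \<in> S. coord v \<in> X \<nu>} \<in> code_of d S X" by (intro code_of_word) (simp add: coord_topspace)
  then obtain \<sigma> where "\<sigma> \<in> F" "{\<nu> \<in> S. coord v \<in> X \<nu>} = S \<inter> \<sigma>" unfolding assms pull_id by blast
  then show "\<exists>\<sigma>\<in>F. \<forall>\<nu>\<in>S. v \<in> fvecs (X \<nu>) \<longleftrightarrow> \<nu> \<in> \<sigma>"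
    by (intro bexI[of _ \<sigma>]) (auto simp: fvecs_def)
next
  assume "\<sigma> \<in> F"
  then have "S \<inter> \<sigma> \<in> code_of d S X" unfolding assms pull_id by blast
  then obtain p where p: "p \<in> topspace (Esp d)" "S \<inter> \<sigma> = {\<nu> \<in> S. p \<in> X \<nu>}" by (rule code_ofE)
  obtain v where v: "v \<in> Rn d" "coord v = p" using p(1) by (rule topspace_coord)
  then show "\<exists>v\<in>Rn d. \<forall>\<nu>\<in>S. v \<in> fvecs (X \<nu>) \<longleftrightarrow> \<nu> \<in> \<sigma>"
    using p(2) by (intro bexI[of _ v]) (auto simp: fvecs_def)
qed

lemma chain_word_facts:
  assumes "u \<in> chain_words n"
  shows "Piece i \<in> u \<Longrightarrow> Suc i < n \<Longrightarrow> Lpart i \<in> u \<or> Piece (Suc i) \<in> u"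
    and "Piece (Suc i) \<in> u \<Longrightarrow> Rpart (Suc i) \<in> u \<or> Piece i \<in> u"
    and "\<not> (Lpart i \<in> u \<and> Rpart (Suc i) \<in> u)"
    and "Piece i \<in> u \<Longrightarrow> Piece j \<in> u \<Longrightarrow> j \<le> Suc i"
    and "\<exists>i<n. Piece i \<in> u"
    and "Petal i \<notin> u" "Link \<notin> u"
proof -
  from assms consider (piece) k where "k < n" "u = piece_word k" | (corner) k where "Suc k < n" "u \<in> corner_words k"
    unfolding chain_words_def by blast
  note 1 = this
  show "Piece i \<in> u \<Longrightarrow> Suc i < n \<Longrightarrow> Lpart i \<in> u \<or> Piece (Suc i) \<in> u"
    using 1 by cases (auto simp: piece_word_def corner_words_def corner_word_def)
  show "Piece (Suc i) \<in> u \<Longrightarrow> Rpart (Suc i) \<in> u \<or> Piece i \<in> u"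
    using 1 by cases (auto simp: piece_word_def corner_words_def corner_word_def)
  show "\<not> (Lpart i \<in> u \<and> Rpart (Suc i) \<in> u)"
    using 1 by cases (auto simp: piece_word_def corner_words_def corner_word_def)
  show "Piece i \<in> u \<Longrightarrow> Piece j \<in> u \<Longrightarrow> j \<le> Suc i"
    using 1 by cases (auto simp: piece_word_def corner_words_def corner_word_def)
  show "\<exists>i<n. Piece i \<in> u"
    using 1 by cases (auto simp: piece_word_def corner_words_def corner_word_def)
  show "Petal i \<notin> u" "Link \<notin> u"
    using 1 by (cases, auto simp: piece_word_def corner_words_def corner_word_def)+
qed

text \<open>On the chain at most one petal is met at a time.\<close>

definition linked_words :: "nat \<Rightarrow> neuron set set \<Rightarrow> bool" where
  "linked_words n I \<longleftrightarrow> (\<forall>w\<in>I. \<exists>u\<in>chain_words n. w = u \<or> (\<exists>i. w = insert (Petal i) u))"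

lemma piece_word_chain: "i < n \<Longrightarrow> piece_word i \<in> chain_words n"
  by (auto simp: chain_words_def)

lemma linked_private_pieces: "linked_words n (private_pieces n)"
  unfolding linked_words_def
proof
  fix w assume "w \<in> private_pieces n"
  then consider "w \<in> chain_words n" | i where "i < n" "w = insert (Petal i) (piece_word i)"
    unfolding private_pieces_def by blast
  then show "\<exists>u\<in>chain_words n. w = u \<or> (\<exists>i. w = insert (Petal i) u)"
    by cases (blast intro: piece_word_chain)+
qed

lemma linked_shared_corner: "linked_words 2 shared_corner"
  unfolding linked_words_def
proof
  fix w assume "w \<in> shared_corner"
  moreover have "corner_words 0 \<subseteq> chain_words 2" unfolding chain_words_def by auto
  moreover have "piece_word 0 \<in> chain_words 2" "piece_word 1 \<in> chain_words 2" by (auto intro: piece_word_chain)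
  ultimately show "\<exists>u\<in>chain_words 2. w = u \<or> (\<exists>i. w = insert (Petal i) u)"
    unfolding shared_corner_def by blast
qed

lemma flower_code_facts:
  assumes I: "linked_words n I" and s: "\<sigma> \<in> flower_code m I"
  shows "Petal i \<in> \<sigma> \<Longrightarrow> Petal j \<in> \<sigma> \<Longrightarrow> i \<noteq> j \<Longrightarrow> wall m \<subseteq> \<sigma> \<and> Link \<notin> \<sigma> \<and> (\<forall>k. Piece k \<notin> \<sigma>)"
    and "Piece i \<in> \<sigma> \<Longrightarrow> Suc i < n \<Longrightarrow> Lpart i \<in> \<sigma> \<or> Piece (Suc i) \<in> \<sigma>"
    and "Piece (Suc i) \<in> \<sigma> \<Longrightarrow> Rpart (Suc i) \<in> \<sigma> \<or> Piece i \<in> \<sigma>"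
    and "\<not> (Lpart i \<in> \<sigma> \<and> Rpart (Suc i) \<in> \<sigma>)"
    and "Piece i \<in> \<sigma> \<Longrightarrow> Piece j \<in> \<sigma> \<Longrightarrow> j \<le> Suc i"
    and "Link \<in> \<sigma> \<Longrightarrow> \<exists>i<n. Piece i \<in> \<sigma>"
    and "Petal i \<in> \<sigma> \<Longrightarrow> Ambient \<in> \<sigma>"
    and "Ambient \<in> \<sigma> \<Longrightarrow> Low \<notin> \<sigma> \<Longrightarrow> High \<notin> \<sigma> \<Longrightarrow> wall m \<subseteq> \<sigma>"
    and "\<not> (Low \<in> \<sigma> \<and> High \<in> \<sigma>)"
    and "Low \<in> \<sigma> \<or> High \<in> \<sigma> \<Longrightarrow> Ambient \<in> \<sigma>"
proof -
  have w: "\<nu> \<in> wall m \<Longrightarrow> \<exists>i. \<nu> = Petal i" for \<nu> by (auto simp: wall_def)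
  from s have "(\<sigma> \<subseteq> {Ambient, Low} \<and> (Low \<in> \<sigma> \<longleftrightarrow> Ambient \<in> \<sigma>))
    \<or> (\<exists>V\<in>{{Ambient}, {Ambient, Low}, {Ambient, High}}. \<sigma> = V \<union> wall m) \<or> (\<exists>k. \<sigma> = {Ambient, Low, Petal k})
    \<or> (\<exists>u\<in>chain_words n. \<exists>P. \<sigma> = {Ambient, Low, Link} \<union> P \<union> u \<and> P \<in> insert {} (range (\<lambda>k. {Petal k})))"
  proof (cases rule: flower_codeE)
    case empty then show ?thesis by simp
  next
    case wall then show ?thesis by (intro disjI2[OF disjI1] bexI[of _ "{Ambient}"]) simp_all
  next
    case low then show ?thesis by (intro disjI2[OF disjI1] bexI[of _ "{Ambient, Low}"]) simp_all
  next
    case high then show ?thesis by (intro disjI2[OF disjI1] bexI[of _ "{Ambient, High}"]) simp_all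
  next
    case ambient then show ?thesis by simp
  next
    case (petal i)
    then show ?thesis by (intro disjI2[OF disjI2[OF disjI1]] exI[of _ i])
  next
    case (link w)
    then obtain u where u: "u \<in> chain_words n" "w = u \<or> (\<exists>i. w = insert (Petal i) u)"
      using I unfolding linked_words_def by blast
    show ?thesis
    proof (intro disjI2 bexI[OF _ u(1)])
      from u(2) show "\<exists>P. \<sigma> = {Ambient, Low, Link} \<union> P \<union> u \<and> P \<in> insert {} (range (\<lambda>k. {Petal k}))"
      proof
        assume "w = u" then show ?thesis using link(2) by (intro exI[of _ "{}"]) simp
      next
        assume "\<exists>i. w = insert (Petal i) u"
        then obtain i where "w = insert (Petal i) u" ..
        then show ?thesis using link(2) by (intro exI[of _ "{Petal i}"]) (auto simp: insert_commute)
      qed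
    qed
  qed
  then consider (plain) "\<sigma> \<subseteq> {Ambient, Low}" "Low \<in> \<sigma> \<longleftrightarrow> Ambient \<in> \<sigma>"
    | (centre) V where "V \<in> {{Ambient}, {Ambient, Low}, {Ambient, High}}" "\<sigma> = V \<union> wall m"
    | (petal) k where "\<sigma> = {Ambient, Low, Petal k}"
    | (chain) u P where "u \<in> chain_words n" "\<sigma> = {Ambient, Low, Link} \<union> P \<union> u" "P \<in> insert {} (range (\<lambda>k. {Petal k}))"
    by (elim disjE conjE bexE exE) (rule that; assumption | assumption)+
  note cs = this
  note simps = chain_word_facts(6,7)
  have ch: "Low \<notin> u" "High \<notin> u" "Ambient \<notin> u" if "u \<in> chain_words n" for u
    using chain_words_subset[OF that] by auto
  show "Petal i \<in> \<sigma> \<Longrightarrow> Petal j \<in> \<sigma> \<Longrightarrow> i \<noteq> j \<Longrightarrow> wall m \<subseteq> \<sigma> \<and> Link \<notin> \<sigma> \<and> (\<forall>k. Piece k \<notin> \<sigma>)"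
    using cs by cases (auto dest: w simp: simps)
  show "Piece i \<in> \<sigma> \<Longrightarrow> Suc i < n \<Longrightarrow> Lpart i \<in> \<sigma> \<or> Piece (Suc i) \<in> \<sigma>"
    using cs by cases (auto dest: w chain_word_facts(1))
  show "Piece (Suc i) \<in> \<sigma> \<Longrightarrow> Rpart (Suc i) \<in> \<sigma> \<or> Piece i \<in> \<sigma>"
    using cs by cases (auto dest: w chain_word_facts(2))
  show "\<not> (Lpart i \<in> \<sigma> \<and> Rpart (Suc i) \<in> \<sigma>)"
    using cs by cases (auto dest: w chain_word_facts(3))
  show "Piece i \<in> \<sigma> \<Longrightarrow> Piece j \<in> \<sigma> \<Longrightarrow> j \<le> Suc i"
    using cs by cases (auto dest: w chain_word_facts(4))
  show "Link \<in> \<sigma> \<Longrightarrow> \<exists>i<n. Piece i \<in> \<sigma>"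
    using cs by cases (auto dest: w chain_word_facts(5))
  show "Petal i \<in> \<sigma> \<Longrightarrow> Ambient \<in> \<sigma>"
    using cs by cases auto
  show "Ambient \<in> \<sigma> \<Longrightarrow> Low \<notin> \<sigma> \<Longrightarrow> High \<notin> \<sigma> \<Longrightarrow> wall m \<subseteq> \<sigma>"
    using cs by cases auto
  show "\<not> (Low \<in> \<sigma> \<and> High \<in> \<sigma>)"
    using cs by cases (auto dest: w ch)
  show "Low \<in> \<sigma> \<or> High \<in> \<sigma> \<Longrightarrow> Ambient \<in> \<sigma>"
    using cs by cases (auto dest: w ch)
qed

lemma shared_corner_Petal:
  assumes "\<sigma> \<in> flower_code 3 shared_corner" "Piece 0 \<in> \<sigma>" "Piece 1 \<in> \<sigma>"
  shows "Petal 1 \<in> \<sigma>"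
  using assms
proof (cases rule: flower_codeE)
  case (link w)
  have "Petal 1 \<in> w" if "w \<in> shared_corner" "Piece 0 \<in> w" "Piece 1 \<in> w"
    using that unfolding shared_corner_def by (auto simp: piece_word_def)
  then show ?thesis using link assms by auto
qed (auto simp: wall_def)

text \<open>Each piece of a chain is glued to the union of the earlier ones along their overlap.  Leaving
  that overlap on either side keeps a point in \<open>L i\<close> or in \<open>R (Suc i)\<close>, and as these are closed and
  disjoint no segment can leave the union at a corner.\<close>

lemma convex_chain_Union:
  fixes H L R :: "nat \<Rightarrow> 'a::real_inner set"
  assumes H: "\<And>i. i < n \<Longrightarrow> compact (H i) \<and> convex (H i) \<and> closed (L i) \<and> closed (R i)"
    and HL: "\<And>i. Suc i < n \<Longrightarrow> H i \<subseteq> L i \<union> H (Suc i)"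
    and HR: "\<And>i. Suc i < n \<Longrightarrow> H (Suc i) \<subseteq> R (Suc i) \<union> H i"
    and LR: "\<And>i. Suc i < n \<Longrightarrow> L i \<inter> R (Suc i) = {}"
    and ov: "\<And>i. Suc i < n \<Longrightarrow> H i \<inter> H (Suc i) \<noteq> {}"
    and far: "\<And>i j. j < n \<Longrightarrow> Suc i < j \<Longrightarrow> H i \<inter> H j = {}"
    and k: "k < n"
  shows "convex (\<Union>i\<le>k. H i)"
  using k
proof (induction k)
  case 0
  then show ?case using H by simp
next
  case (Suc k)
  define X where "X = (\<Union>i\<le>k. H i)"
  have XU: "X = (\<Union>i<k. H i) \<union> H k" unfolding X_def by (auto simp: le_less)
  have "convex (X \<union> H (Suc k))"
  proof (rule convex_Un_separated_overlap[where A = "(\<Union>i<k. H i) \<union> L k" and B = "R (Suc k)"])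
    show "compact X" unfolding X_def using H Suc.prems by (intro compact_UN) auto
    show "convex X" unfolding X_def using Suc by simp
    show "compact (H (Suc k))" "convex (H (Suc k))" "closed (R (Suc k))" using H Suc.prems by auto
    have "compact (\<Union>i<k. H i)" using H Suc.prems by (intro compact_UN) auto
    then show "closed ((\<Union>i<k. H i) \<union> L k)" using H[of k] Suc.prems by (intro closed_Un) (auto intro: compact_imp_closed)
    show "X \<subseteq> ((\<Union>i<k. H i) \<union> L k) \<union> H (Suc k)" unfolding XU using HL[OF Suc.prems] by blast
    show "H (Suc k) \<subseteq> R (Suc k) \<union> X" unfolding XU using HR[OF Suc.prems] by blast
    have "(\<Union>i<k. H i) \<inter> H (Suc k) = {}" using far[OF Suc.prems] by auto
    then show "X \<inter> H (Suc k) \<inter> ((\<Union>i<k. H i) \<union> L k) \<inter> R (Suc k) = {}" using LR[OF Suc.prems] by blast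
    show "X \<inter> H (Suc k) \<noteq> {}" unfolding XU using ov[OF Suc.prems] by blast
  qed
  then show ?case unfolding X_def by (simp add: atMost_Suc Un_commute)
qed

subsection \<open>Open realizations with a convex link\<close>

text \<open>The hull of the points \<open>p i\<close> lies in \<open>L\<close> and comes near the centre; as \<open>L\<close> is open, it meets the
  centre.  The flat \<open>A\<close> can be chosen small, so that few petals suffice.\<close>

lemma open_flower_meets_link:
  assumes A: "A = (+) a ` span B" "A \<subseteq> Rn d" and fin: "finite B" "card B < m"
    and U: "\<And>i. i < m \<Longrightarrow> openin (top_of_set (Rn d)) (U i) \<and> convex (U i) \<and> C \<subseteq> U i"
    and UU: "\<And>i j. i < m \<Longrightarrow> j < m \<Longrightarrow> i \<noteq> j \<Longrightarrow> U i \<inter> U j \<subseteq> C"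
    and C: "C \<inter> A \<noteq> {}"
    and L: "openin (top_of_set (Rn d)) L" "convex L"
    and p: "\<And>i. i < m \<Longrightarrow> p i \<in> U i \<inter> L \<inter> A"
  shows "C \<inter> L \<noteq> {}"
proof -
  have cA: "convex A" unfolding A(1) by (rule convex_translation[OF subspace_imp_convex[OF subspace_span]])
  have "convex hull (p ` {..<m}) \<inter> closure (C \<inter> A) \<noteq> {}"
  proof (rule sunflower[where a = a and B = B and U = "\<lambda>i. U i \<inter> A"])
    show "compact X" if "X \<subseteq> (+) a ` span B" "closed X" "bounded X" for X
    proof -
      have "X \<subseteq> Rn d" using that(1) A by simp
      then show ?thesis using that(2,3) by (rule Rn_heine_borel)
    qed
    show "open_sunflower ((+) a ` span B) {..<m} (\<lambda>i. U i \<inter> A) (C \<inter> A)"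
      unfolding open_sunflower_def A(1)[symmetric]
    proof (intro conjI ballI impI)
      fix i assume i: "i \<in> {..<m}"
      show "openin (top_of_set A) (U i \<inter> A)" using U A(2) i by (intro openin_subset_section[of "Rn d"]) auto
      show "convex (U i \<inter> A)" using U i cA by (intro convex_Int) auto
      show "C \<inter> A \<subseteq> U i \<inter> A" using U i by blast
    next
      fix i j assume "i \<in> {..<m}" "j \<in> {..<m}" "i \<noteq> j"
      then show "(U i \<inter> A) \<inter> (U j \<inter> A) \<subseteq> C \<inter> A" using UU[of i j] by auto
    qed (rule C)
    show "finite B" "finite {..<m}" "card B < card {..<m}" using fin by simp_all
    show "p i \<in> U i \<inter> A" if "i \<in> {..<m}" for i using p[of i] that by simp
  qed
  then obtain x where x: "x \<in> convex hull (p ` {..<m})" "x \<in> closure (C \<inter> A)" by blast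
  have "convex hull (p ` {..<m}) \<subseteq> L" using p L(2) by (intro hull_minimal) auto
  moreover obtain T where T: "open T" "L = Rn d \<inter> T" using L(1) by (auto simp: openin_open)
  ultimately have "T \<inter> closure (C \<inter> A) \<noteq> {}" using x by blast
  then have "T \<inter> (C \<inter> A) \<noteq> {}" using open_Int_closure_eq_empty[OF T(1), of "C \<inter> A"] by blast
  then show ?thesis using T(2) A(2) by blast
qed


lemma base_members:
  "i < m \<Longrightarrow> Petal i \<in> base m n" "i < n \<Longrightarrow> Piece i \<in> base m n"
  "i < n \<Longrightarrow> Lpart i \<in> base m n" "i < n \<Longrightarrow> Rpart i \<in> base m n"
  by (auto simp: base_def)

lemma petals_meet:
  assumes words: "\<exists>\<sigma>\<in>flower_code m I. \<forall>\<nu>\<in>S. v \<in> Y \<nu> \<longleftrightarrow> \<nu> \<in> \<sigma>"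
    and I: "linked_words n I" and S: "base m n \<subseteq> S"
    and ij: "i < m" "j < m" "i \<noteq> j" "v \<in> Y (Petal i)" "v \<in> Y (Petal j)"
  shows "k < m \<Longrightarrow> v \<in> Y (Petal k)" "k < n \<Longrightarrow> v \<notin> Y (Piece k)" "Link \<in> S \<Longrightarrow> v \<notin> Y Link"
proof -
  obtain \<sigma> where \<sigma>: "\<sigma> \<in> flower_code m I" "\<forall>\<nu>\<in>S. v \<in> Y \<nu> \<longleftrightarrow> \<nu> \<in> \<sigma>" using words by blast
  have "Petal i \<in> \<sigma>" "Petal j \<in> \<sigma>" using \<sigma>(2) ij S base_members(1)[of _ m n] by blast+
  then have f: "wall m \<subseteq> \<sigma>" "Link \<notin> \<sigma>" "\<And>k. Piece k \<notin> \<sigma>"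
    using flower_code_facts(1)[OF I \<sigma>(1) _ _ ij(3)] by blast+
  have "Petal k \<in> \<sigma>" if "k < m" for k using f(1) that by (auto simp: wall_def)
  then show "k < m \<Longrightarrow> v \<in> Y (Petal k)" using \<sigma>(2) S base_members(1)[of _ m n] by blast
  show "k < n \<Longrightarrow> v \<notin> Y (Piece k)" using \<sigma>(2) f(3) S base_members(2)[of _ n m] by blast
  show "Link \<in> S \<Longrightarrow> v \<notin> Y Link" using \<sigma>(2) f(2) by blast
qed

lemma link_base_sub: "base m n \<subseteq> link_base m n" "Link \<in> link_base m n"
  by (auto simp: link_base_def)

text \<open>The link touches all \<open>n\<close> petals and avoids the centre.\<close>

theorem open_link_private_bound:
  assumes n: "n \<ge> 2" and real: "open_realizable d (link_base n n) (link_code n n (private_pieces n))"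
  shows "n \<le> d"
proof (rule ccontr)
  assume "\<not> n \<le> d"
  let ?S = "link_base n n"
  obtain U where U: "open_convex_realization d ?S (link_code n n (private_pieces n)) U" using real by blast
  define Y where "Y \<nu> = fvecs (U \<nu>)" for \<nu>
  have code: "code_of d ?S U = link_code n n (private_pieces n)" using U by (simp add: open_convex_realization_def)
  note words = realization_words[OF code, folded Y_def]
  have op: "openin (top_of_set (Rn d)) (Y \<nu>)" "convex (Y \<nu>)" if "\<nu> \<in> ?S" for \<nu>
    using U that by (auto simp: open_convex_realization_def Y_def openin_fvecs convex_fvecs)
  have YR: "Y \<nu> \<subseteq> Rn d" if "\<nu> \<in> ?S" for \<nu> using op(1)[OF that] openin_imp_subset by blast
  have PS: "Petal i \<in> ?S" if "i < n" for i using that base_members(1) link_base_sub by blast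
  note meet = petals_meet[OF words(1) linked_private_pieces link_base_sub(1)]
  define C where "C = (\<Inter>i<n. Y (Petal i))"
  have p: "\<exists>v. v \<in> Y (Petal i) \<inter> Y Link" if i: "i < n" for i
  proof -
    have "{Ambient, Low, Link} \<union> insert (Petal i) (piece_word i) \<in> flower_code n (private_pieces n)"
      by (rule flower_code_linkI[OF private_piecesI(2)[OF i]])
    from words(2)[OF this] obtain v where "\<forall>\<nu>\<in>?S. v \<in> Y \<nu> \<longleftrightarrow> \<nu> \<in> {Ambient, Low, Link} \<union> insert (Petal i) (piece_word i)" by blast
    then show ?thesis using PS[OF i] link_base_sub(2) by (intro exI[of _ v]) simp
  qed
  then have "\<forall>i. \<exists>v. i < n \<longrightarrow> v \<in> Y (Petal i) \<inter> Y Link" by blast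
  then obtain p where p: "\<And>i. i < n \<Longrightarrow> p i \<in> Y (Petal i) \<inter> Y Link" by metis
  have "C \<inter> Y Link \<noteq> {}"
  proof (rule open_flower_meets_link[where a = 0 and B = "unitv ` {..<d}" and A = "Rn d" and d = d and m = n and U = "\<lambda>i. Y (Petal i)" and p = p])
    show "Rn d = (+) 0 ` span (unitv ` {..<d})" by (simp add: Rn_eq_span)
    have "card (unitv ` {..<d}) \<le> d" using card_image_le[of "{..<d}" unitv] by simp
    then show "card (unitv ` {..<d}) < n" using \<open>\<not> n \<le> d\<close> by linarith
    show "openin (top_of_set (Rn d)) (Y (Petal i)) \<and> convex (Y (Petal i)) \<and> C \<subseteq> Y (Petal i)" if "i < n" for i
      using op[OF PS[OF that]] that by (auto simp: C_def)
    show "Y (Petal i) \<inter> Y (Petal j) \<subseteq> C" if "i < n" "j < n" "i \<noteq> j" for i j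
    proof
      fix v assume v: "v \<in> Y (Petal i) \<inter> Y (Petal j)"
      then have "v \<in> Rn d" using YR[OF PS[OF that(1)]] by blast
      then show "v \<in> C" using meet(1)[of v i j] that v by (auto simp: C_def)
    qed
    obtain v where v: "v \<in> Rn d" "\<forall>\<nu>\<in>?S. v \<in> Y \<nu> \<longleftrightarrow> \<nu> \<in> {Ambient} \<union> wall n" using words(2)[OF flower_codeI(2)] by blast
    then have "v \<in> C" using PS by (auto simp: C_def wall_def)
    then show "C \<inter> Rn d \<noteq> {}" using v(1) by blast
    show "openin (top_of_set (Rn d)) (Y Link)" "convex (Y Link)" using op[OF link_base_sub(2)] by auto
    show "p i \<in> Y (Petal i) \<inter> Y Link \<inter> Rn d" if "i < n" for i using p[OF that] YR[OF PS[OF that]] by blast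
  qed simp_all
  then obtain v where v: "v \<in> C" "v \<in> Y Link" by blast
  then have "v \<in> Rn d" using YR[OF link_base_sub(2)] by blast
  moreover have "v \<in> Y (Petal 0)" "v \<in> Y (Petal 1)" using v(1) n by (auto simp: C_def)
  ultimately show False using meet(3)[of v 0 1] v(2) n link_base_sub(2) by auto
qed

lemma segment_meets_both:
  fixes p q :: "'a::real_normed_vector"
  assumes sub: "closed_segment p q \<subseteq> G \<union> H" and pq: "p \<in> G" "q \<in> H"
    and op: "(\<exists>A. openin (top_of_set A) G \<and> openin (top_of_set A) H \<and> closed_segment p q \<subseteq> A) \<or> closed G \<and> closed H"
  shows "\<exists>x\<in>closed_segment p q. x \<in> G \<and> x \<in> H"
proof (rule ccontr)
  assume none: "\<not> ?thesis"
  let ?s = "closed_segment p q"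
  have con: "connected ?s" by (rule connected_segment)
  have ne: "?s \<inter> G \<noteq> {}" "?s \<inter> H \<noteq> {}" using pq by auto
  from op show False
  proof
    assume "\<exists>A. openin (top_of_set A) G \<and> openin (top_of_set A) H \<and> ?s \<subseteq> A"
    then obtain A S T where "open S" "G = A \<inter> S" "open T" "H = A \<inter> T" "?s \<subseteq> A" by (auto simp: openin_open)
    then show False using con none ne sub unfolding connected_def by blast
  next
    assume "closed G \<and> closed H"
    then show False using con none ne sub unfolding connected_closed by blast
  qed
qed

lemma plane_through:
  fixes p q c :: "'a::real_vector"
  shows "p \<in> (+) p ` span {q - p, c - p}" "q \<in> (+) p ` span {q - p, c - p}" "c \<in> (+) p ` span {q - p, c - p}"
proof -
  have "p = p + 0" "q = p + (q - p)" "c = p + (c - p)" by simp_all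
  then show "p \<in> (+) p ` span {q - p, c - p}" "q \<in> (+) p ` span {q - p, c - p}" "c \<in> (+) p ` span {q - p, c - p}"
    using span_zero span_base[of "q - p" "{q - p, c - p}"] span_base[of "c - p" "{q - p, c - p}"] by (metis imageI insertI1 insert_commute)+
qed

lemma plane_through_subset:
  assumes A: "A = (+) a ` span B" and pqc: "p \<in> A" "q \<in> A" "c \<in> A"
  shows "(+) p ` span {q - p, c - p} \<subseteq> A"
proof -
  have d: "x - y \<in> span B" if xy: "x \<in> A" "y \<in> A" for x y
  proof -
    obtain u v where "x = a + u" "y = a + v" "u \<in> span B" "v \<in> span B" using xy A by blast
    then show ?thesis by (simp add: span_diff)
  qed
  have "span {q - p, c - p} \<subseteq> span B" using d pqc by (intro span_minimal) auto
  moreover obtain u where "p = a + u" "u \<in> span B" using pqc(1) A by blast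
  ultimately show ?thesis unfolding A by (auto simp: add.assoc intro!: imageI span_add)
qed

lemma below_3_cases: "i < (3::nat) \<longleftrightarrow> i = 0 \<or> i = 1 \<or> i = 2"
  by linarith

text \<open>A segment in the link from petal 0 to petal 2 is covered by two open pieces, so it passes through
  their overlap and there lies in petal 1.  Its three points in the petals are collinear, hence lie in a
  common plane with a point of the centre, and three petals are too many for a plane.\<close>

theorem open_link_shared_bound:
  assumes real: "open_realizable d (link_base 3 2) (link_code 3 2 shared_corner)"
  shows False
proof -
  let ?S = "link_base 3 2"
  obtain U where U: "open_convex_realization d ?S (link_code 3 2 shared_corner) U" using real by blast
  define Y where "Y \<nu> = fvecs (U \<nu>)" for \<nu>
  have code: "code_of d ?S U = link_code 3 2 shared_corner" using U by (simp add: open_convex_realization_def)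
  note words = realization_words[OF code, folded Y_def]
  have op: "openin (top_of_set (Rn d)) (Y \<nu>)" "convex (Y \<nu>)" if "\<nu> \<in> ?S" for \<nu>
    using U that by (auto simp: open_convex_realization_def Y_def openin_fvecs convex_fvecs)
  have YR: "Y \<nu> \<subseteq> Rn d" if "\<nu> \<in> ?S" for \<nu> using op(1)[OF that] openin_imp_subset by blast
  have PS: "Petal i \<in> ?S" if "i < 3" for i using that base_members(1) link_base_sub by blast
  have HS: "Piece 0 \<in> ?S" "Piece 1 \<in> ?S" by (simp_all add: link_base_def base_def)
  note meet = petals_meet[OF words(1) linked_shared_corner link_base_sub(1)]
  define C where "C = (\<Inter>i<3. Y (Petal i))"
  have "insert (Petal 0) (piece_word 0) \<in> shared_corner" "insert (Petal 2) (piece_word 1) \<in> shared_corner"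
    by (simp_all add: shared_corner_def)
  note wit = this[THEN flower_code_linkI, THEN words(2)]
  obtain p where p: "\<forall>\<nu>\<in>?S. p \<in> Y \<nu> \<longleftrightarrow> \<nu> \<in> {Ambient, Low, Link} \<union> insert (Petal 0) (piece_word 0)" using wit(1) by blast
  obtain q where q: "\<forall>\<nu>\<in>?S. q \<in> Y \<nu> \<longleftrightarrow> \<nu> \<in> {Ambient, Low, Link} \<union> insert (Petal 2) (piece_word 1)" using wit(2) by blast
  have pq: "p \<in> Y Link" "p \<in> Y (Petal 0)" "p \<in> Y (Piece 0)" "q \<in> Y Link" "q \<in> Y (Petal 2)" "q \<in> Y (Piece 1)"
    using p q PS[of 0] PS[of 2] HS link_base_sub(2)[of 3 2] by (simp_all add: piece_word_def)
  let ?s = "closed_segment p q"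
  have sL: "?s \<subseteq> Y Link" using pq op(2)[OF link_base_sub(2)] by (intro closed_segment_subset) auto
  have sR: "?s \<subseteq> Rn d" using sL YR[OF link_base_sub(2)] by blast
  have "?s \<subseteq> Y (Piece 0) \<union> Y (Piece 1)"
  proof
    fix v assume v: "v \<in> ?s"
    then obtain \<sigma> where \<sigma>: "\<sigma> \<in> flower_code 3 shared_corner" "\<forall>\<nu>\<in>?S. v \<in> Y \<nu> \<longleftrightarrow> \<nu> \<in> \<sigma>" using words(1) sR by blast
    have "Link \<in> \<sigma>" using \<sigma>(2) v sL link_base_sub(2) by blast
    then obtain i where "i < 2" "Piece i \<in> \<sigma>" using flower_code_facts(6)[OF linked_shared_corner \<sigma>(1)] by blast
    then have "Piece 0 \<in> \<sigma> \<or> Piece 1 \<in> \<sigma>" by (auto simp: less_2_cases_iff)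
    then show "v \<in> Y (Piece 0) \<union> Y (Piece 1)" using \<sigma>(2) HS by blast
  qed
  then obtain x where x: "x \<in> ?s" "x \<in> Y (Piece 0)" "x \<in> Y (Piece 1)"
    using segment_meets_both[of p q "Y (Piece 0)" "Y (Piece 1)"] pq op(1)[OF HS(1)] op(1)[OF HS(2)] sR by blast
  have x1: "x \<in> Y (Petal 1)"
  proof -
    obtain \<sigma> where \<sigma>: "\<sigma> \<in> flower_code 3 shared_corner" "\<forall>\<nu>\<in>?S. x \<in> Y \<nu> \<longleftrightarrow> \<nu> \<in> \<sigma>" using words(1) sR x(1) by blast
    then show ?thesis using shared_corner_Petal[OF \<sigma>(1)] x HS PS[of 1] by simp
  qed
  obtain c where c: "c \<in> Rn d" "\<forall>\<nu>\<in>?S. c \<in> Y \<nu> \<longleftrightarrow> \<nu> \<in> {Ambient} \<union> wall 3" using words(2)[OF flower_codeI(2)] by blast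
  then have cC: "c \<in> C" using PS by (auto simp: C_def wall_def)
  define A where "A = (+) p ` span {q - p, c - p}"
  have mem: "p \<in> A" "q \<in> A" "c \<in> A" unfolding A_def by (rule plane_through)+
  have AR: "A \<subseteq> Rn d"
    unfolding A_def by (rule plane_through_subset[of "Rn d" 0 "unitv ` {..<d}"]) (use sR c(1) in \<open>auto simp: Rn_eq_span\<close>)
  have "convex A" unfolding A_def by (rule convex_translation[OF subspace_imp_convex[OF subspace_span]])
  then have xA: "x \<in> A" using x(1) closed_segment_subset[OF mem(1,2)] by blast
  define r where "r i = (if i = 0 then p else if i = 1 then x else q)" for i :: nat
  have "C \<inter> Y Link \<noteq> {}"
  proof (rule open_flower_meets_link[where a = p and B = "{q - p, c - p}" and A = A and d = d and m = 3 and U = "\<lambda>i. Y (Petal i)" and p = r])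
    show "card {q - p, c - p} < 3" using card_insert_le_m1[of 2 "{c - p}" "q - p"] by simp
    show "openin (top_of_set (Rn d)) (Y (Petal i)) \<and> convex (Y (Petal i)) \<and> C \<subseteq> Y (Petal i)" if "i < 3" for i
      using op[OF PS[OF that]] that by (auto simp: C_def)
    show "Y (Petal i) \<inter> Y (Petal j) \<subseteq> C" if "i < 3" "j < 3" "i \<noteq> j" for i j
    proof
      fix v assume v: "v \<in> Y (Petal i) \<inter> Y (Petal j)"
      then have "v \<in> Rn d" using YR[OF PS[OF that(1)]] by blast
      then show "v \<in> C" using meet(1)[of v i j] that v by (auto simp: C_def)
    qed
    show "C \<inter> A \<noteq> {}" using cC mem(3) by blast
    show "openin (top_of_set (Rn d)) (Y Link)" "convex (Y Link)" using op[OF link_base_sub(2)] by auto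
    show "r i \<in> Y (Petal i) \<inter> Y Link \<inter> A" if "i < 3" for i
      using that pq mem x x1 xA sL unfolding below_3_cases r_def by auto
  qed (use AR A_def in simp_all)
  then obtain v where v: "v \<in> C" "v \<in> Y Link" by blast
  then have "v \<in> Rn d" using YR[OF link_base_sub(2)] by blast
  moreover have "v \<in> Y (Petal 0)" "v \<in> Y (Petal 1)" using v(1) by (auto simp: C_def)
  ultimately show False using meet(3)[of v 0 1] v(2) link_base_sub(2) by auto
qed

subsection \<open>Closed realizations in which the centre is thick\<close>

text \<open>A ball that contains a point of each overlap cuts the pieces down to compact sets without breaking
  the chain.\<close>

lemma compact_chain:
  assumes real: "closed_convex_realization d S (pull id S (flower_code m I)) X" and S: "base m n \<subseteq> S"
    and I: "linked_words n I" and n: "n \<ge> 1"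
    and corners: "\<And>i. Suc i < n \<Longrightarrow> \<exists>w\<in>I. Piece i \<in> w \<and> Piece (Suc i) \<in> w"
    and P: "finite (P :: fvec set)"
  shows "\<exists>r. P \<subseteq> cball 0 r \<and> (\<forall>i<n. compact (fvecs (X (Piece i)) \<inter> cball 0 r))
           \<and> convex (\<Union>i<n. fvecs (X (Piece i)) \<inter> cball 0 r)"
proof -
  define Y where "Y \<nu> = fvecs (X \<nu>)" for \<nu>
  have code: "code_of d S X = pull id S (flower_code m I)" using real by (simp add: closed_convex_realization_def)
  note words = realization_words[OF code, folded Y_def]
  have cl: "closed (Y \<nu>)" "Y \<nu> \<subseteq> Rn d" "convex (Y \<nu>)" if "\<nu> \<in> S" for \<nu>
    using real that closed_fvecs[of d "X \<nu>"] by (auto simp: closed_convex_realization_def Y_def convex_fvecs)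
  have mem: "Piece i \<in> S" "Lpart i \<in> S" "Rpart i \<in> S" if "i < n" for i
    using S that base_members(2-4)[of i n m] by blast+
  have "\<forall>i. \<exists>v. Suc i < n \<longrightarrow> v \<in> Y (Piece i) \<inter> Y (Piece (Suc i))"
  proof
    fix i
    show "\<exists>v. Suc i < n \<longrightarrow> v \<in> Y (Piece i) \<inter> Y (Piece (Suc i))"
    proof (cases "Suc i < n")
      case True
      then obtain w where w: "w \<in> I" "Piece i \<in> w" "Piece (Suc i) \<in> w" using corners by blast
      obtain v where "\<forall>\<nu>\<in>S. v \<in> Y \<nu> \<longleftrightarrow> \<nu> \<in> {Ambient, Low, Link} \<union> w" using words(2)[OF flower_code_linkI[OF w(1)]] by blast
      then show ?thesis using w mem(1)[of i] mem(1)[OF True] True by (intro exI[of _ v]) simp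
    qed simp
  qed
  then obtain q where q: "\<And>i. Suc i < n \<Longrightarrow> q i \<in> Y (Piece i) \<inter> Y (Piece (Suc i))" by metis
  have "finite (P \<union> q ` {..<n})" using P by simp
  then obtain r where r: "\<And>x. x \<in> P \<union> q ` {..<n} \<Longrightarrow> norm x \<le> r" using finite_imp_bounded bounded_iff by metis
  define H where "H i = Y (Piece i) \<inter> cball 0 r" for i
  have HR: "H i \<subseteq> Rn d" if "i < n" for i using cl(2)[OF mem(1)[OF that]] by (auto simp: H_def)
  have cH: "compact (H i)" if "i < n" for i
  proof (rule Rn_heine_borel[OF HR[OF that]])
    show "closed (H i)" unfolding H_def using cl(1)[OF mem(1)[OF that]] by (intro closed_Int closed_cball)
    show "bounded (H i)" unfolding H_def by (intro bounded_Int) simp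
  qed
  have word: "\<exists>\<sigma>\<in>flower_code m I. \<forall>\<nu>\<in>S. v \<in> Y \<nu> \<longleftrightarrow> \<nu> \<in> \<sigma>" if "v \<in> H i" "i < n" for v i
    using words(1) HR[OF that(2)] that(1) by blast
  have "convex (\<Union>i\<le>n - 1. H i)"
  proof (rule convex_chain_Union[where L = "\<lambda>i. Y (Lpart i)" and R = "\<lambda>i. Y (Rpart i)" and n = n])
    show "compact (H i) \<and> convex (H i) \<and> closed (Y (Lpart i)) \<and> closed (Y (Rpart i))" if "i < n" for i
      using cH[OF that] cl(3)[OF mem(1)[OF that]] cl(1)[OF mem(2)[OF that]] cl(1)[OF mem(3)[OF that]]
      by (simp add: H_def convex_Int)
  next
    fix i assume i: "Suc i < n"
    then have i': "i < n" by simp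
    show "H i \<subseteq> Y (Lpart i) \<union> H (Suc i)"
    proof
      fix v assume v: "v \<in> H i"
      obtain \<sigma> where s: "\<sigma> \<in> flower_code m I" "\<forall>\<nu>\<in>S. v \<in> Y \<nu> \<longleftrightarrow> \<nu> \<in> \<sigma>" using word[OF v i'] by blast
      then show "v \<in> Y (Lpart i) \<union> H (Suc i)"
        using flower_code_facts(2)[OF I s(1) _ i] v mem[OF i'] mem[OF i] by (auto simp: H_def)
    qed
    show "H (Suc i) \<subseteq> Y (Rpart (Suc i)) \<union> H i"
    proof
      fix v assume v: "v \<in> H (Suc i)"
      obtain \<sigma> where s: "\<sigma> \<in> flower_code m I" "\<forall>\<nu>\<in>S. v \<in> Y \<nu> \<longleftrightarrow> \<nu> \<in> \<sigma>" using word[OF v i] by blast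
      then show "v \<in> Y (Rpart (Suc i)) \<union> H i"
        using flower_code_facts(3)[OF I s(1), of i] v mem[OF i'] mem[OF i] by (auto simp: H_def)
    qed
    show "Y (Lpart i) \<inter> Y (Rpart (Suc i)) = {}"
    proof (rule equals0I)
      fix v assume v: "v \<in> Y (Lpart i) \<inter> Y (Rpart (Suc i))"
      then have "v \<in> Rn d" using cl(2)[OF mem(2)[OF i']] by blast
      then obtain \<sigma> where s: "\<sigma> \<in> flower_code m I" "\<forall>\<nu>\<in>S. v \<in> Y \<nu> \<longleftrightarrow> \<nu> \<in> \<sigma>" using words(1) by blast
      then show False using flower_code_facts(4)[OF I s(1), of i] v mem[OF i'] mem[OF i] by auto
    qed
    show "H i \<inter> H (Suc i) \<noteq> {}" using q[OF i] r[of "q i"] i' by (auto simp: H_def)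
  next
    fix i j assume j: "j < n" "Suc i < j"
    then have i: "i < n" by simp
    show "H i \<inter> H j = {}"
    proof (rule equals0I)
      fix v assume v: "v \<in> H i \<inter> H j"
      obtain \<sigma> where s: "\<sigma> \<in> flower_code m I" "\<forall>\<nu>\<in>S. v \<in> Y \<nu> \<longleftrightarrow> \<nu> \<in> \<sigma>" using word[of v i] v i by blast
      then have "Piece i \<in> \<sigma>" "Piece j \<in> \<sigma>" using v mem(1)[OF i] mem(1)[OF j(1)] by (auto simp: H_def)
      then show False using flower_code_facts(5)[OF I s(1), of i j] j by simp
    qed
  qed (use n in simp)
  moreover have "{..n - 1} = {..<n}" using n by auto
  ultimately have "convex (\<Union>i<n. H i)" by simp
  moreover have "P \<subseteq> cball 0 r" using r by auto
  ultimately show ?thesis using cH unfolding H_def Y_def by blast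
qed

text \<open>Here the convex chain touches all petals and avoids the thick centre.\<close>

lemma closed_private_bound:
  assumes real: "closed_convex_realization d S (pull id S (flower_code n (private_pieces n))) X"
    and S: "base n n \<subseteq> S" and n: "n \<ge> 2"
    and A: "A = (+) a ` span B" "A \<subseteq> Rn d" "finite B"
    and petals: "\<And>i. i < n \<Longrightarrow> fvecs (X (Petal i)) \<subseteq> A"
    and c: "c \<in> top_of_set A interior_of (\<Inter>i<n. fvecs (X (Petal i)))"
  shows "n \<le> card B"
proof (rule ccontr)
  assume less: "\<not> n \<le> card B"
  let ?I = "private_pieces n"
  define Y where "Y \<nu> = fvecs (X \<nu>)" for \<nu>
  have code: "code_of d S X = pull id S (flower_code n ?I)" using real by (simp add: closed_convex_realization_def)
  note words = realization_words[OF code, folded Y_def]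
  have cl: "closed (Y \<nu>)" "Y \<nu> \<subseteq> Rn d" "convex (Y \<nu>)" if "\<nu> \<in> S" for \<nu>
    using real that closed_fvecs[of d "X \<nu>"] by (auto simp: closed_convex_realization_def Y_def convex_fvecs)
  have PS: "Petal i \<in> S" "Piece i \<in> S" if "i < n" for i using that base_members(1,2)[of i n n] S by blast+
  note meet = petals_meet[OF words(1) linked_private_pieces S]
  define C where "C = (\<Inter>i<n. Y (Petal i))"
  have "\<exists>v. v \<in> Y (Petal i) \<inter> Y (Piece i)" if i: "i < n" for i
  proof -
    have "{Ambient, Low, Link} \<union> insert (Petal i) (piece_word i) \<in> flower_code n ?I"
      by (rule flower_code_linkI[OF private_piecesI(2)[OF i]])
    from words(2)[OF this] obtain v where "\<forall>\<nu>\<in>S. v \<in> Y \<nu> \<longleftrightarrow> \<nu> \<in> {Ambient, Low, Link} \<union> insert (Petal i) (piece_word i)" by blast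
    then show ?thesis using PS[OF i] by (intro exI[of _ v]) (simp add: piece_word_def)
  qed
  then have "\<forall>i. \<exists>v. i < n \<longrightarrow> v \<in> Y (Petal i) \<inter> Y (Piece i)" by blast
  then obtain p where p: "\<And>i. i < n \<Longrightarrow> p i \<in> Y (Petal i) \<inter> Y (Piece i)" by metis
  have corners: "\<exists>w\<in>?I. Piece i \<in> w \<and> Piece (Suc i) \<in> w" if "Suc i < n" for i
  proof (rule bexI[of _ "corner_word i"])
    show "corner_word i \<in> ?I" using that by (intro private_piecesI(1)) (auto simp: chain_words_def corner_words_def)
  qed (simp add: corner_word_def)
  have "n \<ge> 1" using n by simp
  from compact_chain[OF real S linked_private_pieces this corners finite_imageI[OF finite_lessThan[of n], of p], folded Y_def]
  obtain r where r: "p ` {..<n} \<subseteq> cball 0 r" "\<forall>i<n. compact (Y (Piece i) \<inter> cball 0 r)"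
    "convex (\<Union>i<n. Y (Piece i) \<inter> cball 0 r)" by blast
  define K where "K = (\<Union>i<n. Y (Piece i) \<inter> cball 0 r)"
  have "K \<inter> C \<noteq> {}"
  proof (rule closed_sunflower[where A = A and a = a and B = B and I = "{..<n}" and W = "\<lambda>i. Y (Petal i)" and c = c and p = p])
    show "finite B" "finite {..<n}" "card B < card {..<n}" using A less by simp_all
    show "A = (+) a ` span B" by (rule A(1))
    show "compact Z" if "Z \<subseteq> A" "closed Z" "bounded Z" for Z
      using Rn_heine_borel[of Z d] that A(2) by blast
    show "Y (Petal i) \<subseteq> A \<and> convex (Y (Petal i)) \<and> C \<subseteq> Y (Petal i)" if "i \<in> {..<n}" for i
      using that petals[of i] cl(3)[OF PS(1)[of i]] by (auto simp: C_def Y_def)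
    show "Y (Petal i) \<inter> Y (Petal j) \<subseteq> C" if ij: "i \<in> {..<n}" "j \<in> {..<n}" "i \<noteq> j" for i j
    proof
      fix v assume v: "v \<in> Y (Petal i) \<inter> Y (Petal j)"
      then have "v \<in> Rn d" using cl(2)[OF PS(1)[of i]] ij by auto
      then show "v \<in> C" using meet(1)[of v i j] ij v by (auto simp: C_def)
    qed
    show "closed C" unfolding C_def using cl(1) PS(1) by (intro closed_INT ballI) simp
    show "c \<in> top_of_set A interior_of C" using c by (simp add: C_def Y_def)
    show "compact K" unfolding K_def using r(2) by (intro compact_UN) auto
    show "convex K" unfolding K_def by (rule r(3))
    show "p i \<in> Y (Petal i) \<inter> K" if i: "i \<in> {..<n}" for i
    proof -
      have "p i \<in> Y (Piece i) \<inter> cball 0 r" using p[of i] r(1) i by blast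
      then show ?thesis using p[of i] i unfolding K_def by blast
    qed
  qed
  then obtain v i where v: "v \<in> C" "v \<in> Y (Piece i)" "i < n" unfolding K_def by blast
  then have "v \<in> Rn d" using cl(2)[OF PS(2)] by blast
  moreover have "v \<in> Y (Petal 0)" "v \<in> Y (Petal 1)" using v(1) n by (auto simp: C_def)
  ultimately show False using meet(2)[of v 0 1 i] v(2,3) n by auto
qed

text \<open>As for open sets, three collinear points lie in the three petals.  The plane through them is taken
  through an interior point of the centre, so that the centre stays thick in it.\<close>

lemma closed_shared_bound:
  assumes real: "closed_convex_realization d S (pull id S (flower_code 3 shared_corner)) X"
    and S: "base 3 2 \<subseteq> S"
    and A: "A = (+) a ` span B" "A \<subseteq> Rn d"
    and petals: "\<And>i. i < 3 \<Longrightarrow> fvecs (X (Petal i)) \<subseteq> A"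
    and c: "c \<in> top_of_set A interior_of (\<Inter>i<3. fvecs (X (Petal i)))"
  shows False
proof -
  let ?I = shared_corner
  define Y where "Y \<nu> = fvecs (X \<nu>)" for \<nu>
  have code: "code_of d S X = pull id S (flower_code 3 ?I)" using real by (simp add: closed_convex_realization_def)
  note words = realization_words[OF code, folded Y_def]
  have cl: "closed (Y \<nu>)" "Y \<nu> \<subseteq> Rn d" "convex (Y \<nu>)" if "\<nu> \<in> S" for \<nu>
    using real that closed_fvecs[of d "X \<nu>"] by (auto simp: closed_convex_realization_def Y_def convex_fvecs)
  have PS: "Petal i \<in> S" if "i < 3" for i using that base_members(1)[of i 3 2] S by blast
  have HS: "Piece 0 \<in> S" "Piece 1 \<in> S" using S by (auto simp: base_def)
  note meet = petals_meet[OF words(1) linked_shared_corner S]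
  define C where "C = (\<Inter>i<3. Y (Petal i))"
  have "insert (Petal 0) (piece_word 0) \<in> shared_corner" "insert (Petal 2) (piece_word 1) \<in> shared_corner"
    by (simp_all add: shared_corner_def)
  note wit = this[THEN flower_code_linkI, THEN words(2)]
  obtain p where p: "\<forall>\<nu>\<in>S. p \<in> Y \<nu> \<longleftrightarrow> \<nu> \<in> {Ambient, Low, Link} \<union> insert (Petal 0) (piece_word 0)" using wit(1) by blast
  obtain q where q: "\<forall>\<nu>\<in>S. q \<in> Y \<nu> \<longleftrightarrow> \<nu> \<in> {Ambient, Low, Link} \<union> insert (Petal 2) (piece_word 1)" using wit(2) by blast
  have pq: "p \<in> Y (Petal 0)" "p \<in> Y (Piece 0)" "q \<in> Y (Petal 2)" "q \<in> Y (Piece 1)"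
    using p q PS[of 0] PS[of 2] HS by (simp_all add: piece_word_def)
  have corners: "\<exists>w\<in>?I. Piece i \<in> w \<and> Piece (Suc i) \<in> w" if "Suc i < 2" for i
    using that by (intro bexI[of _ "insert (Petal 1) (corner_word 0)"]) (auto simp: shared_corner_def corner_words_def corner_word_def)
  have "finite {p, q}" "(2::nat) \<ge> 1" by simp_all
  from compact_chain[OF real S linked_shared_corner this(2) corners this(1), folded Y_def]
  obtain r where r: "{p, q} \<subseteq> cball 0 r" "\<forall>i<2. compact (Y (Piece i) \<inter> cball 0 r)"
    "convex (\<Union>i<2. Y (Piece i) \<inter> cball 0 r)" by blast
  have K: "(\<Union>i<2. Y (Piece i) \<inter> cball 0 r) = (Y (Piece 0) \<union> Y (Piece 1)) \<inter> cball 0 r"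
    by (auto simp: less_2_cases_iff)
  let ?s = "closed_segment p q"
  have s: "?s \<subseteq> Y (Piece 0) \<union> Y (Piece 1)"
  proof -
    have "?s \<subseteq> (Y (Piece 0) \<union> Y (Piece 1)) \<inter> cball 0 r"
      using r(1,3) pq unfolding K by (intro closed_segment_subset) auto
    then show ?thesis by blast
  qed
  have sR: "?s \<subseteq> Rn d" using s cl(2)[OF HS(1)] cl(2)[OF HS(2)] by blast
  obtain x where x: "x \<in> ?s" "x \<in> Y (Piece 0)" "x \<in> Y (Piece 1)"
    using segment_meets_both[OF s pq(2,4)] cl(1)[OF HS(1)] cl(1)[OF HS(2)] by blast
  have x1: "x \<in> Y (Petal 1)"
  proof -
    obtain \<sigma> where \<sigma>: "\<sigma> \<in> flower_code 3 shared_corner" "\<forall>\<nu>\<in>S. x \<in> Y \<nu> \<longleftrightarrow> \<nu> \<in> \<sigma>" using words(1) sR x(1) by blast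
    then show ?thesis using shared_corner_Petal[OF \<sigma>(1)] x HS PS[of 1] by simp
  qed
  define A' where "A' = (+) p ` span {q - p, c - p}"
  have mem: "p \<in> A'" "q \<in> A'" "c \<in> A'" unfolding A'_def by (rule plane_through)+
  have C: "top_of_set A interior_of C \<subseteq> C" "c \<in> top_of_set A interior_of C" "C \<subseteq> A"
  proof -
    show "top_of_set A interior_of C \<subseteq> C" by (rule interior_of_subset)
    show "c \<in> top_of_set A interior_of C" using c by (simp add: C_def Y_def)
    have "C \<subseteq> Y (Petal 0)" by (auto simp: C_def)
    then show "C \<subseteq> A" using petals[of 0] by (simp add: Y_def)
  qed
  have AA: "A' \<subseteq> A"
    unfolding A'_def by (rule plane_through_subset[OF A(1)]) (use pq petals[of 0] petals[of 2] C in \<open>auto simp: Y_def\<close>)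
  have cA: "convex A'" unfolding A'_def by (rule convex_translation[OF subspace_imp_convex[OF subspace_span]])
  have sA: "?s \<subseteq> A'" using closed_segment_subset[OF mem(1,2) cA] .
  have clA: "closed A'"
    unfolding A'_def by (intro closed_translation closed_span_finite) simp
  define u where "u i = (if i = 0 then p else if i = 1 then x else q)" for i :: nat
  have "?s \<inter> (C \<inter> A') \<noteq> {}"
  proof (rule closed_sunflower[where A = A' and a = p and B = "{q - p, c - p}" and I = "{..<3}" and W = "\<lambda>i. Y (Petal i) \<inter> A'" and c = c and p = u])
    show "card {q - p, c - p} < card {..<3::nat}" using card_insert_le_m1[of 2 "{c - p}" "q - p"] by simp
    show "A' = (+) p ` span {q - p, c - p}" by (rule A'_def)
    show "compact Z" if "Z \<subseteq> A'" "closed Z" "bounded Z" for Z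
      using Rn_heine_borel[of Z d] that AA A(2) by blast
    show "Y (Petal i) \<inter> A' \<subseteq> A' \<and> convex (Y (Petal i) \<inter> A') \<and> C \<inter> A' \<subseteq> Y (Petal i) \<inter> A'" if "i \<in> {..<3}" for i
      using that convex_Int[OF cl(3)[OF PS[of i]] cA] by (auto simp: C_def)
    show "(Y (Petal i) \<inter> A') \<inter> (Y (Petal j) \<inter> A') \<subseteq> C \<inter> A'" if ij: "i \<in> {..<3}" "j \<in> {..<3}" "i \<noteq> j" for i j
    proof
      fix v assume v: "v \<in> (Y (Petal i) \<inter> A') \<inter> (Y (Petal j) \<inter> A')"
      then have "v \<in> Rn d" using cl(2)[OF PS[of i]] ij by auto
      then show "v \<in> C \<inter> A'" using meet(1)[of v i j] ij v by (auto simp: C_def)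
    qed
    show "closed (C \<inter> A')" unfolding C_def using cl(1) PS clA by (intro closed_Int closed_INT ballI) simp_all
    have "openin (top_of_set A') ((top_of_set A interior_of C) \<inter> A')"
      using AA by (intro openin_subset_section[OF openin_interior_of])
    moreover have "(top_of_set A interior_of C) \<inter> A' \<subseteq> C \<inter> A'" using C(1) by blast
    ultimately have "(top_of_set A interior_of C) \<inter> A' \<subseteq> top_of_set A' interior_of (C \<inter> A')" by (intro interior_of_maximal)
    then show "c \<in> top_of_set A' interior_of (C \<inter> A')" using C(2) mem(3) by blast
    show "u i \<in> (Y (Petal i) \<inter> A') \<inter> ?s" if "i \<in> {..<3}" for i
      using that pq mem x x1 sA unfolding lessThan_iff below_3_cases u_def by auto
  qed simp_all
  then obtain v where v: "v \<in> C" "v \<in> ?s" by blast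
  then have "v \<in> Rn d" "v \<in> Y (Piece 0) \<or> v \<in> Y (Piece 1)" using sR s by auto
  moreover have "v \<in> Y (Petal 0)" "v \<in> Y (Petal 1)" using v(1) by (auto simp: C_def)
  ultimately show False using meet(2)[of v 0 1] by auto
qed

subsection \<open>Where thick centres come from\<close>

text \<open>In a nondegenerate closed realization the interiors attain each codeword; in a nondegenerate open
  one the closures form a closed realization whose interiors contain the given open sets.\<close>

lemma nd_realizable_thick:
  assumes real: "nd_realizable d S C" and \<sigma>: "\<sigma> \<in> C"
  shows "\<exists>X p. closed_convex_realization d S C X \<and> p \<in> topspace (Esp d) \<and> (\<forall>\<nu>\<in>\<sigma>. p \<in> Esp d interior_of X \<nu>)"
  using real
proof
  assume "\<exists>U. open_convex_realization d S C U \<and> nondegenerate_open d S U"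
  then obtain U where U: "open_convex_realization d S C U" "nondegenerate_open d S U" by blast
  let ?X = "\<lambda>\<nu>. Esp d closure_of U \<nu>"
  have "closed_convex_realization d S C ?X"
    using U by (auto simp: closed_convex_realization_def open_convex_realization_def nondegenerate_open_def convex_fun_closure_of)
  moreover have "\<sigma> \<in> code_of d S U" using U(1) \<sigma> by (simp add: open_convex_realization_def)
  then obtain p where p: "p \<in> topspace (Esp d)" "\<sigma> = {\<nu> \<in> S. p \<in> U \<nu>}" by (rule code_ofE)
  moreover have "p \<in> Esp d interior_of ?X \<nu>" if "\<nu> \<in> \<sigma>" for \<nu>
  proof -
    have op: "openin (Esp d) (U \<nu>)" using that p(2) U(1) by (simp add: open_convex_realization_def)
    then have "U \<nu> \<subseteq> Esp d interior_of ?X \<nu>"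
      by (intro interior_of_maximal closure_of_subset openin_subset)
    then show ?thesis using that p(2) by blast
  qed
  ultimately show ?thesis by blast
next
  assume "nd_closed_realizable d S C"
  then obtain X where X: "closed_convex_realization d S C X" "nondegenerate_closed d S X" by blast
  then have "\<sigma> \<in> code_of d S (\<lambda>\<nu>. Esp d interior_of X \<nu>)"
    using \<sigma> by (simp add: closed_convex_realization_def nondegenerate_closed_def)
  then obtain p where "p \<in> topspace (Esp d)" "\<sigma> = {\<nu> \<in> S. p \<in> Esp d interior_of X \<nu>}" by (rule code_ofE)
  then show ?thesis using X(1) by (intro exI[of _ X] exI[of _ p]) simp
qed

lemma nd_flower_thick:
  assumes real: "nd_realizable d (base m n) (pull id (base m n) (flower_code m I))" and m: "m \<ge> 1"
  shows "\<exists>X c. closed_convex_realization d (base m n) (pull id (base m n) (flower_code m I)) X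
           \<and> c \<in> top_of_set (Rn d) interior_of (\<Inter>i<m. fvecs (X (Petal i))) \<and> (\<forall>i<m. fvecs (X (Petal i)) \<subseteq> Rn d)"
proof -
  have "wall m \<in> pull id (base m n) (flower_code m I)"
    by (rule pull_idI[OF flower_codeI(2)]) (use wall_Pow[of m n] base_no_Link[of m n] in auto)
  from nd_realizable_thick[OF real this] obtain X p where
    X: "closed_convex_realization d (base m n) (pull id (base m n) (flower_code m I)) X"
    and p: "p \<in> topspace (Esp d)" "\<forall>\<nu>\<in>wall m. p \<in> Esp d interior_of X \<nu>" by blast
  obtain c where c: "coord c = p" using p(1) by (rule topspace_coord)
  define G where "G = (\<Inter>i<m. fvecs (Esp d interior_of X (Petal i)))"
  have "openin (top_of_set (Rn d)) G"
  proof -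
    have "{..<m} \<noteq> {}" using m by (simp add: lessThan_empty_iff)
    then show ?thesis unfolding G_def by (intro openin_INT2 openin_fvecs openin_interior_of) simp_all
  qed
  moreover have "fvecs (Esp d interior_of X \<nu>) \<subseteq> fvecs (X \<nu>)" for \<nu>
    using interior_of_subset[of "Esp d" "X \<nu>"] by (auto simp: fvecs_def)
  then have "G \<subseteq> (\<Inter>i<m. fvecs (X (Petal i)))" unfolding G_def by blast
  ultimately have "G \<subseteq> top_of_set (Rn d) interior_of (\<Inter>i<m. fvecs (X (Petal i)))" by (intro interior_of_maximal)
  moreover have "c \<in> G" using p(2) c by (auto simp: G_def fvecs_def wall_def)
  moreover have "fvecs (X (Petal i)) \<subseteq> Rn d" if "i < m" for i
    using X base_members(1)[OF that, of n] closed_fvecs(2) by (auto simp: closed_convex_realization_def)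
  ultimately show ?thesis using X by blast
qed

text \<open>\<open>Low\<close> and \<open>High\<close> are closed and disjoint, so the segment between a point of each leaves both of
  them, at a point \<open>x\<close> of \<open>Ambient\<close>.  All points of \<open>Ambient\<close> near \<open>x\<close> lie in the centre, and among them
  are interior points of \<open>Ambient\<close> relative to its flat.\<close>

lemma split_flower_thick:
  assumes real: "closed_convex_realization d (split_base m n) (split_code m n I) X" and I: "linked_words n I"
  shows "\<exists>a B c. finite B \<and> card B \<le> d \<and> (+) a ` span B \<subseteq> Rn d \<and> (\<forall>i<m. fvecs (X (Petal i)) \<subseteq> (+) a ` span B)
           \<and> c \<in> top_of_set ((+) a ` span B) interior_of (\<Inter>i<m. fvecs (X (Petal i)))"
proof -
  let ?S = "split_base m n"
  define Y where "Y \<nu> = fvecs (X \<nu>)" for \<nu>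
  have code: "code_of d ?S X = split_code m n I" using real by (simp add: closed_convex_realization_def)
  note words = realization_words[OF code, folded Y_def]
  have cl: "closed (Y \<nu>)" "Y \<nu> \<subseteq> Rn d" "convex (Y \<nu>)" if "\<nu> \<in> ?S" for \<nu>
    using real that closed_fvecs[of d "X \<nu>"] by (auto simp: closed_convex_realization_def Y_def convex_fvecs)
  have SS: "Ambient \<in> ?S" "Low \<in> ?S" "High \<in> ?S" "\<And>i. i < m \<Longrightarrow> Petal i \<in> ?S"
    by (auto simp: split_base_def base_def)
  note facts = flower_code_facts[OF I]
  have LA: "Y Low \<subseteq> Y Ambient" "Y High \<subseteq> Y Ambient"
  proof -
    have "v \<in> Y Ambient" if "v \<in> Y Low \<or> v \<in> Y High" for v
    proof -
      have "v \<in> Rn d" using that cl(2) SS by blast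
      then obtain \<sigma> where "\<sigma> \<in> flower_code m I" "\<forall>\<nu>\<in>?S. v \<in> Y \<nu> \<longleftrightarrow> \<nu> \<in> \<sigma>" using words(1) by blast
      then show ?thesis using facts(10)[of \<sigma> m] that SS by blast
    qed
    then show "Y Low \<subseteq> Y Ambient" "Y High \<subseteq> Y Ambient" by blast+
  qed
  have PA: "Y (Petal i) \<subseteq> Y Ambient" if i: "i < m" for i
  proof
    fix v assume v: "v \<in> Y (Petal i)"
    then have "v \<in> Rn d" using cl(2) SS(4)[OF i] by blast
    then obtain \<sigma> where "\<sigma> \<in> flower_code m I" "\<forall>\<nu>\<in>?S. v \<in> Y \<nu> \<longleftrightarrow> \<nu> \<in> \<sigma>" using words(1) by blast
    then show "v \<in> Y Ambient" using facts(7)[of \<sigma> m i] v SS(1) SS(4)[OF i] by blast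
  qed
  have LH: "Y Low \<inter> Y High = {}"
  proof (rule equals0I)
    fix v assume v: "v \<in> Y Low \<inter> Y High"
    then have "v \<in> Rn d" using cl(2) SS by blast
    then obtain \<sigma> where "\<sigma> \<in> flower_code m I" "\<forall>\<nu>\<in>?S. v \<in> Y \<nu> \<longleftrightarrow> \<nu> \<in> \<sigma>" using words(1) by blast
    then show False using facts(9)[of \<sigma> m] v SS by blast
  qed
  have rest: "v \<in> Y (Petal i)" if v: "v \<in> Y Ambient" "v \<notin> Y Low" "v \<notin> Y High" and i: "i < m" for v i
  proof -
    have "v \<in> Rn d" using cl(2) SS(1) v by blast
    then obtain \<sigma> where s: "\<sigma> \<in> flower_code m I" "\<forall>\<nu>\<in>?S. v \<in> Y \<nu> \<longleftrightarrow> \<nu> \<in> \<sigma>" using words(1) by blast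
    then have "wall m \<subseteq> \<sigma>" using facts(8)[of \<sigma> m] v SS by blast
    then have "Petal i \<in> \<sigma>" using i by (auto simp: wall_def)
    then show ?thesis using s(2) SS(4)[OF i] by blast
  qed
  obtain l where l: "\<forall>\<nu>\<in>?S. l \<in> Y \<nu> \<longleftrightarrow> \<nu> \<in> {Ambient, Low}" using words(2)[OF flower_codeI(5)] by blast
  obtain h where h: "\<forall>\<nu>\<in>?S. h \<in> Y \<nu> \<longleftrightarrow> \<nu> \<in> {Ambient, High} \<union> wall m" using words(2)[OF flower_codeI(4)] by blast
  have lh: "l \<in> Y Low" "h \<in> Y High" using l h SS by simp_all
  have sA: "closed_segment l h \<subseteq> Y Ambient" using lh LA cl(3)[OF SS(1)] by (intro closed_segment_subset) auto
  have "\<not> closed_segment l h \<subseteq> Y Low \<union> Y High"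
    using segment_meets_both[of l h "Y Low" "Y High"] lh cl(1)[OF SS(2)] cl(1)[OF SS(3)] LH by blast
  then obtain x where x: "x \<in> Y Ambient" "x \<notin> Y Low" "x \<notin> Y High" using sA by blast
  have "\<exists>B c. finite B \<and> card B \<le> card (unitv ` {..<d}) \<and> Y Ambient \<subseteq> (+) x ` span B
      \<and> (+) x ` span B \<subseteq> span (unitv ` {..<d}) \<and> c \<in> top_of_set ((+) x ` span B) interior_of Y Ambient"
    using cl(2)[OF SS(1)] by (intro convex_interior_in_flat[OF cl(3)[OF SS(1)] x(1)]) (simp_all add: Rn_eq_span)
  then obtain B c where B: "finite B" "card B \<le> card (unitv ` {..<d})" "Y Ambient \<subseteq> (+) x ` span B"
    "(+) x ` span B \<subseteq> Rn d" "c \<in> top_of_set ((+) x ` span B) interior_of Y Ambient"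
    unfolding Rn_eq_span[symmetric] by blast
  define A where "A = (+) x ` span B"
  have "closed (Y Low \<union> Y High)" using cl(1) SS by (intro closed_Un)
  then have "open (- (Y Low \<union> Y High))" by (rule open_Compl)
  then obtain e where e: "e > 0" "ball x e \<subseteq> - (Y Low \<union> Y High)" using x by (meson ComplI UnE openE)
  define t where "t = min 1 (e / (2 * (norm (c - x) + 1)))"
  define w where "w = (1 - t) *\<^sub>R x + t *\<^sub>R c"
  have np: "norm (c - x) + 1 > 0" using norm_ge_zero[of "c - x"] by linarith
  have t: "0 < t" "t \<le> 1" using e np by (auto simp: t_def)
  have wI: "w \<in> top_of_set A interior_of Y Ambient"
    unfolding w_def by (rule interior_of_flat_mix[OF A_def cl(3)[OF SS(1)] _ _ x(1) t]) (use B in \<open>auto simp: A_def\<close>)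
  have "w - x = t *\<^sub>R (c - x)" by (simp add: w_def algebra_simps)
  then have "norm (w - x) = t * norm (c - x)" using t by simp
  also have "\<dots> \<le> t * (norm (c - x) + 1)" using t by (intro mult_left_mono) auto
  also have "\<dots> \<le> (e / (2 * (norm (c - x) + 1))) * (norm (c - x) + 1)"
    using np by (intro mult_right_mono) (auto simp: t_def)
  also have "\<dots> = e / 2" using np by (simp add: field_simps)
  finally have "dist x w < e" using e(1) by (simp add: dist_norm norm_minus_commute)
  then have wL: "w \<in> ball x e" by simp
  define G where "G = (top_of_set A interior_of Y Ambient) \<inter> ball x e"
  have "openin (top_of_set A) G" unfolding G_def by (intro openin_Int_open openin_interior_of open_ball)
  moreover have "G \<subseteq> (\<Inter>i<m. Y (Petal i))"
    using rest e(2) interior_of_subset[of "top_of_set A" "Y Ambient"] unfolding G_def by blast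
  ultimately have "G \<subseteq> top_of_set A interior_of (\<Inter>i<m. Y (Petal i))" by (intro interior_of_maximal)
  then have "w \<in> top_of_set A interior_of (\<Inter>i<m. Y (Petal i))" using wI wL unfolding G_def by blast
  moreover have "card B \<le> d" using B(2) card_image_le[of "{..<d}" unitv] by simp
  moreover have "Y (Petal i) \<subseteq> A" if "i < m" for i using PA[OF that] B(3) by (auto simp: A_def)
  ultimately show ?thesis using B(1,4) unfolding A_def Y_def by blast
qed

lemma split_base_sub: "base m n \<subseteq> split_base m n"
  by (auto simp: split_base_def)

theorem closed_split_private_bound:
  assumes "n \<ge> 2" "closed_realizable d (split_base n n) (split_code n n (private_pieces n))"
  shows "n \<le> d"
proof -
  obtain X where X: "closed_convex_realization d (split_base n n) (split_code n n (private_pieces n)) X" using assms(2) by blast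
  from split_flower_thick[OF X linked_private_pieces] obtain a B c where
    B: "finite B" "card B \<le> d" "(+) a ` span B \<subseteq> Rn d" "\<forall>i<n. fvecs (X (Petal i)) \<subseteq> (+) a ` span B"
      "c \<in> top_of_set ((+) a ` span B) interior_of (\<Inter>i<n. fvecs (X (Petal i)))" by blast
  then have "n \<le> card B" by (intro closed_private_bound[OF X split_base_sub assms(1) refl B(3,1) _ B(5)]) simp
  then show ?thesis using B(2) by linarith
qed

theorem closed_split_shared_bound:
  assumes "closed_realizable d (split_base 3 2) (split_code 3 2 shared_corner)"
  shows False
proof -
  obtain X where X: "closed_convex_realization d (split_base 3 2) (split_code 3 2 shared_corner) X" using assms by blast
  from split_flower_thick[OF X linked_shared_corner] obtain a B c where
    B: "(+) a ` span B \<subseteq> Rn d" "\<forall>i<3. fvecs (X (Petal i)) \<subseteq> (+) a ` span B"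
      "c \<in> top_of_set ((+) a ` span B) interior_of (\<Inter>i<3. fvecs (X (Petal i)))" by blast
  then show False by (intro closed_shared_bound[OF X split_base_sub refl B(1) _ B(3)]) simp
qed

theorem nd_private_bound:
  assumes n: "n \<ge> 2" and real: "nd_realizable d (base n n) (pull id (base n n) (flower_code n (private_pieces n)))"
  shows "n \<le> d"
proof -
  have "n \<ge> 1" using n by simp
  from nd_flower_thick[OF real this] obtain X c where X:
      "closed_convex_realization d (base n n) (pull id (base n n) (flower_code n (private_pieces n))) X"
      "c \<in> top_of_set (Rn d) interior_of (\<Inter>i<n. fvecs (X (Petal i)))" "\<forall>i<n. fvecs (X (Petal i)) \<subseteq> Rn d" by blast
  have R: "Rn d = (+) 0 ` span (unitv ` {..<d})" by (simp add: Rn_eq_span)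
  have "n \<le> card (unitv ` {..<d})"
    using X(3) by (intro closed_private_bound[OF X(1) subset_refl n R subset_refl _ _ X(2)]) simp_all
  then show ?thesis using card_image_le[of "{..<d}" unitv] by simp
qed

theorem nd_shared_bound:
  assumes real: "nd_realizable d (base 3 2) (pull id (base 3 2) (flower_code 3 shared_corner))"
  shows False
proof -
  have "(3::nat) \<ge> 1" by simp
  from nd_flower_thick[OF real this] obtain X c where X:
      "closed_convex_realization d (base 3 2) (pull id (base 3 2) (flower_code 3 shared_corner)) X"
      "c \<in> top_of_set (Rn d) interior_of (\<Inter>i<3. fvecs (X (Petal i)))" "\<forall>i<3. fvecs (X (Petal i)) \<subseteq> Rn d" by blast
  have R: "Rn d = (+) 0 ` span (unitv ` {..<d})" by (simp add: Rn_eq_span)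
  show False
    using X(3) by (intro closed_shared_bound[OF X(1) subset_refl R subset_refl _ X(2)]) simp
qed

section \<open>Prescribing the three dimensions\<close>

text \<open>With \<open>Link\<close> the bound \<open>a\<close> is felt by open realizations and not by closed ones; with \<open>Low\<close> and
  \<open>High\<close> it is the other way round; with neither only nondegenerate realizations feel it.\<close>

definition flower_of_dimension :: "enat \<Rightarrow> nat \<Rightarrow> nat \<Rightarrow> neuron set set \<Rightarrow> bool" where
  "flower_of_dimension a m n I \<longleftrightarrow>
     (\<forall>w\<in>I. w \<subseteq> base m n)
     \<and> (\<forall>d. a \<le> enat d \<longrightarrow> nd_closed_realizable d (full_base m n) (flower_code m I))
     \<and> (\<forall>d. a \<le> enat d \<longrightarrow> open_realizable d (full_base m n) (flower_code m I))
     \<and> (\<forall>d\<ge>2. closed_realizable d (link_base m n) (link_code m n I))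
     \<and> (\<forall>d\<ge>2. open_realizable d (split_base m n) (split_code m n I))
     \<and> (\<forall>d. open_realizable d (link_base m n) (link_code m n I) \<longrightarrow> a \<le> enat d)
     \<and> (\<forall>d. closed_realizable d (split_base m n) (split_code m n I) \<longrightarrow> a \<le> enat d)
     \<and> (\<forall>d. nd_realizable d (base m n) (pull id (base m n) (flower_code m I)) \<longrightarrow> a \<le> enat d)"

lemma flower_of_dimension_exists:
  fixes a :: enat
  assumes a: "2 \<le> a"
  shows "\<exists>m n I. flower_of_dimension a m n I"
proof (cases a)
  case (enat n)
  have "enat 2 \<le> enat n" using a unfolding enat by (simp add: numeral_eq_enat)
  then have n: "2 \<le> n" by simp
  then have n1: "1 \<le> n" by simp
  show ?thesis
    unfolding enat enat_ord_simps flower_of_dimension_def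
  proof (intro exI[of _ n] exI[of _ "private_pieces n"] conjI allI impI ballI)
    show "w \<subseteq> base n n" if "w \<in> private_pieces n" for w using that by (rule private_pieces_subset)
  qed (fact private_flower_fat_realization[OF n] private_fan_realization[OF n1] private_bend_realization[OF n]
      open_link_private_bound[OF n] closed_split_private_bound[OF n] nd_private_bound[OF n])+
next
  case infinity
  show ?thesis
    unfolding infinity flower_of_dimension_def
  proof (rule exI[of _ 3], rule exI[of _ 2], rule exI[of _ shared_corner], intro conjI allI impI ballI)
    show "w \<subseteq> base 3 2" if "w \<in> shared_corner" for w using that by (rule shared_corner_subset)
    show "\<infinity> \<le> enat d" if "open_realizable d (link_base 3 2) (link_code 3 2 shared_corner)" for d
      using open_link_shared_bound[OF that] ..
    show "\<infinity> \<le> enat d" if "closed_realizable d (split_base 3 2) (split_code 3 2 shared_corner)" for d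
      using closed_split_shared_bound[OF that] ..
    show "\<infinity> \<le> enat d" if "nd_realizable d (base 3 2) (pull id (base 3 2) (flower_code 3 shared_corner))" for d
      using nd_shared_bound[OF that] ..
  qed (simp_all add: shared_corner_fan_realization shared_corner_bend_realization)
qed

lemma pull_flower:
  "S \<subseteq> S' \<Longrightarrow> pull id S (pull id S' C) = pull id S C"
  using pull_pull[of id S S' id C] by simp

lemma full_base_sub:
  "link_base m n \<subseteq> full_base m n" "split_base m n \<subseteq> full_base m n" "base m n \<subseteq> full_base m n"
  by (auto simp: full_base_def split_base_def link_base_def)

text \<open>All planar realizations and the fat one restrict to the smaller base sets, so that each code inherits
  the realizations of the larger ones.\<close>

lemma component_codes:
  fixes a :: enat
  assumes "2 \<le> a"
  shows "\<exists>S (C :: neuron set set). is_code S C \<and> (\<forall>d. open_realizable d S C \<longrightarrow> a \<le> enat d)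
       \<and> (\<forall>d\<ge>2. closed_realizable d S C)
       \<and> (\<forall>d. a \<le> enat d \<longrightarrow> nd_closed_realizable d S C \<and> open_realizable d S C)" (is ?open)
    and "\<exists>S (C :: neuron set set). is_code S C \<and> (\<forall>d. closed_realizable d S C \<longrightarrow> a \<le> enat d)
       \<and> (\<forall>d\<ge>2. open_realizable d S C) \<and> (\<forall>d. a \<le> enat d \<longrightarrow> nd_closed_realizable d S C)" (is ?closed)
    and "\<exists>S (C :: neuron set set). is_code S C \<and> (\<forall>d. nd_realizable d S C \<longrightarrow> a \<le> enat d)
       \<and> (\<forall>d\<ge>2. open_realizable d S C \<and> closed_realizable d S C)
       \<and> (\<forall>d. a \<le> enat d \<longrightarrow> nd_closed_realizable d S C)" (is ?nd)
proof -
  obtain m n I where "flower_of_dimension a m n I" using flower_of_dimension_exists[OF assms] by blast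
  then have I: "\<forall>w\<in>I. w \<subseteq> base m n"
    and up: "\<forall>d. a \<le> enat d \<longrightarrow> nd_closed_realizable d (full_base m n) (flower_code m I)"
      "\<forall>d. a \<le> enat d \<longrightarrow> open_realizable d (full_base m n) (flower_code m I)"
    and plane: "\<forall>d\<ge>2. closed_realizable d (link_base m n) (link_code m n I)"
      "\<forall>d\<ge>2. open_realizable d (split_base m n) (split_code m n I)"
    and low: "\<forall>d. open_realizable d (link_base m n) (link_code m n I) \<longrightarrow> a \<le> enat d"
      "\<forall>d. closed_realizable d (split_base m n) (split_code m n I) \<longrightarrow> a \<le> enat d"
      "\<forall>d. nd_realizable d (base m n) (pull id (base m n) (flower_code m I)) \<longrightarrow> a \<le> enat d"
    unfolding flower_of_dimension_def by - (elim conjE, assumption)+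
  let ?F = "flower_code m I"
  have "is_code (full_base m n) ?F" using I by (intro is_code_flower) blast
  moreover have "finite (full_base m n)" by (simp add: full_base_def split_base_def base_def)
  ultimately have code: "is_code S (pull id S ?F)" if "S \<subseteq> full_base m n" for S
    using that by (intro is_code_pull) (auto intro: finite_subset)
  have pull: "id ` S \<subseteq> full_base m n" if "S \<subseteq> full_base m n" for S using that by simp
  have upS: "nd_closed_realizable d S (pull id S ?F)" "open_realizable d S (pull id S ?F)"
    if "a \<le> enat d" "S \<subseteq> full_base m n" for d S
  proof -
    note d = that(1) and S = pull[OF that(2)]
    show "nd_closed_realizable d S (pull id S ?F)" by (rule realizable_pull(3)[OF S up(1)[rule_format, OF d]])
    show "open_realizable d S (pull id S ?F)" by (rule realizable_pull(1)[OF S up(2)[rule_format, OF d]])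
  qed
  have base: "closed_realizable d (base m n) (pull id (base m n) ?F)" "open_realizable d (base m n) (pull id (base m n) ?F)"
    if "d \<ge> 2" for d
  proof -
    have i: "id ` base m n \<subseteq> link_base m n" "id ` base m n \<subseteq> split_base m n"
      using link_base_sub(1) split_base_sub by simp_all
    show "closed_realizable d (base m n) (pull id (base m n) ?F)"
      using realizable_pull(2)[OF i(1) plane(1)[rule_format, OF that]] unfolding pull_flower[OF link_base_sub(1)] .
    show "open_realizable d (base m n) (pull id (base m n) ?F)"
      using realizable_pull(1)[OF i(2) plane(2)[rule_format, OF that]] unfolding pull_flower[OF split_base_sub] .
  qed
  show ?open
    by (rule exI[of _ "link_base m n"], rule exI[of _ "link_code m n I"])
      (intro conjI low(1) plane(1) code full_base_sub allI impI upS; assumption?)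
  show ?closed
    by (rule exI[of _ "split_base m n"], rule exI[of _ "split_code m n I"])
      (intro conjI low(2) plane(2) code full_base_sub allI impI upS; assumption?)
  show ?nd
    by (rule exI[of _ "base m n"], rule exI[of _ "pull id (base m n) ?F"])
      (intro conjI low(3) base code full_base_sub allI impI upS; assumption?)
qed

theorem theorem1p9:
  fixes a b c :: enat
  assumes "2 \<le> a" and "2 \<le> b" and "2 \<le> c"
    and "max a b \<le> c"
  shows "\<exists>(S :: nat set) C. is_code S C \<and> embedding_dimension_vector S C = (a, b, c)"
proof -
  obtain S0 and C0 :: "neuron set set" where P: "is_code S0 C0" "\<forall>d. open_realizable d S0 C0 \<longrightarrow> a \<le> enat d"
    "\<forall>d\<ge>2. closed_realizable d S0 C0" "\<forall>d. a \<le> enat d \<longrightarrow> nd_closed_realizable d S0 C0 \<and> open_realizable d S0 C0"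
    using component_codes(1)[OF assms(1)] by blast
  obtain S1 and C1 :: "neuron set set" where Q: "is_code S1 C1" "\<forall>d. closed_realizable d S1 C1 \<longrightarrow> b \<le> enat d"
    "\<forall>d\<ge>2. open_realizable d S1 C1" "\<forall>d. b \<le> enat d \<longrightarrow> nd_closed_realizable d S1 C1"
    using component_codes(2)[OF assms(2)] by blast
  obtain S2 and C2 :: "neuron set set" where R: "is_code S2 C2" "\<forall>d. nd_realizable d S2 C2 \<longrightarrow> c \<le> enat d"
    "\<forall>d\<ge>2. open_realizable d S2 C2 \<and> closed_realizable d S2 C2" "\<forall>d. c \<le> enat d \<longrightarrow> nd_closed_realizable d S2 C2"
    using component_codes(3)[OF assms(3)] by blast
  define S where "S k = (if k = 0 then S0 else if k = 1 then S1 else S2)" for k :: nat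
  define C where "C k = (if k = 0 then C0 else if k = 1 then C1 else C2)" for k :: nat
  let ?K = "{..<3::nat}"
  let ?U = "Sigma ?K S" and ?D = "disjoint_code ?K C"
  have codes: "is_code (S k) (C k)" if "k \<in> ?K" for k using P(1) Q(1) R(1) by (simp add: S_def C_def)
  have K: "finite ?K" by simp
  have every: "Q (S0) C0 \<and> Q S1 C1 \<and> Q S2 C2 \<Longrightarrow> Q (S k) (C k)" for Q :: "neuron set \<Rightarrow> neuron set set \<Rightarrow> bool" and k
    by (simp add: S_def C_def)
  have two: "2 \<le> d \<and> 1 \<le> d" if "x \<le> enat d" "2 \<le> x" for x d
  proof -
    have "enat 2 \<le> enat d" using that by (metis numeral_eq_enat order_trans)
    then show ?thesis by simp
  qed
  have part: "Pair k ` S k \<subseteq> ?U" "pull (Pair k) (S k) ?D = C k" if "k < 3" for k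
    using that pull_disjoint_code[of k ?K S C] codes by auto
  have OR: "open_realizable d ?U ?D \<longleftrightarrow> a \<le> enat d" for d
  proof
    assume "open_realizable d ?U ?D"
    then have "open_realizable d (S 0) (C 0)" using realizable_pull(1)[OF part(1)[of 0], of d ?D] part(2)[of 0] by simp
    then show "a \<le> enat d" using P(2) by (simp add: S_def C_def)
  next
    assume a: "a \<le> enat d"
    note d = two[OF a assms(1)]
    have "open_realizable d (S k) (C k)" for k
      by (rule every) (use P(4) Q(3) R(3) a d in blast)
    then show "open_realizable d ?U ?D" using d codes by (intro realizable_disjoint_code(1)) auto
  qed
  have CR: "closed_realizable d ?U ?D \<longleftrightarrow> b \<le> enat d" for d
  proof
    assume "closed_realizable d ?U ?D"
    then have "closed_realizable d (S 1) (C 1)" using realizable_pull(2)[OF part(1)[of 1], of d ?D] part(2)[of 1] by simp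
    then show "b \<le> enat d" using Q(2) by (simp add: S_def C_def)
  next
    assume b: "b \<le> enat d"
    note d = two[OF b assms(2)]
    have "closed_realizable d (S k) (C k)" for k
      by (rule every) (use P(3) Q(4) R(3) b d in blast)
    then show "closed_realizable d ?U ?D" using d codes by (intro realizable_disjoint_code(2)) auto
  qed
  have NR: "nd_realizable d ?U ?D \<longleftrightarrow> c \<le> enat d" for d
  proof
    assume "nd_realizable d ?U ?D"
    then have "nd_realizable d (S 2) (C 2)" using realizable_pull(4)[OF part(1)[of 2], of d ?D] part(2)[of 2] by simp
    moreover have "S 2 = S2" "C 2 = C2" by (simp_all add: S_def C_def)
    ultimately have "nd_realizable d S2 C2" by (simp only:)
    then show "c \<le> enat d" using R(2) by blast
  next
    assume c: "c \<le> enat d"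
    have ab: "a \<le> enat d" "b \<le> enat d" using c assms(4) by auto
    note d = two[OF c assms(3)]
    have "nd_closed_realizable d (S k) (C k)" for k
      by (rule every) (use P(4) Q(4) R(4) ab c in blast)
    then have "nd_closed_realizable d ?U ?D" using d codes by (intro realizable_disjoint_code(3)) auto
    then show "nd_realizable d ?U ?D" by blast
  qed
  show ?thesis
  proof (rule relabel_nat[OF is_code_disjoint[OF K codes]])
    fix S' :: "nat set" and C'
    assume code: "is_code S' C'"
      and O: "\<And>d. open_realizable d S' C' \<longleftrightarrow> open_realizable d ?U ?D"
      and C: "\<And>d. closed_realizable d S' C' \<longleftrightarrow> closed_realizable d ?U ?D"
      and N: "\<And>d. nd_realizable d S' C' \<longleftrightarrow> nd_realizable d ?U ?D"
    have "odim S' C' = a" unfolding odim_def by (rule Inf_dimensions) (simp only: O OR)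
    moreover have "cdim S' C' = b" unfolding cdim_def by (rule Inf_dimensions) (simp only: C CR)
    moreover have "nddim S' C' = c" unfolding nddim_def by (rule Inf_dimensions) (simp only: N NR)
    ultimately show ?thesis
      using code by (intro exI[of _ S'] exI[of _ C']) (simp add: embedding_dimension_vector_def)
  qed
qed

end
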